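(* Let $E$ be a regular Courant algebroid with ample Lie algebroid $A_E$, characteristic distribution $F$ and $B=TM/F$. The $C^\infty(M)$-linear map $d_T\colon\Gamma(B[-2])\to C^3(A_E)$ attached to a dissection $\Psi$ of $E$ and a triple $(j,\nabla^F,\nabla^B)$, viewed as an element of $C^3(A_E;B^*[2])$, is a $3$-cocycle of the Lie algebroid $A_E$ with values in $B^*[2]$. Furthermore, the cohomology class $[d_T]\in H^3_{\mathrm{CE}}(A_E;B^*[2])$ is canonical, i.e. independent of the choice of the triple $(j,\nabla^F,\nabla^B)$ and of the dissection $\Psi$.
   Context: **Courant algebroids.** A Courant algebroid $(E,g,\rho,\circ)$ over a connected smooth manifold $M$ is a vector bundle $E\to M$ with a fiberwise nondegenerate symmetric pseudo-metric $g$, a bundle map $\rho\colon E\to TM$ and an $\mathbb R$-bilinear operation $\circ$ on $\Gamma(E)$ such that for $e_i\in\Gamma(E)$, $f\in C^\infty(M)$: $e_1\circ(fe_2)=(\rho(e_1)f)e_2+f\,e_1\circ e_2$; $\rho(e_1)g(e_2,e_3)=g(e_1\circ e_2,e_3)+g(e_2,e_1\circ e_3)$; $e_1\circ e_1=\frac12\rho^*d(g(e_1,e_1))$ (with $E^*\cong E$ via $g$); $e_1\circ(e_2\circ e_3)=(e_1\circ e_2)\circ e_3+e_2\circ(e_1\circ e_3)$. Regular means $\rho$ has constant rank; then $F:=\rho(E)$ is the characteristic distribution, $B:=TM/F$, $(\ker\rho)^\perp\subseteq\ker\rho$, and $A_E:=E/(\ker\rho)^\perp$ with induced anchor and bracket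 is the ample Lie algebroid; $C^\bullet(A_E;V)=\Gamma(\wedge^\bullet A_E^*\otimes V)$ for an $A_E$-module $V$, with usual Chevalley–Eilenberg differential. **Dissection and triple.** $\mathcal G=\ker\rho/(\ker\rho)^\perp$ has the fiberwise Lie bracket induced by $\circ$ and the pseudo-metric $g^{\mathcal G}$ induced by $g$. A dissection is an isomorphism $\Psi\colon F^*\oplus\mathcal G\oplus F\to E$ of pseudo-Euclidean bundles, the source having metric $\langle\xi+r+x,\eta+s+y\rangle=\frac12\langle\xi|y\rangle+\frac12\langle\eta|x\rangle+g^{\mathcal G}(r,s)$; identify the bundles, so $A_E\cong F\oplus\mathcal G$. Put $\nabla^{\mathcal G}_xr=\mathrm{pr}_{\mathcal G}(x\circ r)$ for $x\in\Gamma(F)$, $r\in\Gamma(\mathcal G)$. A triple $(j,\nabla^F,\nabla^B)$ consists of a splitting $j\colon B\to TM$ of $\mathrm{pr}_B\colon TM\to B$ (so $TM=F\oplus j(B)$, with projection $\mathrm{pr}_F$ onto $F$), a torsion-free $F$-connection $\nabla^F$ on $F$, and a $B$-connection $\nabla^B$ on $\mathcal G$ (derivations along $j(b)$) preserving $g^{\mathcal G}$. Extend $\nabla^F$ to $F^*$ by duality, $\nabla^B$ to $F$ by $\nabla^B_bx=\mathrm{pr}_F[j(b),x]$ and to $F^*$ by duality. The associated ($\Psi$-compatible) metric connection on $E$ is $\nabla=\nabla^F+\nabla^{\mathcal G}+\nabla^B$: along $x_0\in\Gamma(F)$ it is $\nabla^F$ on $F\oplus F^*$ and $\nabla^{\mathcal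 G}$ on $\mathcal G$; along $j(b)$ it is $\nabla^B$. Its torsion is $C_\nabla(e_1,e_2,e_3)=\frac12\mathrm{cycl}_{123}\,g\big(\frac13(e_1\circ e_2-e_2\circ e_1)-(\nabla_{\rho(e_1)}e_2-\nabla_{\rho(e_2)}e_1),e_3\big)$ (sum over cyclic permutations), which is an element of $C^3(A_E)$. **The map $d_T$.** $d_T(b[-2]):=R^\nabla(\tilde\rho[2],j(b)[-2])-\nabla_{j(b)}C_\nabla\in C^3(A_E)$ for $b\in\Gamma(B)$, where $R^\nabla(\tilde\rho[2],j(b)[-2])\in\Gamma(F^*\otimes\wedge^2\mathcal G^* )\subset C^3(A_E)$ has value $g^{\mathcal G}(R^\nabla(x,j(b))r,s)$ on $(x,r,s)$ for $x\in\Gamma(F)$, $r,s\in\Gamma(\mathcal G)$, with $R^\nabla$ the curvature of $\nabla$, and $\nabla_{j(b)}C_\nabla$ is the covariant derivative. **Module structure.** $B$ is an $A_E$-module through the Bott connection: $\widetilde\nabla_ab=\mathrm{pr}_B[\rho(a),\tilde b]$ with $\tilde b\in\Gamma(TM)$ any lift of $b$; $B^*[2]$ is its (shifted) dual module. *)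

theory Defs
  imports "HOL-Analysis.Analysis" "HOL-Library.Function_Algebras"
begin

text \<open>
  Functions into a real vector space carry the pointwise vector space structure. It is used for
  sections of bundles, for functionals, and for cochains.
\<close>

instantiation "fun" :: (type, scaleR) scaleR
begin
definition scaleR_fun :: "real \<Rightarrow> ('a \<Rightarrow> 'b) \<Rightarrow> 'a \<Rightarrow> 'b" where
  "scaleR_fun c f = (\<lambda>x. c *\<^sub>R f x)"
instance ..
end

instance "fun" :: (type, real_vector) real_vector
  by standard (simp_all add: scaleR_fun_def fun_eq_iff algebra_simps)

section \<open>Smooth manifolds\<close>

primrec times_differentiable_on ::
  "nat \<Rightarrow> 'a::real_normed_vector set \<Rightarrow> ('a \<Rightarrow> 'b::real_normed_vector) \<Rightarrow> bool" where
  "times_differentiable_on 0 S f \<longleftrightarrow> continuous_on S f"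
| "times_differentiable_on (Suc n) S f \<longleftrightarrow>
     (\<forall>x\<in>S. f differentiable (at x)) \<and>
     (\<forall>v. times_differentiable_on n S (\<lambda>x. frechet_derivative f (at x) v))"

text \<open>Only used for open sets of a finite-dimensional space.\<close>

definition C_infinity_on :: "'a::real_normed_vector set \<Rightarrow> ('a \<Rightarrow> 'b::real_normed_vector) \<Rightarrow> bool" where
  "C_infinity_on S f \<longleftrightarrow> (\<forall>n. times_differentiable_on n S f)"

text \<open>
  The manifold is the whole type \<open>'m\<close>, with an atlas \<open>M\<close> (not necessarily maximal) of charts
  \<open>(U, \<phi>)\<close> with values in a finite-dimensional space \<open>'a\<close>. The type \<open>'a\<close> is not required to be of
  class \<open>euclidean_space\<close>, since this would exclude dimension zero.
\<close>

type_synonym ('m, 'a) atlas = "('m set \<times> ('m \<Rightarrow> 'a)) set"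

definition smooth_manifold ::
  "('m::{t2_space, second_countable_topology}, 'a::real_normed_vector) atlas \<Rightarrow> bool" where
  "smooth_manifold M \<longleftrightarrow>
     (\<exists>B::'a set. finite B \<and> span B = UNIV) \<and>
     (\<Union>(U, \<phi>)\<in>M. U) = UNIV \<and>
     (\<forall>(U, \<phi>)\<in>M. open U \<and> open (\<phi> ` U) \<and> homeomorphism U (\<phi> ` U) \<phi> (inv_into U \<phi>)) \<and>
     (\<forall>(U, \<phi>)\<in>M. \<forall>(V, \<psi>)\<in>M. C_infinity_on (\<phi> ` (U \<inter> V)) (\<psi> \<circ> inv_into U \<phi>))"

definition smooth_fun_on ::
  "('m::topological_space, 'a::real_normed_vector) atlas \<Rightarrow> 'm set \<Rightarrow> ('m \<Rightarrow> real) \<Rightarrow> bool" where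
  "smooth_fun_on M W f \<longleftrightarrow> (\<forall>(U, \<phi>)\<in>M. C_infinity_on (\<phi> ` (U \<inter> W)) (f \<circ> inv_into U \<phi>))"

definition Cinf :: "('m::topological_space, 'a::real_normed_vector) atlas \<Rightarrow> ('m \<Rightarrow> real) set" where
  "Cinf M = {f. smooth_fun_on M UNIV f}"


section \<open>Vector bundles\<close>

text \<open>
  A vector bundle is given by its fibres, which are subspaces of an ambient real vector space
  \<open>'v\<close> (different fibres are unrelated), and by the set of its smooth global sections.
\<close>

record ('m, 'v) vbundle =
  fiber :: "'m \<Rightarrow> 'v set"
  sections :: "('m \<Rightarrow> 'v) set"

definition frame_on ::
  "('m, 'v::real_vector) vbundle \<Rightarrow> 'm set \<Rightarrow> nat \<Rightarrow> (nat \<Rightarrow> 'm \<Rightarrow> 'v) \<Rightarrow> bool" where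
  "frame_on V U r e \<longleftrightarrow>
     (\<forall>i<r. e i \<in> sections V) \<and>
     (\<forall>p\<in>U. inj_on (\<lambda>i. e i p) {..<r} \<and> independent ((\<lambda>i. e i p) ` {..<r}) \<and>
            span ((\<lambda>i. e i p) ` {..<r}) = fiber V p)"

text \<open>
  Local triviality: every point has a neighbourhood framed by (restrictions of) smooth sections,
  and a family of fibre elements is a smooth section iff its coefficients in all such local frames
  are smooth. In particular, transition functions between local frames are smooth.
\<close>

definition vector_bundle ::
  "('m::topological_space, 'a::real_normed_vector) atlas \<Rightarrow> ('m, 'v::real_vector) vbundle \<Rightarrow> bool" where
  "vector_bundle M V \<longleftrightarrow>
     (\<forall>p. subspace (fiber V p)) \<and>
     (\<forall>p. \<exists>U r e. open U \<and> p \<in> U \<and> frame_on V U r e) \<and>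
     (\<forall>s. s \<in> sections V \<longleftrightarrow>
        (\<forall>p. s p \<in> fiber V p) \<and>
        (\<forall>U r e c. open U \<and> frame_on V U r e \<and> (\<forall>p\<in>U. s p = (\<Sum>i<r. c i p *\<^sub>R e i p)) \<longrightarrow>
                   (\<forall>i<r. smooth_fun_on M U (c i))))"

definition fscale :: "('m \<Rightarrow> real) \<Rightarrow> ('m \<Rightarrow> 'v::real_vector) \<Rightarrow> 'm \<Rightarrow> 'v"  (infixr "\<odot>" 75) where
  "f \<odot> s = (\<lambda>p. f p *\<^sub>R s p)"

definition on_sec :: "('m \<Rightarrow> 'v \<Rightarrow> 'w) \<Rightarrow> ('m \<Rightarrow> 'v) \<Rightarrow> 'm \<Rightarrow> 'w" where
  "on_sec \<phi> s = (\<lambda>p. \<phi> p (s p))"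

definition bundle_map ::
  "('m, 'v::real_vector) vbundle \<Rightarrow> ('m, 'w::real_vector) vbundle \<Rightarrow> ('m \<Rightarrow> 'v \<Rightarrow> 'w) \<Rightarrow> bool" where
  "bundle_map V W \<phi> \<longleftrightarrow>
     (\<forall>p. \<forall>u\<in>fiber V p. \<phi> p u \<in> fiber W p) \<and>
     (\<forall>p. \<forall>u\<in>fiber V p. \<forall>v\<in>fiber V p. \<phi> p (u + v) = \<phi> p u + \<phi> p v) \<and>
     (\<forall>p c. \<forall>u\<in>fiber V p. \<phi> p (c *\<^sub>R u) = c *\<^sub>R \<phi> p u) \<and>
     (\<forall>s\<in>sections V. on_sec \<phi> s \<in> sections W)"

definition inv_map :: "('m, 'v) vbundle \<Rightarrow> ('m \<Rightarrow> 'v \<Rightarrow> 'w) \<Rightarrow> 'm \<Rightarrow> 'w \<Rightarrow> 'v" where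
  "inv_map V \<phi> = (\<lambda>p. inv_into (fiber V p) (\<phi> p))"

definition bundle_iso ::
  "('m, 'v::real_vector) vbundle \<Rightarrow> ('m, 'w::real_vector) vbundle \<Rightarrow> ('m \<Rightarrow> 'v \<Rightarrow> 'w) \<Rightarrow> bool" where
  "bundle_iso V W \<phi> \<longleftrightarrow>
     bundle_map V W \<phi> \<and> (\<forall>p. bij_betw (\<phi> p) (fiber V p) (fiber W p)) \<and>
     bundle_map W V (inv_map V \<phi>)"

definition subbundle :: "('m, 'v) vbundle \<Rightarrow> ('m \<Rightarrow> 'v set) \<Rightarrow> ('m, 'v) vbundle" where
  "subbundle V D = \<lparr>fiber = D, sections = {s \<in> sections V. \<forall>p. s p \<in> D p}\<rparr>"

text \<open>Functionals on a fibre are extended by zero to all of \<open>'v\<close>.\<close>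

definition dual_bundle ::
  "('m::topological_space, 'a::real_normed_vector) atlas \<Rightarrow> ('m, 'v::real_vector) vbundle
   \<Rightarrow> ('m, 'v \<Rightarrow> real) vbundle" where
  "dual_bundle M V =
     (let D = (\<lambda>p. {\<xi>. (\<forall>u\<in>fiber V p. \<forall>v\<in>fiber V p. \<xi> (u + v) = \<xi> u + \<xi> v) \<and>
                        (\<forall>c. \<forall>u\<in>fiber V p. \<xi> (c *\<^sub>R u) = c * \<xi> u) \<and>
                        (\<forall>u. u \<notin> fiber V p \<longrightarrow> \<xi> u = 0)})
      in \<lparr>fiber = D,
          sections = {\<xi>. (\<forall>p. \<xi> p \<in> D p) \<and> (\<forall>s\<in>sections V. on_sec \<xi> s \<in> Cinf M)}\<rparr>)"

definition direct_sum3 ::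
  "('m, 'u) vbundle \<Rightarrow> ('m, 'v) vbundle \<Rightarrow> ('m, 'w) vbundle \<Rightarrow> ('m, 'u \<times> 'v \<times> 'w) vbundle" where
  "direct_sum3 U V W =
     \<lparr>fiber = (\<lambda>p. fiber U p \<times> fiber V p \<times> fiber W p),
      sections = {s. (\<lambda>p. fst (s p)) \<in> sections U \<and> (\<lambda>p. fst (snd (s p))) \<in> sections V \<and>
                     (\<lambda>p. snd (snd (s p))) \<in> sections W}\<rparr>"

text \<open>
  \<open>Q\<close> with \<open>\<pi>\<close> is the quotient bundle of \<open>V\<close> by the subbundle with fibres \<open>D\<close>. Such a pair is unique
  up to a unique isomorphism. A quotient is given by such a pair, and not by cosets, because the
  fibres have to be subspaces of a type of class \<open>real_vector\<close>.
\<close>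

definition quotient_bundle ::
  "('m::topological_space, 'a::real_normed_vector) atlas \<Rightarrow> ('m, 'v::real_vector) vbundle
   \<Rightarrow> ('m \<Rightarrow> 'v set) \<Rightarrow> ('m, 'w::real_vector) vbundle \<Rightarrow> ('m \<Rightarrow> 'v \<Rightarrow> 'w) \<Rightarrow> bool" where
  "quotient_bundle M V D Q \<pi> \<longleftrightarrow>
     vector_bundle M Q \<and> bundle_map V Q \<pi> \<and>
     (\<forall>p. \<pi> p ` fiber V p = fiber Q p) \<and>
     (\<forall>p. {u \<in> fiber V p. \<pi> p u = 0} = D p) \<and>
     on_sec \<pi> ` sections V = sections Q"

definition lift_fib :: "('m, 'v) vbundle \<Rightarrow> ('m \<Rightarrow> 'v \<Rightarrow> 'w) \<Rightarrow> 'm \<Rightarrow> 'w \<Rightarrow> 'v" where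
  "lift_fib V \<pi> p u = (SOME v. v \<in> fiber V p \<and> \<pi> p v = u)"

definition lift_sec :: "('m, 'v) vbundle \<Rightarrow> ('m \<Rightarrow> 'v \<Rightarrow> 'w) \<Rightarrow> ('m \<Rightarrow> 'w) \<Rightarrow> 'm \<Rightarrow> 'v" where
  "lift_sec V \<pi> s = (SOME t. t \<in> sections V \<and> on_sec \<pi> t = s)"

definition smooth_pairing ::
  "('m::topological_space, 'a::real_normed_vector) atlas \<Rightarrow> ('m, 'v::real_vector) vbundle
   \<Rightarrow> ('m \<Rightarrow> 'v \<Rightarrow> 'v \<Rightarrow> real) \<Rightarrow> bool" where
  "smooth_pairing M V g \<longleftrightarrow>
     (\<forall>p. \<forall>u\<in>fiber V p. \<forall>v\<in>fiber V p. \<forall>w\<in>fiber V p.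
        g p (u + v) w = g p u w + g p v w \<and> g p u (v + w) = g p u v + g p u w) \<and>
     (\<forall>p c. \<forall>u\<in>fiber V p. \<forall>v\<in>fiber V p. g p (c *\<^sub>R u) v = c * g p u v \<and> g p u (c *\<^sub>R v) = c * g p u v) \<and>
     (\<forall>s\<in>sections V. \<forall>t\<in>sections V. (\<lambda>p. g p (s p) (t p)) \<in> Cinf M)"

definition pseudo_metric ::
  "('m::topological_space, 'a::real_normed_vector) atlas \<Rightarrow> ('m, 'v::real_vector) vbundle
   \<Rightarrow> ('m \<Rightarrow> 'v \<Rightarrow> 'v \<Rightarrow> real) \<Rightarrow> bool" where
  "pseudo_metric M V g \<longleftrightarrow>
     smooth_pairing M V g \<and>
     (\<forall>p. \<forall>u\<in>fiber V p. \<forall>v\<in>fiber V p. g p u v = g p v u) \<and>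
     (\<forall>p. \<forall>u\<in>fiber V p. (\<forall>v\<in>fiber V p. g p u v = 0) \<longrightarrow> u = 0)"

definition met :: "('m \<Rightarrow> 'v \<Rightarrow> 'v \<Rightarrow> real) \<Rightarrow> ('m \<Rightarrow> 'v) \<Rightarrow> ('m \<Rightarrow> 'v) \<Rightarrow> 'm \<Rightarrow> real" where
  "met g s t = (\<lambda>p. g p (s p) (t p))"


section \<open>The tangent bundle\<close>

text \<open>
  Tangent vectors at \<open>p\<close> are the derivations at \<open>p\<close> of the algebra of smooth functions, extended by
  zero to non-smooth functions.
\<close>

type_synonym 'm tvec = "('m \<Rightarrow> real) \<Rightarrow> real"

definition tangent_space ::
  "('m::topological_space, 'a::real_normed_vector) atlas \<Rightarrow> 'm \<Rightarrow> 'm tvec set" where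
  "tangent_space M p =
     {v. (\<forall>f\<in>Cinf M. \<forall>h\<in>Cinf M. v (f + h) = v f + v h \<and> v (f * h) = f p * v h + h p * v f) \<and>
         (\<forall>c. \<forall>f\<in>Cinf M. v (c *\<^sub>R f) = c * v f) \<and>
         (\<forall>f. f \<notin> Cinf M \<longrightarrow> v f = 0)}"

definition der :: "('m \<Rightarrow> 'm tvec) \<Rightarrow> ('m \<Rightarrow> real) \<Rightarrow> 'm \<Rightarrow> real" where
  "der X f = (\<lambda>p. X p f)"

definition tangent_bundle ::
  "('m::topological_space, 'a::real_normed_vector) atlas \<Rightarrow> ('m, 'm tvec) vbundle" where
  "tangent_bundle M =
     \<lparr>fiber = tangent_space M,
      sections = {X. (\<forall>p. X p \<in> tangent_space M p) \<and> (\<forall>f\<in>Cinf M. der X f \<in> Cinf M)}\<rparr>"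

definition lie_bracket :: "('m \<Rightarrow> 'm tvec) \<Rightarrow> ('m \<Rightarrow> 'm tvec) \<Rightarrow> 'm \<Rightarrow> 'm tvec" where
  "lie_bracket X Y = (\<lambda>p f. X p (der Y f) - Y p (der X f))"

text \<open>
  \<open>nab\<close> is a connection on \<open>W\<close> along \<open>V\<close>; a section \<open>v\<close> of \<open>V\<close> acts on functions through the vector
  field \<open>on_sec \<alpha> v\<close>.
\<close>

definition connection ::
  "('m::topological_space, 'a::real_normed_vector) atlas \<Rightarrow> ('m, 'v::real_vector) vbundle
   \<Rightarrow> ('m \<Rightarrow> 'v \<Rightarrow> 'm tvec) \<Rightarrow> ('m, 'w::real_vector) vbundle
   \<Rightarrow> (('m \<Rightarrow> 'v) \<Rightarrow> ('m \<Rightarrow> 'w) \<Rightarrow> 'm \<Rightarrow> 'w) \<Rightarrow> bool" where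
  "connection M V \<alpha> W nab \<longleftrightarrow>
     (\<forall>v\<in>sections V. \<forall>w\<in>sections W. nab v w \<in> sections W) \<and>
     (\<forall>v\<in>sections V. \<forall>v'\<in>sections V. \<forall>w\<in>sections W. nab (v + v') w = nab v w + nab v' w) \<and>
     (\<forall>v\<in>sections V. \<forall>w\<in>sections W. \<forall>w'\<in>sections W. nab v (w + w') = nab v w + nab v w') \<and>
     (\<forall>f\<in>Cinf M. \<forall>v\<in>sections V. \<forall>w\<in>sections W.
        nab (f \<odot> v) w = f \<odot> nab v w \<and>
        nab v (f \<odot> w) = der (on_sec \<alpha> v) f \<odot> w + f \<odot> nab v w)"


section \<open>Courant algebroids\<close>

record ('m, 'e) courant =
  bun :: "('m, 'e) vbundle"
  metric :: "'m \<Rightarrow> 'e \<Rightarrow> 'e \<Rightarrow> real"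
  anchor :: "'m \<Rightarrow> 'e \<Rightarrow> 'm tvec"
  brac :: "('m \<Rightarrow> 'e) \<Rightarrow> ('m \<Rightarrow> 'e) \<Rightarrow> 'm \<Rightarrow> 'e"

abbreviation Sec :: "('m, 'e) courant \<Rightarrow> ('m \<Rightarrow> 'e) set" where
  "Sec C \<equiv> sections (bun C)"

abbreviation anc :: "('m, 'e) courant \<Rightarrow> ('m \<Rightarrow> 'e) \<Rightarrow> 'm \<Rightarrow> 'm tvec" where
  "anc C e \<equiv> on_sec (anchor C) e"

text \<open>
  The axiom for \<open>e \<circ> e\<close> is paired with an arbitrary section \<open>e'\<close>: by definition of the identification
  of \<open>E\<^sup>*\<close> with \<open>E\<close> through the metric, \<open>\<rho>\<^sup>*df\<close> is the section with \<open>g(\<rho>\<^sup>*df, e') = \<rho>(e')f\<close>.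
\<close>

definition courant_algebroid ::
  "('m::topological_space, 'a::real_normed_vector) atlas \<Rightarrow> ('m, 'e::real_vector) courant \<Rightarrow> bool" where
  "courant_algebroid M C \<longleftrightarrow>
     vector_bundle M (bun C) \<and> pseudo_metric M (bun C) (metric C) \<and>
     bundle_map (bun C) (tangent_bundle M) (anchor C) \<and>
     (\<forall>e\<^sub>1\<in>Sec C. \<forall>e\<^sub>2\<in>Sec C. brac C e\<^sub>1 e\<^sub>2 \<in> Sec C) \<and>
     (\<forall>e\<^sub>1\<in>Sec C. \<forall>e\<^sub>2\<in>Sec C. \<forall>e\<^sub>3\<in>Sec C.
        brac C (e\<^sub>1 + e\<^sub>2) e\<^sub>3 = brac C e\<^sub>1 e\<^sub>3 + brac C e\<^sub>2 e\<^sub>3 \<and>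
        brac C e\<^sub>1 (e\<^sub>2 + e\<^sub>3) = brac C e\<^sub>1 e\<^sub>2 + brac C e\<^sub>1 e\<^sub>3) \<and>
     (\<forall>c. \<forall>e\<^sub>1\<in>Sec C. \<forall>e\<^sub>2\<in>Sec C.
        brac C (c *\<^sub>R e\<^sub>1) e\<^sub>2 = c *\<^sub>R brac C e\<^sub>1 e\<^sub>2 \<and> brac C e\<^sub>1 (c *\<^sub>R e\<^sub>2) = c *\<^sub>R brac C e\<^sub>1 e\<^sub>2) \<and>
     (\<forall>f\<in>Cinf M. \<forall>e\<^sub>1\<in>Sec C. \<forall>e\<^sub>2\<in>Sec C.
        brac C e\<^sub>1 (f \<odot> e\<^sub>2) = der (anc C e\<^sub>1) f \<odot> e\<^sub>2 + f \<odot> brac C e\<^sub>1 e\<^sub>2) \<and>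
     (\<forall>e\<^sub>1\<in>Sec C. \<forall>e\<^sub>2\<in>Sec C. \<forall>e\<^sub>3\<in>Sec C.
        der (anc C e\<^sub>1) (met (metric C) e\<^sub>2 e\<^sub>3) =
          met (metric C) (brac C e\<^sub>1 e\<^sub>2) e\<^sub>3 + met (metric C) e\<^sub>2 (brac C e\<^sub>1 e\<^sub>3)) \<and>
     (\<forall>e\<in>Sec C. \<forall>e'\<in>Sec C.
        met (metric C) (brac C e e) e' = (1/2) *\<^sub>R der (anc C e') (met (metric C) e e)) \<and>
     (\<forall>e\<^sub>1\<in>Sec C. \<forall>e\<^sub>2\<in>Sec C. \<forall>e\<^sub>3\<in>Sec C.
        brac C e\<^sub>1 (brac C e\<^sub>2 e\<^sub>3) = brac C (brac C e\<^sub>1 e\<^sub>2) e\<^sub>3 + brac C e\<^sub>2 (brac C e\<^sub>1 e\<^sub>3))"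

definition regular :: "('m, 'e::real_vector) courant \<Rightarrow> bool" where
  "regular C \<longleftrightarrow> (\<exists>k. \<forall>p. dim (anchor C p ` fiber (bun C) p) = k)"

definition char_dist ::
  "('m::topological_space, 'a::real_normed_vector) atlas \<Rightarrow> ('m, 'e) courant \<Rightarrow> ('m, 'm tvec) vbundle" where
  "char_dist M C = subbundle (tangent_bundle M) (\<lambda>p. anchor C p ` fiber (bun C) p)"

definition ker_anchor :: "('m, 'e) courant \<Rightarrow> 'm \<Rightarrow> 'e set" where
  "ker_anchor C p = {u \<in> fiber (bun C) p. anchor C p u = 0}"

definition ker_perp :: "('m, 'e) courant \<Rightarrow> 'm \<Rightarrow> 'e set" where
  "ker_perp C p = {u \<in> fiber (bun C) p. \<forall>v\<in>ker_anchor C p. metric C p u v = 0}"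

text \<open>
  The three quotients \<open>A\<^sub>E = E / (ker \<rho>)\<^sup>\<bottom>\<close>, \<open>\<G> = ker \<rho> / (ker \<rho>)\<^sup>\<bottom>\<close> and \<open>B = TM / F\<close> with their
  projections.
\<close>

record ('m, 'e, 'w, 'g, 'b) quots =
  A_bun :: "('m, 'w) vbundle"
  A_pr :: "'m \<Rightarrow> 'e \<Rightarrow> 'w"
  G_bun :: "('m, 'g) vbundle"
  G_pr :: "'m \<Rightarrow> 'e \<Rightarrow> 'g"
  B_bun :: "('m, 'b) vbundle"
  B_pr :: "'m \<Rightarrow> 'm tvec \<Rightarrow> 'b"

definition quotients_of ::
  "('m::topological_space, 'a::real_normed_vector) atlas \<Rightarrow> ('m, 'e::real_vector) courant
   \<Rightarrow> ('m, 'e, 'w::real_vector, 'g::real_vector, 'b::real_vector) quots \<Rightarrow> bool" where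
  "quotients_of M C Q \<longleftrightarrow>
     quotient_bundle M (bun C) (ker_perp C) (A_bun Q) (A_pr Q) \<and>
     quotient_bundle M (subbundle (bun C) (ker_anchor C)) (ker_perp C) (G_bun Q) (G_pr Q) \<and>
     quotient_bundle M (tangent_bundle M) (fiber (char_dist M C)) (B_bun Q) (B_pr Q)"

definition ample_anchor ::
  "('m, 'e) courant \<Rightarrow> ('m, 'e, 'w, 'g, 'b) quots \<Rightarrow> ('m \<Rightarrow> 'w) \<Rightarrow> 'm \<Rightarrow> 'm tvec" where
  "ample_anchor C Q a = anc C (lift_sec (bun C) (A_pr Q) a)"

definition ample_bracket ::
  "('m, 'e) courant \<Rightarrow> ('m, 'e, 'w, 'g, 'b) quots \<Rightarrow> ('m \<Rightarrow> 'w) \<Rightarrow> ('m \<Rightarrow> 'w) \<Rightarrow> 'm \<Rightarrow> 'w" where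
  "ample_bracket C Q a a' =
     on_sec (A_pr Q) (brac C (lift_sec (bun C) (A_pr Q) a) (lift_sec (bun C) (A_pr Q) a'))"

definition bott ::
  "('m::topological_space, 'a::real_normed_vector) atlas \<Rightarrow> ('m, 'e) courant
   \<Rightarrow> ('m, 'e, 'w, 'g, 'b) quots \<Rightarrow> ('m \<Rightarrow> 'w) \<Rightarrow> ('m \<Rightarrow> 'b) \<Rightarrow> 'm \<Rightarrow> 'b" where
  "bott M C Q a b =
     on_sec (B_pr Q) (lie_bracket (ample_anchor C Q a) (lift_sec (tangent_bundle M) (B_pr Q) b))"

definition G_metric ::
  "('m, 'e) courant \<Rightarrow> ('m, 'e, 'w, 'g, 'b) quots \<Rightarrow> 'm \<Rightarrow> 'g \<Rightarrow> 'g \<Rightarrow> real" where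
  "G_metric C Q p r s =
     metric C p (lift_fib (subbundle (bun C) (ker_anchor C)) (G_pr Q) p r)
                (lift_fib (subbundle (bun C) (ker_anchor C)) (G_pr Q) p s)"


section \<open>Lie algebroid cohomology with values in the dual of \<open>B\<close>\<close>

text \<open>
  Sections of \<open>\<Lambda>\<^sup>kA\<^sup>* \<otimes> B\<^sup>*\<close> are alternating \<open>C\<^sup>\<infinity>(M)\<close>-multilinear maps from k-tuples of
  sections of \<open>A\<close> (lists of length k) to the \<open>C\<^sup>\<infinity>(M)\<close>-module \<open>\<Gamma>(B\<^sup>*) = Hom(\<Gamma>(B), C\<^sup>\<infinity>(M))\<close>. All maps are
  extended by zero outside their domain. The shift of \<open>B\<^sup>*\<close> by 2 affects only the grading: it is even,
  so it introduces no sign.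
\<close>

definition sec_dual ::
  "('m::topological_space, 'a::real_normed_vector) atlas \<Rightarrow> ('m, 'b::real_vector) vbundle
   \<Rightarrow> (('m \<Rightarrow> 'b) \<Rightarrow> 'm \<Rightarrow> real) set" where
  "sec_dual M V =
     {\<phi>. (\<forall>b\<in>sections V. \<phi> b \<in> Cinf M) \<and>
         (\<forall>b\<in>sections V. \<forall>b'\<in>sections V. \<phi> (b + b') = \<phi> b + \<phi> b') \<and>
         (\<forall>f\<in>Cinf M. \<forall>b\<in>sections V. \<phi> (f \<odot> b) = f * \<phi> b) \<and>
         (\<forall>b. b \<notin> sections V \<longrightarrow> \<phi> b = 0)}"

type_synonym ('m, 'w, 'b) cochain = "('m \<Rightarrow> 'w) list \<Rightarrow> ('m \<Rightarrow> 'b) \<Rightarrow> 'm \<Rightarrow> real"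

definition tuples :: "('m, 'w) vbundle \<Rightarrow> nat \<Rightarrow> ('m \<Rightarrow> 'w) list set" where
  "tuples A k = {as. length as = k \<and> set as \<subseteq> sections A}"

definition ce_cochains ::
  "('m::topological_space, 'a::real_normed_vector) atlas
   \<Rightarrow> ('m, 'e, 'w::real_vector, 'g, 'b::real_vector) quots \<Rightarrow> nat \<Rightarrow> ('m, 'w, 'b) cochain set" where
  "ce_cochains M Q k =
     {\<omega>. (\<forall>as\<in>tuples (A_bun Q) k. \<omega> as \<in> sec_dual M (B_bun Q)) \<and>
         (\<forall>as. as \<notin> tuples (A_bun Q) k \<longrightarrow> \<omega> as = 0) \<and>
         (\<forall>as\<in>tuples (A_bun Q) k. \<forall>i<k. \<forall>s\<in>sections (A_bun Q). \<forall>t\<in>sections (A_bun Q).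
            \<omega> (as[i := s + t]) = \<omega> (as[i := s]) + \<omega> (as[i := t])) \<and>
         (\<forall>as\<in>tuples (A_bun Q) k. \<forall>i<k. \<forall>f\<in>Cinf M. \<forall>s\<in>sections (A_bun Q). \<forall>b.
            \<omega> (as[i := f \<odot> s]) b = f * \<omega> (as[i := s]) b) \<and>
         (\<forall>as\<in>tuples (A_bun Q) k. \<forall>i<k. \<forall>j<k. i \<noteq> j \<and> as ! i = as ! j \<longrightarrow> \<omega> as = 0)}"

definition dual_action ::
  "('m::topological_space, 'a::real_normed_vector) atlas \<Rightarrow> ('m, 'e) courant
   \<Rightarrow> ('m, 'e, 'w, 'g, 'b) quots \<Rightarrow> ('m \<Rightarrow> 'w) \<Rightarrow> (('m \<Rightarrow> 'b) \<Rightarrow> 'm \<Rightarrow> real)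
   \<Rightarrow> ('m \<Rightarrow> 'b) \<Rightarrow> 'm \<Rightarrow> real" where
  "dual_action M C Q a \<phi> =
     (\<lambda>b. if b \<in> sections (B_bun Q) then der (ample_anchor C Q a) (\<phi> b) - \<phi> (bott M C Q a b) else 0)"

definition omit :: "nat \<Rightarrow> 'x list \<Rightarrow> 'x list" where
  "omit i xs = take i xs @ drop (Suc i) xs"

definition ce_diff ::
  "('m::topological_space, 'a::real_normed_vector) atlas \<Rightarrow> ('m, 'e) courant
   \<Rightarrow> ('m, 'e, 'w, 'g, 'b) quots \<Rightarrow> nat \<Rightarrow> ('m, 'w, 'b) cochain \<Rightarrow> ('m, 'w, 'b) cochain" where
  "ce_diff M C Q k \<omega> = (\<lambda>as.
     if as \<in> tuples (A_bun Q) (Suc k) then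
       (\<Sum>i\<le>k. (-1) ^ i *\<^sub>R dual_action M C Q (as ! i) (\<omega> (omit i as))) +
       (\<Sum>j\<le>k. \<Sum>i<j. (-1) ^ (i + j) *\<^sub>R
          \<omega> (ample_bracket C Q (as ! i) (as ! j) # omit i (omit j as)))
     else 0)"

definition ce_cocycles ::
  "('m::topological_space, 'a::real_normed_vector) atlas \<Rightarrow> ('m, 'e) courant
   \<Rightarrow> ('m, 'e, 'w::real_vector, 'g, 'b::real_vector) quots \<Rightarrow> nat \<Rightarrow> ('m, 'w, 'b) cochain set" where
  "ce_cocycles M C Q k = {\<omega> \<in> ce_cochains M Q k. ce_diff M C Q k \<omega> = 0}"

text \<open>The class of \<open>\<omega>\<close> in \<open>H\<^sup>k\<close> for \<open>k \<ge> 1\<close>, as a coset of the space of coboundaries.\<close>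

definition ce_class ::
  "('m::topological_space, 'a::real_normed_vector) atlas \<Rightarrow> ('m, 'e) courant
   \<Rightarrow> ('m, 'e, 'w::real_vector, 'g, 'b::real_vector) quots \<Rightarrow> nat \<Rightarrow> ('m, 'w, 'b) cochain
   \<Rightarrow> ('m, 'w, 'b) cochain set" where
  "ce_class M C Q k \<omega> = {\<omega> + ce_diff M C Q (k - 1) \<eta> |\<eta>. \<eta> \<in> ce_cochains M Q (k - 1)}"


section \<open>Dissections and triples\<close>

definition diss_source ::
  "('m::topological_space, 'a::real_normed_vector) atlas \<Rightarrow> ('m, 'e) courant
   \<Rightarrow> ('m, 'e, 'w, 'g, 'b) quots \<Rightarrow> ('m, ('m tvec \<Rightarrow> real) \<times> 'g \<times> 'm tvec) vbundle" where
  "diss_source M C Q = direct_sum3 (dual_bundle M (char_dist M C)) (G_bun Q) (char_dist M C)"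

type_synonym ('m, 'e, 'g) diss = "'m \<Rightarrow> ('m tvec \<Rightarrow> real) \<times> 'g \<times> 'm tvec \<Rightarrow> 'e"

text \<open>
  The last two conditions say that the dissection is compatible with the identifications
  \<open>F = \<rho>(E)\<close> and \<open>\<G> = ker \<rho> / (ker \<rho>)\<^sup>\<bottom>\<close>; they are what makes \<open>F \<oplus> \<G> \<cong> A\<^sub>E\<close> canonical and
  \<open>\<nabla>\<^sup>\<G>\<close> an F-connection. It follows that \<open>F\<^sup>*\<close> is mapped onto \<open>(ker \<rho>)\<^sup>\<bottom>\<close>.
\<close>

definition dissection ::
  "('m::topological_space, 'a::real_normed_vector) atlas \<Rightarrow> ('m, 'e::real_vector) courant
   \<Rightarrow> ('m, 'e, 'w, 'g::real_vector, 'b) quots \<Rightarrow> ('m, 'e, 'g) diss \<Rightarrow> bool" where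
  "dissection M C Q \<Psi> \<longleftrightarrow>
     bundle_iso (diss_source M C Q) (bun C) \<Psi> \<and>
     (\<forall>p. \<forall>(\<xi>, r, x)\<in>fiber (diss_source M C Q) p. \<forall>(\<eta>, s, y)\<in>fiber (diss_source M C Q) p.
        metric C p (\<Psi> p (\<xi>, r, x)) (\<Psi> p (\<eta>, s, y)) = \<xi> y / 2 + \<eta> x / 2 + G_metric C Q p r s) \<and>
     (\<forall>p. \<forall>(\<xi>, r, x)\<in>fiber (diss_source M C Q) p. anchor C p (\<Psi> p (\<xi>, r, x)) = x) \<and>
     (\<forall>p. \<forall>r\<in>fiber (G_bun Q) p. G_pr Q p (\<Psi> p (0, r, 0)) = r)"

definition diss_inv ::
  "('m::topological_space, 'a::real_normed_vector) atlas \<Rightarrow> ('m, 'e) courant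
   \<Rightarrow> ('m, 'e, 'w, 'g, 'b) quots \<Rightarrow> ('m, 'e, 'g) diss
   \<Rightarrow> 'm \<Rightarrow> 'e \<Rightarrow> ('m tvec \<Rightarrow> real) \<times> 'g \<times> 'm tvec" where
  "diss_inv M C Q \<Psi> = inv_map (diss_source M C Q) \<Psi>"

definition emb_F :: "('m, 'e, 'g::real_vector) diss \<Rightarrow> ('m \<Rightarrow> 'm tvec) \<Rightarrow> 'm \<Rightarrow> 'e" where
  "emb_F \<Psi> x = (\<lambda>p. \<Psi> p (0, 0, x p))"

definition emb_G :: "('m, 'e, 'g::real_vector) diss \<Rightarrow> ('m \<Rightarrow> 'g) \<Rightarrow> 'm \<Rightarrow> 'e" where
  "emb_G \<Psi> r = (\<lambda>p. \<Psi> p (0, r p, 0))"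

definition comp_Fdual ::
  "('m::topological_space, 'a::real_normed_vector) atlas \<Rightarrow> ('m, 'e) courant
   \<Rightarrow> ('m, 'e, 'w, 'g, 'b) quots \<Rightarrow> ('m, 'e, 'g) diss \<Rightarrow> ('m \<Rightarrow> 'e) \<Rightarrow> 'm \<Rightarrow> 'm tvec \<Rightarrow> real" where
  "comp_Fdual M C Q \<Psi> e = (\<lambda>p. fst (diss_inv M C Q \<Psi> p (e p)))"

definition comp_G ::
  "('m::topological_space, 'a::real_normed_vector) atlas \<Rightarrow> ('m, 'e) courant
   \<Rightarrow> ('m, 'e, 'w, 'g, 'b) quots \<Rightarrow> ('m, 'e, 'g) diss \<Rightarrow> ('m \<Rightarrow> 'e) \<Rightarrow> 'm \<Rightarrow> 'g" where
  "comp_G M C Q \<Psi> e = (\<lambda>p. fst (snd (diss_inv M C Q \<Psi> p (e p))))"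

definition comp_F ::
  "('m::topological_space, 'a::real_normed_vector) atlas \<Rightarrow> ('m, 'e) courant
   \<Rightarrow> ('m, 'e, 'w, 'g, 'b) quots \<Rightarrow> ('m, 'e, 'g) diss \<Rightarrow> ('m \<Rightarrow> 'e) \<Rightarrow> 'm \<Rightarrow> 'm tvec" where
  "comp_F M C Q \<Psi> e = (\<lambda>p. snd (snd (diss_inv M C Q \<Psi> p (e p))))"

definition nabla_G ::
  "('m::topological_space, 'a::real_normed_vector) atlas \<Rightarrow> ('m, 'e) courant
   \<Rightarrow> ('m, 'e, 'w, 'g::real_vector, 'b) quots \<Rightarrow> ('m, 'e, 'g) diss
   \<Rightarrow> ('m \<Rightarrow> 'm tvec) \<Rightarrow> ('m \<Rightarrow> 'g) \<Rightarrow> 'm \<Rightarrow> 'g" where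
  "nabla_G M C Q \<Psi> x r = comp_G M C Q \<Psi> (brac C (emb_F \<Psi> x) (emb_G \<Psi> r))"

record ('m, 'g, 'b) triple =
  split_B :: "'m \<Rightarrow> 'b \<Rightarrow> 'm tvec"
  nabla_F :: "('m \<Rightarrow> 'm tvec) \<Rightarrow> ('m \<Rightarrow> 'm tvec) \<Rightarrow> 'm \<Rightarrow> 'm tvec"
  nabla_B :: "('m \<Rightarrow> 'b) \<Rightarrow> ('m \<Rightarrow> 'g) \<Rightarrow> 'm \<Rightarrow> 'g"

definition is_triple ::
  "('m::topological_space, 'a::real_normed_vector) atlas \<Rightarrow> ('m, 'e) courant
   \<Rightarrow> ('m, 'e, 'w, 'g::real_vector, 'b::real_vector) quots \<Rightarrow> ('m, 'g, 'b) triple \<Rightarrow> bool" where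
  "is_triple M C Q \<tau> \<longleftrightarrow>
     bundle_map (B_bun Q) (tangent_bundle M) (split_B \<tau>) \<and>
     (\<forall>p. \<forall>u\<in>fiber (B_bun Q) p. B_pr Q p (split_B \<tau> p u) = u) \<and>
     connection M (char_dist M C) (\<lambda>p x. x) (char_dist M C) (nabla_F \<tau>) \<and>
     (\<forall>x\<in>sections (char_dist M C). \<forall>y\<in>sections (char_dist M C).
        nabla_F \<tau> x y - nabla_F \<tau> y x = lie_bracket x y) \<and>
     connection M (B_bun Q) (split_B \<tau>) (G_bun Q) (nabla_B \<tau>) \<and>
     (\<forall>b\<in>sections (B_bun Q). \<forall>r\<in>sections (G_bun Q). \<forall>s\<in>sections (G_bun Q).
        der (on_sec (split_B \<tau>) b) (met (G_metric C Q) r s) =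
          met (G_metric C Q) (nabla_B \<tau> b r) s + met (G_metric C Q) r (nabla_B \<tau> b s))"


section \<open>The metric connection, its torsion, and the map \<open>d\<^sub>T\<close>\<close>

definition part_B ::
  "('m, 'e, 'w, 'g, 'b) quots \<Rightarrow> ('m \<Rightarrow> 'm tvec) \<Rightarrow> 'm \<Rightarrow> 'b" where
  "part_B Q X = on_sec (B_pr Q) X"

definition part_F ::
  "('m, 'e, 'w, 'g, 'b) quots \<Rightarrow> ('m, 'g, 'b) triple \<Rightarrow> ('m \<Rightarrow> 'm tvec) \<Rightarrow> 'm \<Rightarrow> 'm tvec" where
  "part_F Q \<tau> X = X - on_sec (split_B \<tau>) (part_B Q X)"

text \<open>
  The components of \<open>\<nabla>\<^sub>X\<close> on \<open>F\<close>, \<open>\<G>\<close> and \<open>F\<^sup>*\<close> for \<open>X = x + j(b)\<close> with \<open>x = pr\<^sub>F X\<close> and \<open>b = pr\<^sub>B X\<close>.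
\<close>

definition conn_F ::
  "('m, 'e, 'w, 'g, 'b) quots \<Rightarrow> ('m, 'g, 'b) triple
   \<Rightarrow> ('m \<Rightarrow> 'm tvec) \<Rightarrow> ('m \<Rightarrow> 'm tvec) \<Rightarrow> 'm \<Rightarrow> 'm tvec" where
  "conn_F Q \<tau> X y =
     nabla_F \<tau> (part_F Q \<tau> X) y + part_F Q \<tau> (lie_bracket (on_sec (split_B \<tau>) (part_B Q X)) y)"

definition conn_G ::
  "('m::topological_space, 'a::real_normed_vector) atlas \<Rightarrow> ('m, 'e) courant
   \<Rightarrow> ('m, 'e, 'w, 'g::real_vector, 'b) quots \<Rightarrow> ('m, 'e, 'g) diss \<Rightarrow> ('m, 'g, 'b) triple
   \<Rightarrow> ('m \<Rightarrow> 'm tvec) \<Rightarrow> ('m \<Rightarrow> 'g) \<Rightarrow> 'm \<Rightarrow> 'g" where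
  "conn_G M C Q \<Psi> \<tau> X r = nabla_G M C Q \<Psi> (part_F Q \<tau> X) r + nabla_B \<tau> (part_B Q X) r"

definition conn_Fdual ::
  "('m::topological_space, 'a::real_normed_vector) atlas \<Rightarrow> ('m, 'e) courant
   \<Rightarrow> ('m, 'e, 'w, 'g, 'b) quots \<Rightarrow> ('m, 'g, 'b) triple
   \<Rightarrow> ('m \<Rightarrow> 'm tvec) \<Rightarrow> ('m \<Rightarrow> 'm tvec \<Rightarrow> real) \<Rightarrow> 'm \<Rightarrow> 'm tvec \<Rightarrow> real" where
  "conn_Fdual M C Q \<tau> X \<xi> =
     (THE \<eta>. \<eta> \<in> sections (dual_bundle M (char_dist M C)) \<and>
        (\<forall>y\<in>sections (char_dist M C).
           on_sec \<eta> y = der X (on_sec \<xi> y) - on_sec \<xi> (conn_F Q \<tau> X y)))"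

definition conn ::
  "('m::topological_space, 'a::real_normed_vector) atlas \<Rightarrow> ('m, 'e) courant
   \<Rightarrow> ('m, 'e, 'w, 'g::real_vector, 'b) quots \<Rightarrow> ('m, 'e, 'g) diss \<Rightarrow> ('m, 'g, 'b) triple
   \<Rightarrow> ('m \<Rightarrow> 'm tvec) \<Rightarrow> ('m \<Rightarrow> 'e) \<Rightarrow> 'm \<Rightarrow> 'e" where
  "conn M C Q \<Psi> \<tau> X e =
     (\<lambda>p. \<Psi> p (conn_Fdual M C Q \<tau> X (comp_Fdual M C Q \<Psi> e) p,
               conn_G M C Q \<Psi> \<tau> X (comp_G M C Q \<Psi> e) p,
               conn_F Q \<tau> X (comp_F M C Q \<Psi> e) p))"

definition curvature ::
  "(('m \<Rightarrow> 'm tvec) \<Rightarrow> ('m \<Rightarrow> 'e::real_vector) \<Rightarrow> 'm \<Rightarrow> 'e)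
   \<Rightarrow> ('m \<Rightarrow> 'm tvec) \<Rightarrow> ('m \<Rightarrow> 'm tvec) \<Rightarrow> ('m \<Rightarrow> 'e) \<Rightarrow> 'm \<Rightarrow> 'e" where
  "curvature nab X Y e = nab X (nab Y e) - nab Y (nab X e) - nab (lie_bracket X Y) e"

definition torsion ::
  "('m, 'e::real_vector) courant \<Rightarrow> (('m \<Rightarrow> 'm tvec) \<Rightarrow> ('m \<Rightarrow> 'e) \<Rightarrow> 'm \<Rightarrow> 'e)
   \<Rightarrow> ('m \<Rightarrow> 'e) \<Rightarrow> ('m \<Rightarrow> 'e) \<Rightarrow> ('m \<Rightarrow> 'e) \<Rightarrow> 'm \<Rightarrow> real" where
  "torsion C nab e\<^sub>1 e\<^sub>2 e\<^sub>3 =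
     (let T = (\<lambda>u v w. met (metric C)
                 ((1/3) *\<^sub>R (brac C u v - brac C v u) - (nab (anc C u) v - nab (anc C v) u)) w)
      in (1/2) *\<^sub>R (T e\<^sub>1 e\<^sub>2 e\<^sub>3 + T e\<^sub>2 e\<^sub>3 e\<^sub>1 + T e\<^sub>3 e\<^sub>1 e\<^sub>2))"

definition cov_deriv3 ::
  "(('m \<Rightarrow> 'm tvec) \<Rightarrow> ('m \<Rightarrow> 'e) \<Rightarrow> 'm \<Rightarrow> 'e) \<Rightarrow> ('m \<Rightarrow> 'm tvec)
   \<Rightarrow> (('m \<Rightarrow> 'e) \<Rightarrow> ('m \<Rightarrow> 'e) \<Rightarrow> ('m \<Rightarrow> 'e) \<Rightarrow> 'm \<Rightarrow> real)
   \<Rightarrow> ('m \<Rightarrow> 'e) \<Rightarrow> ('m \<Rightarrow> 'e) \<Rightarrow> ('m \<Rightarrow> 'e) \<Rightarrow> 'm \<Rightarrow> real" where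
  "cov_deriv3 nab X T e\<^sub>1 e\<^sub>2 e\<^sub>3 =
     der X (T e\<^sub>1 e\<^sub>2 e\<^sub>3) - T (nab X e\<^sub>1) e\<^sub>2 e\<^sub>3 - T e\<^sub>1 (nab X e\<^sub>2) e\<^sub>3 - T e\<^sub>1 e\<^sub>2 (nab X e\<^sub>3)"

text \<open>
  The identification \<open>A\<^sub>E \<cong> \<G> \<oplus> F\<close>, and the resulting lift of sections of \<open>A\<^sub>E\<close> to \<open>E\<close>. A form on \<open>E\<close>
  that vanishes when one argument lies in \<open>(ker \<rho>)\<^sup>\<bottom>\<close>, such as the torsion or its covariant
  derivatives, is regarded as a form on \<open>A\<^sub>E\<close> by evaluating it on these lifts.
\<close>

definition A_comp ::
  "('m::topological_space, 'a::real_normed_vector) atlas \<Rightarrow> ('m, 'e) courant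
   \<Rightarrow> ('m, 'e, 'w, 'g, 'b) quots \<Rightarrow> ('m, 'e, 'g) diss \<Rightarrow> 'm \<Rightarrow> 'w \<Rightarrow> 'g \<times> 'm tvec" where
  "A_comp M C Q \<Psi> p a =
     (THE u. u \<in> fiber (G_bun Q) p \<times> fiber (char_dist M C) p \<and> A_pr Q p (\<Psi> p (0, u)) = a)"

definition A_lift ::
  "('m::topological_space, 'a::real_normed_vector) atlas \<Rightarrow> ('m, 'e) courant
   \<Rightarrow> ('m, 'e, 'w, 'g, 'b) quots \<Rightarrow> ('m, 'e, 'g) diss \<Rightarrow> ('m \<Rightarrow> 'w) \<Rightarrow> 'm \<Rightarrow> 'e" where
  "A_lift M C Q \<Psi> a = (\<lambda>p. \<Psi> p (0, A_comp M C Q \<Psi> p (a p)))"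

text \<open>
  The element of \<open>\<Gamma>(F\<^sup>* \<otimes> \<Lambda>\<^sup>2\<G>\<^sup>*)\<close> with value \<open>g(R(x, j(b))r, s)\<close> on \<open>(x, r, s)\<close>, as an alternating
  3-form on \<open>A\<^sub>E\<close>: the cyclic sum gives its values on arguments with both components nonzero.
\<close>

definition curv_form ::
  "('m::topological_space, 'a::real_normed_vector) atlas \<Rightarrow> ('m, 'e::real_vector) courant
   \<Rightarrow> ('m, 'e, 'w, 'g::real_vector, 'b) quots \<Rightarrow> ('m, 'e, 'g) diss \<Rightarrow> ('m, 'g, 'b) triple
   \<Rightarrow> ('m \<Rightarrow> 'b) \<Rightarrow> ('m \<Rightarrow> 'w) \<Rightarrow> ('m \<Rightarrow> 'w) \<Rightarrow> ('m \<Rightarrow> 'w) \<Rightarrow> 'm \<Rightarrow> real" where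
  "curv_form M C Q \<Psi> \<tau> b a\<^sub>1 a\<^sub>2 a\<^sub>3 =
     (let r = (\<lambda>a p. fst (A_comp M C Q \<Psi> p (a p)));
          x = (\<lambda>a p. snd (A_comp M C Q \<Psi> p (a p)));
          K = (\<lambda>x r s. met (G_metric C Q)
                 (comp_G M C Q \<Psi>
                    (curvature (conn M C Q \<Psi> \<tau>) x (on_sec (split_B \<tau>) b) (emb_G \<Psi> r))) s)
      in K (x a\<^sub>1) (r a\<^sub>2) (r a\<^sub>3) + K (x a\<^sub>2) (r a\<^sub>3) (r a\<^sub>1) + K (x a\<^sub>3) (r a\<^sub>1) (r a\<^sub>2))"

definition d_T_map ::
  "('m::topological_space, 'a::real_normed_vector) atlas \<Rightarrow> ('m, 'e::real_vector) courant
   \<Rightarrow> ('m, 'e, 'w, 'g::real_vector, 'b) quots \<Rightarrow> ('m, 'e, 'g) diss \<Rightarrow> ('m, 'g, 'b) triple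
   \<Rightarrow> ('m \<Rightarrow> 'b) \<Rightarrow> ('m \<Rightarrow> 'w) \<Rightarrow> ('m \<Rightarrow> 'w) \<Rightarrow> ('m \<Rightarrow> 'w) \<Rightarrow> 'm \<Rightarrow> real" where
  "d_T_map M C Q \<Psi> \<tau> b a\<^sub>1 a\<^sub>2 a\<^sub>3 =
     curv_form M C Q \<Psi> \<tau> b a\<^sub>1 a\<^sub>2 a\<^sub>3 -
     cov_deriv3 (conn M C Q \<Psi> \<tau>) (on_sec (split_B \<tau>) b) (torsion C (conn M C Q \<Psi> \<tau>))
       (A_lift M C Q \<Psi> a\<^sub>1) (A_lift M C Q \<Psi> a\<^sub>2) (A_lift M C Q \<Psi> a\<^sub>3)"

text \<open>\<open>d\<^sub>T\<close> viewed as a 3-cochain with values in the dual of \<open>B\<close>.\<close>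

definition d_T ::
  "('m::topological_space, 'a::real_normed_vector) atlas \<Rightarrow> ('m, 'e::real_vector) courant
   \<Rightarrow> ('m, 'e, 'w, 'g::real_vector, 'b) quots \<Rightarrow> ('m, 'e, 'g) diss \<Rightarrow> ('m, 'g, 'b) triple
   \<Rightarrow> ('m, 'w, 'b) cochain" where
  "d_T M C Q \<Psi> \<tau> = (\<lambda>as b.
     if as \<in> tuples (A_bun Q) 3 \<and> b \<in> sections (B_bun Q)
     then d_T_map M C Q \<Psi> \<tau> b (as ! 0) (as ! 1) (as ! 2) else 0)"

end

theory Submission
  imports Defs
begin

text \<open>
  The bracket \<open>\<circ>\<close> makes \<open>\<Gamma>(E)\<close> a Leibniz algebra, which acts on the space of additive maps
  \<open>\<phi> : \<Gamma>(B) \<rightarrow> C\<^sup>\<infinity>(M)\<close> by \<open>(e \<cdot> \<phi>)(b) = \<rho>(e) \<phi>(b) - \<phi>(e \<cdot> b)\<close>, where \<open>e \<cdot> b = pr\<^sub>B [\<rho>(e), b]\<close> is the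
  Bott action. So there is a Loday complex of cochains on \<open>\<Gamma>(E)\<close> with values in this
  representation. Its cochains need not be skew, nor \<open>C\<^sup>\<infinity>(M)\<close>-linear in the sections of \<open>E\<close>. Those
  that are, and that vanish as soon as one argument lies in \<open>(ker \<rho>)\<^sup>\<bottom>\<close>, are the cochains of \<open>A\<^sub>E\<close>
  with values in \<open>B\<^sup>*\<close>, and on them the Loday differential is the Chevalley-Eilenberg differential
  (\<open>ce_diff_descend2\<close>, \<open>ce_diff_descend3\<close>).

  The theorem holds because \<open>d\<^sub>T\<close> is exact in the large complex. Let \<open>D\<^sub>b(e, e') = g(\<nabla>\<^sub>b e, e')\<close> for the
  metric connection \<open>\<nabla>\<close> along \<open>j(b)\<close>. Then \<open>D\<close> is a Loday 2-cochain, and expanding the torsion and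
  its covariant derivative gives \<open>d\<^sub>T = d D\<close> (\<open>d_T_eq\<close>): the curvature terms in the derivative of the
  torsion are cancelled by the curvature term in the definition of \<open>d\<^sub>T\<close>. Consequently \<open>d\<^sub>T\<close> is
  closed. Its class on \<open>A\<^sub>E\<close> need not vanish, since \<open>D\<close> is neither skew nor tensorial in its first
  argument. That \<open>d D\<close> nevertheless is a cochain of \<open>A\<^sub>E\<close> (\<open>skew_form3_loday_d2_D\<close>) rests on two
  properties of \<open>D\<close>: it is metric, and \<open>\<rho>(\<nabla>\<^sub>b e) = [j(b), \<rho>(e)] + j(e \<cdot> b)\<close>.

  For two choices with splittings \<open>j\<close> and \<open>j'\<close>, the vector field \<open>j'(b) - j(b)\<close> lies in \<open>F\<close> and has a
  lift \<open>u\<^sub>b\<close> to \<open>E\<close>. Put \<open>\<theta>\<^sub>b(e) = g(u\<^sub>b, e)\<close>. The defects of \<open>D' - D\<close> from being skew, tensorial and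
  defined on \<open>A\<^sub>E\<close> are opposite to those of \<open>d \<theta>\<close>, so that \<open>\<eta> = D' - D + d \<theta>\<close> is a cochain of \<open>A\<^sub>E\<close>
  (\<open>skew_form2_\<eta>\<close>), and \<open>d D' - d D = d \<eta>\<close>.
\<close>

section \<open>Smooth functions\<close>

lemma times_differentiable_on_cong:
  assumes "open S" "\<And>x. x \<in> S \<Longrightarrow> f x = g x" "times_differentiable_on n S f"
  shows "times_differentiable_on n S g"
  using assms(2,3)
proof (induction n arbitrary: f g)
  case 0
  then show ?case by (metis continuous_on_cong times_differentiable_on.simps(1))
next
  case (Suc n)
  have d: "g differentiable (at x) \<and> frechet_derivative f (at x) = frechet_derivative g (at x)" if "x \<in> S" for x
  proof -
    have "f differentiable (at x)" using Suc.prems(2) that by simp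
    then have "(f has_derivative frechet_derivative f (at x)) (at x)"
      by (simp add: frechet_derivative_works)
    then have "(g has_derivative frechet_derivative f (at x)) (at x)"
      using has_derivative_transform_within_open[OF _ assms(1) that] Suc.prems(1) by blast
    then show ?thesis
      using differentiableI frechet_derivative_at by blast
  qed
  have "times_differentiable_on n S (\<lambda>x. frechet_derivative g (at x) v)" for v
    by (rule Suc.IH[of "\<lambda>x. frechet_derivative f (at x) v"]) (use Suc.prems(2) d in auto)
  then show ?case using d by simp
qed

text \<open>
  The product rule needs \<open>f\<close> itself, and not only its derivatives, to be differentiable one order
  less.
\<close>

lemma times_differentiable_on_Suc_imp:
  "times_differentiable_on (Suc n) S f \<Longrightarrow> times_differentiable_on n S f"
proof (induction n arbitrary: f)
  case 0
  then show ?case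
    by (auto intro!: continuous_at_imp_continuous_on differentiable_imp_continuous_within)
next
  case (Suc n)
  then show ?case by (metis times_differentiable_on.simps(2))
qed

lemma times_differentiable_on_subset:
  "times_differentiable_on n S f \<Longrightarrow> T \<subseteq> S \<Longrightarrow> times_differentiable_on n T f"
  by (induction n arbitrary: f) (auto intro: continuous_on_subset)

lemma times_differentiable_on_const: "times_differentiable_on n S (\<lambda>x. c)"
  by (induction n arbitrary: c) auto

lemma times_differentiable_on_add:
  assumes "open S" "times_differentiable_on n S f" "times_differentiable_on n S g"
  shows "times_differentiable_on n S (\<lambda>x. f x + g x)"
  using assms(2,3)
proof (induction n arbitrary: f g)
  case 0
  then show ?case by (auto intro: continuous_on_add)
next
  case (Suc n)
  have "times_differentiable_on n S (\<lambda>x. frechet_derivative (\<lambda>x. f x + g x) (at x) v)" for v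
  proof (rule times_differentiable_on_cong[OF assms(1)])
    show "times_differentiable_on n S
            (\<lambda>x. frechet_derivative f (at x) v + frechet_derivative g (at x) v)"
      using Suc by simp
    show "frechet_derivative f (at x) v + frechet_derivative g (at x) v =
            frechet_derivative (\<lambda>x. f x + g x) (at x) v" if "x \<in> S" for x
    proof -
      have "(f has_derivative frechet_derivative f (at x)) (at x)"
           "(g has_derivative frechet_derivative g (at x)) (at x)"
        using Suc.prems that by (auto simp: frechet_derivative_works)
      from frechet_derivative_at[OF has_derivative_add[OF this]] show ?thesis by metis
    qed
  qed
  then show ?case using Suc.prems by auto
qed

lemma times_differentiable_on_mult:
  fixes f g :: "'a::real_normed_vector \<Rightarrow> real"
  assumes "open S" "times_differentiable_on n S f" "times_differentiable_on n S g"
  shows "times_differentiable_on n S (\<lambda>x. f x * g x)"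
  using assms(2,3)
proof (induction n arbitrary: f g)
  case 0
  then show ?case by (auto intro: continuous_on_mult)
next
  case (Suc n)
  have "times_differentiable_on n S (\<lambda>x. frechet_derivative (\<lambda>x. f x * g x) (at x) v)" for v
  proof (rule times_differentiable_on_cong[OF assms(1)])
    show "times_differentiable_on n S
            (\<lambda>x. f x * frechet_derivative g (at x) v + frechet_derivative f (at x) v * g x)"
      using Suc.prems
      by (intro times_differentiable_on_add assms(1) Suc.IH)
         (auto dest: times_differentiable_on_Suc_imp simp del: times_differentiable_on.simps(1)
               simp add: times_differentiable_on_Suc_imp)
    show "f x * frechet_derivative g (at x) v + frechet_derivative f (at x) v * g x =
            frechet_derivative (\<lambda>x. f x * g x) (at x) v" if "x \<in> S" for x
    proof -
      have "(f has_derivative frechet_derivative f (at x)) (at x)"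
           "(g has_derivative frechet_derivative g (at x)) (at x)"
        using Suc.prems that by (auto simp: frechet_derivative_works)
      from frechet_derivative_at[OF has_derivative_mult[OF this]] show ?thesis by metis
    qed
  qed
  then show ?case using Suc.prems by auto
qed

lemma chart_image_open:
  assumes "smooth_manifold M" "(U, \<phi>) \<in> M" "open W"
  shows "open (\<phi> ` (U \<inter> W))"
proof -
  have 1: "open U" "open (\<phi> ` U)" "homeomorphism U (\<phi> ` U) \<phi> (inv_into U \<phi>)"
    using assms(1,2) unfolding smooth_manifold_def by auto
  have "openin (top_of_set (\<phi> ` U)) (\<phi> ` (U \<inter> W))"
    by (rule homeomorphism_imp_open_map[OF 1(3)]) (use assms(3) in \<open>auto simp: openin_open\<close>)
  then show ?thesis using 1(2) openin_open_trans by blast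
qed

lemma smooth_fun_on_const: "smooth_fun_on M W (\<lambda>_. c)"
  by (auto simp: smooth_fun_on_def C_infinity_on_def o_def times_differentiable_on_const)

lemma smooth_fun_on_add:
  assumes "smooth_manifold M" "open W" "smooth_fun_on M W f" "smooth_fun_on M W g"
  shows "smooth_fun_on M W (\<lambda>x. f x + g x)"
  unfolding smooth_fun_on_def C_infinity_on_def
proof (clarify)
  fix U \<phi> n assume c: "(U, \<phi>) \<in> M"
  have "times_differentiable_on n (\<phi> ` (U \<inter> W)) (f \<circ> inv_into U \<phi>)"
    "times_differentiable_on n (\<phi> ` (U \<inter> W)) (g \<circ> inv_into U \<phi>)"
    using assms(3,4) c by (auto simp: smooth_fun_on_def C_infinity_on_def)
  then show "times_differentiable_on n (\<phi> ` (U \<inter> W)) ((\<lambda>x. f x + g x) \<circ> inv_into U \<phi>)"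
    using times_differentiable_on_add[OF chart_image_open[OF assms(1) c assms(2)]] by (auto simp: o_def)
qed

lemma smooth_fun_on_mult:
  assumes "smooth_manifold M" "open W" "smooth_fun_on M W f" "smooth_fun_on M W g"
  shows "smooth_fun_on M W (\<lambda>x. f x * g x)"
  unfolding smooth_fun_on_def C_infinity_on_def
proof (clarify)
  fix U \<phi> n assume c: "(U, \<phi>) \<in> M"
  have "times_differentiable_on n (\<phi> ` (U \<inter> W)) (f \<circ> inv_into U \<phi>)"
    "times_differentiable_on n (\<phi> ` (U \<inter> W)) (g \<circ> inv_into U \<phi>)"
    using assms(3,4) c by (auto simp: smooth_fun_on_def C_infinity_on_def)
  then show "times_differentiable_on n (\<phi> ` (U \<inter> W)) ((\<lambda>x. f x * g x) \<circ> inv_into U \<phi>)"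
    using times_differentiable_on_mult[OF chart_image_open[OF assms(1) c assms(2)]] by (auto simp: o_def)
qed

lemma smooth_fun_on_subset:
  "smooth_fun_on M W f \<Longrightarrow> V \<subseteq> W \<Longrightarrow> smooth_fun_on M V f"
  unfolding smooth_fun_on_def C_infinity_on_def
  by (fast intro: times_differentiable_on_subset)

lemma smooth_fun_on_cong:
  assumes "smooth_manifold M" "open W" "\<And>x. x \<in> W \<Longrightarrow> f x = g x" "smooth_fun_on M W f"
  shows "smooth_fun_on M W g"
  unfolding smooth_fun_on_def C_infinity_on_def
proof (clarify)
  fix U \<phi> n assume c: "(U, \<phi>) \<in> M"
  have "homeomorphism U (\<phi> ` U) \<phi> (inv_into U \<phi>)"
    using assms(1) c unfolding smooth_manifold_def by auto
  then have "inv_into U \<phi> (\<phi> x) = x" if "x \<in> U" for x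
    using that by (simp add: homeomorphism_def)
  then have eq: "(f \<circ> inv_into U \<phi>) y = (g \<circ> inv_into U \<phi>) y" if "y \<in> \<phi> ` (U \<inter> W)" for y
    using that assms(3) by auto
  show "times_differentiable_on n (\<phi> ` (U \<inter> W)) (g \<circ> inv_into U \<phi>)"
    by (rule times_differentiable_on_cong[OF chart_image_open[OF assms(1) c assms(2)] eq])
       (use assms(4) c in \<open>auto simp: smooth_fun_on_def C_infinity_on_def simp del: o_apply\<close>)
qed

lemma Cinf_const: "(\<lambda>_. c) \<in> Cinf M"
  by (simp add: Cinf_def smooth_fun_on_const)

lemma Cinf_0: "0 \<in> Cinf M"
  using Cinf_const[of 0 M] by (simp add: zero_fun_def)

context
  fixes M :: "('m::{t2_space, second_countable_topology}, 'a::real_normed_vector) atlas"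
  assumes M: "smooth_manifold M"
begin

lemma Cinf_add: "f \<in> Cinf M \<Longrightarrow> h \<in> Cinf M \<Longrightarrow> f + h \<in> Cinf M"
  using smooth_fun_on_add[OF M, of UNIV f h] by (simp add: Cinf_def plus_fun_def)

lemma Cinf_mult: "f \<in> Cinf M \<Longrightarrow> h \<in> Cinf M \<Longrightarrow> f * h \<in> Cinf M"
  using smooth_fun_on_mult[OF M, of UNIV f h] by (simp add: Cinf_def times_fun_def)

lemma Cinf_scaleR: "f \<in> Cinf M \<Longrightarrow> c *\<^sub>R f \<in> Cinf M"
  using Cinf_mult[OF Cinf_const, of f c] by (simp add: scaleR_fun_def times_fun_def)

lemma Cinf_minus: "f \<in> Cinf M \<Longrightarrow> - f \<in> Cinf M"
  using Cinf_scaleR[of f "-1"] by simp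

lemma Cinf_diff: "f \<in> Cinf M \<Longrightarrow> h \<in> Cinf M \<Longrightarrow> f - h \<in> Cinf M"
  using Cinf_add[OF _ Cinf_minus, of f h] by simp

end

section \<open>Sections of vector bundles\<close>

lemma frame_coeffs_exist:
  assumes "frame_on V U r e" "\<And>p. p \<in> U \<Longrightarrow> s p \<in> fiber V p"
  obtains c where "\<And>p. p \<in> U \<Longrightarrow> s p = (\<Sum>i<r. c i p *\<^sub>R e i p)"
proof -
  have "\<exists>c. s p = (\<Sum>i<r. c i *\<^sub>R e i p)" if "p \<in> U" for p
  proof -
    have inj: "inj_on (\<lambda>i. e i p) {..<r}" and "s p \<in> span ((\<lambda>i. e i p) ` {..<r})"
      using assms that by (auto simp: frame_on_def)
    then obtain u where "s p = (\<Sum>v\<in>(\<lambda>i. e i p) ` {..<r}. u v *\<^sub>R v)"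
      by (auto simp: span_finite)
    then have "s p = (\<Sum>i<r. u (e i p) *\<^sub>R e i p)"
      by (simp add: sum.reindex[OF inj])
    then show ?thesis by (rule exI[of _ "\<lambda>i. u (e i p)"])
  qed
  then obtain d where "\<And>p. p \<in> U \<Longrightarrow> s p = (\<Sum>i<r. d p i *\<^sub>R e i p)" by metis
  then show ?thesis using that[of "\<lambda>i p. d p i"] by simp
qed

lemma frame_coeffs_unique:
  assumes "frame_on V U r e" "p \<in> U" "(\<Sum>i<r. c i *\<^sub>R e i p) = (\<Sum>i<r. d i *\<^sub>R e i p)" "i < r"
  shows "c i = d i"
proof -
  let ?f = "\<lambda>i. e i p"
  have inj: "inj_on ?f {..<r}" and ind: "independent (?f ` {..<r})"
    using assms by (auto simp: frame_on_def)
  define u where "u v = c (the_inv_into {..<r} ?f v) - d (the_inv_into {..<r} ?f v)" for v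
  have u: "u (e j p) = c j - d j" if "j < r" for j
    using the_inv_into_f_f[OF inj] that by (simp add: u_def)
  have "(\<Sum>v\<in>?f ` {..<r}. u v *\<^sub>R v) = (\<Sum>j<r. (c j - d j) *\<^sub>R e j p)"
    by (simp add: sum.reindex[OF inj] u)
  also have "\<dots> = 0" using assms(3) by (simp add: scaleR_left_diff_distrib sum_subtractf)
  finally have "u (e i p) = 0"
    using independentD[OF ind, of "?f ` {..<r}" u "e i p"] assms(4) by blast
  then show ?thesis using u assms(4) by simp
qed

text \<open>
  Smoothness of a section is tested on its coefficients in all local frames, which exist and are
  unique pointwise. So the closure properties of sections reduce to those of smooth functions.
\<close>

context
  fixes M :: "('m::{t2_space, second_countable_topology}, 'a::real_normed_vector) atlas"
    and V :: "('m, 'v::real_vector) vbundle"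
  assumes M: "smooth_manifold M" and V: "vector_bundle M V"
begin

lemma sections_iff:
  "s \<in> sections V \<longleftrightarrow>
     (\<forall>p. s p \<in> fiber V p) \<and>
     (\<forall>U r e c. open U \<and> frame_on V U r e \<and> (\<forall>p\<in>U. s p = (\<Sum>i<r. c i p *\<^sub>R e i p)) \<longrightarrow>
                (\<forall>i<r. smooth_fun_on M U (c i)))"
  using V[unfolded vector_bundle_def, THEN conjunct2, THEN conjunct2] by (rule spec)

lemma section_in_fiber: "s \<in> sections V \<Longrightarrow> s p \<in> fiber V p"
  by (drule sections_iff[THEN iffD1]) simp

lemma fiber_subspace: "subspace (fiber V p)"
  using V[unfolded vector_bundle_def, THEN conjunct1] by (rule spec)

lemma frame_at: "\<exists>U r e. open U \<and> p \<in> U \<and> frame_on V U r e"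
  using V[unfolded vector_bundle_def, THEN conjunct2, THEN conjunct1] by (rule spec)

lemma sections_coeff_smooth:
  assumes "s \<in> sections V" "open U" "frame_on V U r e" "\<And>p. p \<in> U \<Longrightarrow> s p = (\<Sum>i<r. c i p *\<^sub>R e i p)" "i < r"
  shows "smooth_fun_on M U (c i)"
  using assms(1)[THEN sections_iff[THEN iffD1], THEN conjunct2, rule_format, of U r e c i] assms(2-)
  by simp

lemma sectionsI:
  assumes "\<And>p. s p \<in> fiber V p"
    and "\<And>U r e c i. open U \<Longrightarrow> frame_on V U r e \<Longrightarrow> (\<And>p. p \<in> U \<Longrightarrow> s p = (\<Sum>i<r. c i p *\<^sub>R e i p)) \<Longrightarrow>
            i < r \<Longrightarrow> smooth_fun_on M U (c i)"
  shows "s \<in> sections V"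
  by (rule sections_iff[THEN iffD2], intro conjI allI impI assms(1), elim conjE, rule assms(2)) simp_all

lemma sections_add:
  assumes s: "s \<in> sections V" and t: "t \<in> sections V"
  shows "s + t \<in> sections V"
proof (rule sectionsI)
  show "(s + t) p \<in> fiber V p" for p
    using subspace_add[OF fiber_subspace section_in_fiber[OF s] section_in_fiber[OF t]] by simp
  fix U r e c i
  assume U: "open U" "frame_on V U r e" "\<And>p. p \<in> U \<Longrightarrow> (s + t) p = (\<Sum>i<r. c i p *\<^sub>R e i p)"
    and i: "i < r"
  obtain a where a: "\<And>p. p \<in> U \<Longrightarrow> s p = (\<Sum>i<r. a i p *\<^sub>R e i p)"
    using frame_coeffs_exist[OF U(2) section_in_fiber[OF s]] by blast
  obtain b where b: "\<And>p. p \<in> U \<Longrightarrow> t p = (\<Sum>i<r. b i p *\<^sub>R e i p)"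
    using frame_coeffs_exist[OF U(2) section_in_fiber[OF t]] by blast
  have "a i p + b i p = c i p" if "p \<in> U" for p
    by (rule frame_coeffs_unique[OF U(2) that _ i])
       (use a[OF that] b[OF that] U(3)[OF that] in \<open>simp add: sum.distrib scaleR_left_distrib\<close>)
  moreover have "smooth_fun_on M U (\<lambda>p. a i p + b i p)"
    using sections_coeff_smooth[OF s U(1,2) a i] sections_coeff_smooth[OF t U(1,2) b i]
    by (simp add: smooth_fun_on_add M U)
  ultimately show "smooth_fun_on M U (c i)"
    by (rule smooth_fun_on_cong[OF M U(1)])
qed

lemma sections_fscale:
  assumes f: "f \<in> Cinf M" and s: "s \<in> sections V"
  shows "f \<odot> s \<in> sections V"
proof (rule sectionsI)
  show "(f \<odot> s) p \<in> fiber V p" for p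
    using subspace_scale[OF fiber_subspace section_in_fiber[OF s]] by (simp add: fscale_def)
  fix U r e c i
  assume U: "open U" "frame_on V U r e" "\<And>p. p \<in> U \<Longrightarrow> (f \<odot> s) p = (\<Sum>i<r. c i p *\<^sub>R e i p)"
    and i: "i < r"
  obtain a where a: "\<And>p. p \<in> U \<Longrightarrow> s p = (\<Sum>i<r. a i p *\<^sub>R e i p)"
    using frame_coeffs_exist[OF U(2) section_in_fiber[OF s]] by blast
  have "f p * a i p = c i p" if "p \<in> U" for p
    by (rule frame_coeffs_unique[OF U(2) that _ i])
       (use a[OF that] U(3)[OF that] in \<open>simp add: fscale_def scaleR_right.sum\<close>)
  moreover have "smooth_fun_on M U f"
    using f smooth_fun_on_subset[of M UNIV f U] by (simp add: Cinf_def)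
  then have "smooth_fun_on M U (\<lambda>p. f p * a i p)"
    using sections_coeff_smooth[OF s U(1,2) a i] by (simp add: smooth_fun_on_mult M U)
  ultimately show "smooth_fun_on M U (c i)"
    by (rule smooth_fun_on_cong[OF M U(1)])
qed

lemma sections_0: "0 \<in> sections V"
proof (rule sectionsI)
  show "0 p \<in> fiber V p" for p
    using subspace_0[OF fiber_subspace] by simp
  fix U r e c i
  assume U: "open U" "frame_on V U r e" "\<And>p. p \<in> U \<Longrightarrow> 0 p = (\<Sum>i<r. c i p *\<^sub>R e i p)"
    and i: "i < r"
  have "0 = c i p" if "p \<in> U" for p
    by (rule frame_coeffs_unique[OF U(2) that _ i]) (use U(3)[OF that] in simp)
  then show "smooth_fun_on M U (c i)"
    by (rule smooth_fun_on_cong[OF M U(1) _ smooth_fun_on_const])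
qed

lemma sections_scaleR: "s \<in> sections V \<Longrightarrow> c *\<^sub>R s \<in> sections V"
  using sections_fscale[OF Cinf_const, of s c] by (simp add: fscale_def scaleR_fun_def)

lemma sections_minus: "s \<in> sections V \<Longrightarrow> - s \<in> sections V"
  using sections_scaleR[of s "-1"] by simp

lemma sections_diff: "s \<in> sections V \<Longrightarrow> t \<in> sections V \<Longrightarrow> s - t \<in> sections V"
  using sections_add[OF _ sections_minus, of s t] by simp

text \<open>
  Frames consist of global sections, so every vector of a fibre extends to a global section, and
  identities between bundle maps may be tested on sections.
\<close>

lemma section_through:
  assumes "v \<in> fiber V p"
  obtains s where "s \<in> sections V" "s p = v"
proof -
  obtain U r e where U: "open U" "p \<in> U" "frame_on V U r e"
    using frame_at by metis
  obtain c where c: "\<And>q. q \<in> {p} \<Longrightarrow> v = (\<Sum>i<r. c i q *\<^sub>R e i q)"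
    by (rule frame_coeffs_exist[of V "{p}" r e "\<lambda>_. v"]) (use U assms in \<open>auto simp: frame_on_def\<close>)
  have e: "e i \<in> sections V" if "i < r" for i using U(3) that by (simp add: frame_on_def)
  define s where "s k = (\<lambda>q. \<Sum>i<k. c i p *\<^sub>R e i q)" for k
  have "s k \<in> sections V" if "k \<le> r" for k
    using that
  proof (induction k)
    case 0
    then show ?case using sections_0 by (simp add: s_def zero_fun_def)
  next
    case (Suc k)
    then have "s k + c k p *\<^sub>R e k \<in> sections V"
      by (intro sections_add sections_scaleR e) auto
    then show ?case by (simp add: s_def plus_fun_def scaleR_fun_def)
  qed
  then have "s r \<in> sections V" by simp
  moreover have "s r p = v" using c by (simp add: s_def)
  ultimately show ?thesis using that by blast
qed

end

section \<open>Vector fields\<close>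

lemma der_lie_bracket: "der (lie_bracket X Y) f = der X (der Y f) - der Y (der X f)"
  by (auto simp: der_def lie_bracket_def fun_eq_iff)

lemma der_plus: "der (X + Y) f = der X f + der Y f"
  by (simp add: der_def fun_eq_iff)

lemma der_minus: "der (X - Y) f = der X f - der Y f"
  by (simp add: der_def fun_eq_iff)

lemma der_fscale: "der (h \<odot> X) f = h * der X f"
  by (simp add: der_def fscale_def scaleR_fun_def fun_eq_iff)

lemma der_zero: "der 0 f = 0"
  by (simp add: der_def fun_eq_iff)

lemma fscale_add_right: "f \<odot> (s + t) = f \<odot> s + f \<odot> t"
  by (simp add: fscale_def fun_eq_iff scaleR_right_distrib)

lemma fscale_diff_right: "f \<odot> (s - t) = f \<odot> s - f \<odot> t"
  by (simp add: fscale_def fun_eq_iff scaleR_right_diff_distrib)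

lemma fscale_add_left: "(f + h) \<odot> s = f \<odot> s + h \<odot> s"
  by (simp add: fscale_def fun_eq_iff scaleR_left_distrib)

lemma fscale_diff_left: "(f - h) \<odot> s = f \<odot> s - h \<odot> s"
  by (simp add: fscale_def fun_eq_iff scaleR_left_diff_distrib)

lemma fscale_zero_right: "f \<odot> 0 = 0"
  by (simp add: fscale_def fun_eq_iff)

lemma mult_scaleR_fun: "f * (c *\<^sub>R h) = c *\<^sub>R (f * h)" for f h :: "'m \<Rightarrow> real"
  by (simp add: scaleR_fun_def fun_eq_iff)

lemma der_uminus: "der (- X) f = - der X f"
  by (simp add: der_def fun_eq_iff)

locale manifold =
  fixes M :: "('m::{t2_space, second_countable_topology}, 'a::real_normed_vector) atlas"
  assumes manifold: "smooth_manifold M"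
begin

abbreviation VF :: "('m \<Rightarrow> 'm tvec) set" where
  "VF \<equiv> sections (tangent_bundle M)"

lemmas Cinf_closed[simp, intro] =
  Cinf_0 Cinf_add[OF manifold] Cinf_mult[OF manifold] Cinf_scaleR[OF manifold]
  Cinf_minus[OF manifold] Cinf_diff[OF manifold] Cinf_const

lemma VF_iff: "X \<in> VF \<longleftrightarrow> (\<forall>p. X p \<in> tangent_space M p) \<and> (\<forall>f\<in>Cinf M. der X f \<in> Cinf M)"
  by (simp add: tangent_bundle_def)

lemma der_closed[simp, intro]: "X \<in> VF \<Longrightarrow> f \<in> Cinf M \<Longrightarrow> der X f \<in> Cinf M"
  by (simp add: VF_iff)

lemma der_add: "X \<in> VF \<Longrightarrow> f \<in> Cinf M \<Longrightarrow> h \<in> Cinf M \<Longrightarrow> der X (f + h) = der X f + der X h"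
  by (simp add: VF_iff der_def tangent_space_def fun_eq_iff)

lemma der_scaleR: "X \<in> VF \<Longrightarrow> f \<in> Cinf M \<Longrightarrow> der X (c *\<^sub>R f) = c *\<^sub>R der X f"
  by (simp add: VF_iff der_def tangent_space_def fun_eq_iff scaleR_fun_def)

lemma der_mult: "X \<in> VF \<Longrightarrow> f \<in> Cinf M \<Longrightarrow> h \<in> Cinf M \<Longrightarrow> der X (f * h) = f * der X h + h * der X f"
  by (simp add: VF_iff der_def tangent_space_def fun_eq_iff)

lemma der_neg: "X \<in> VF \<Longrightarrow> f \<in> Cinf M \<Longrightarrow> der X (- f) = - der X f"
  using der_scaleR[of X f "-1"] by simp

lemma der_diff: "X \<in> VF \<Longrightarrow> f \<in> Cinf M \<Longrightarrow> h \<in> Cinf M \<Longrightarrow> der X (f - h) = der X f - der X h"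
  using der_add[of X f "-h"] der_neg[of X h] by simp

lemma der_of_0[simp]: "X \<in> VF \<Longrightarrow> der X 0 = 0"
  using der_scaleR[of X 0 0] by simp

lemma der_outside: "X \<in> VF \<Longrightarrow> f \<notin> Cinf M \<Longrightarrow> der X f = 0"
  by (simp add: VF_iff der_def tangent_space_def fun_eq_iff)

lemma VF_I:
  assumes cl: "\<And>f. f \<in> Cinf M \<Longrightarrow> der X f \<in> Cinf M"
    and add: "\<And>f h. f \<in> Cinf M \<Longrightarrow> h \<in> Cinf M \<Longrightarrow> der X (f + h) = der X f + der X h"
    and mult: "\<And>f h. f \<in> Cinf M \<Longrightarrow> h \<in> Cinf M \<Longrightarrow> der X (f * h) = f * der X h + h * der X f"
    and sc: "\<And>c f. f \<in> Cinf M \<Longrightarrow> der X (c *\<^sub>R f) = c *\<^sub>R der X f"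
    and out: "\<And>f. f \<notin> Cinf M \<Longrightarrow> der X f = 0"
  shows "X \<in> VF"
proof -
  have "X p \<in> tangent_space M p" for p
    unfolding tangent_space_def
    using fun_cong[OF add, of _ _ p] fun_cong[OF mult, of _ _ p] fun_cong[OF sc, of _ _ p]
      fun_cong[OF out, of _ p]
    by (simp add: der_def scaleR_fun_def)
  then show ?thesis by (simp add: VF_iff cl)
qed

text \<open>
  Tangent vectors vanish on non-smooth functions, so a vector field is determined by its action on
  smooth ones. Hence identities between vector fields, such as the Jacobi identity, are
  computations with derivations.
\<close>

lemma VF_eqI:
  assumes "X \<in> VF" "Y \<in> VF" "\<And>f. f \<in> Cinf M \<Longrightarrow> der X f = der Y f"
  shows "X = Y"
proof -
  have "der X f = der Y f" for f
    using assms der_outside[of X f] der_outside[of Y f] by (cases "f \<in> Cinf M") auto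
  then show ?thesis by (simp add: der_def fun_eq_iff)
qed

lemma VF_add[simp, intro]: "X \<in> VF \<Longrightarrow> Y \<in> VF \<Longrightarrow> X + Y \<in> VF"
  by (rule VF_I) (simp_all add: der_plus der_add der_mult der_scaleR der_outside algebra_simps)

lemma VF_diff[simp, intro]: "X \<in> VF \<Longrightarrow> Y \<in> VF \<Longrightarrow> X - Y \<in> VF"
  by (rule VF_I) (simp_all add: der_minus der_add der_mult der_scaleR der_outside algebra_simps)

lemma VF_0[simp, intro]: "0 \<in> VF"
  by (rule VF_I) (simp_all add: der_zero)

lemma VF_minus[simp, intro]: "X \<in> VF \<Longrightarrow> - X \<in> VF"
  using VF_diff[of 0 X] by simp

lemma VF_fscale[simp, intro]: "f \<in> Cinf M \<Longrightarrow> X \<in> VF \<Longrightarrow> f \<odot> X \<in> VF"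
  by (rule VF_I) (simp_all add: der_fscale der_add der_mult der_scaleR der_outside mult_scaleR_fun algebra_simps)

lemma VF_lie[simp, intro]:
  assumes "X \<in> VF" "Y \<in> VF" shows "lie_bracket X Y \<in> VF"
  by (rule VF_I)
     (use assms in \<open>simp_all add: der_lie_bracket der_add der_mult der_scaleR der_outside algebra_simps\<close>)

lemmas der_simps = der_plus der_uminus der_minus der_fscale der_zero der_lie_bracket der_add der_diff der_mult
  der_neg

lemma lie_add_left: "X \<in> VF \<Longrightarrow> Y \<in> VF \<Longrightarrow> Z \<in> VF \<Longrightarrow>
    lie_bracket (X + Y) Z = lie_bracket X Z + lie_bracket Y Z"
  by (rule VF_eqI) (simp_all add: der_simps)

lemma lie_add_right: "X \<in> VF \<Longrightarrow> Y \<in> VF \<Longrightarrow> Z \<in> VF \<Longrightarrow>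
    lie_bracket X (Y + Z) = lie_bracket X Y + lie_bracket X Z"
  by (rule VF_eqI) (simp_all add: der_simps)

lemma lie_diff_right: "X \<in> VF \<Longrightarrow> Y \<in> VF \<Longrightarrow> Z \<in> VF \<Longrightarrow>
    lie_bracket X (Y - Z) = lie_bracket X Y - lie_bracket X Z"
  by (rule VF_eqI) (simp_all add: der_simps)

lemma lie_0_left[simp]: "X \<in> VF \<Longrightarrow> lie_bracket 0 X = 0"
  by (rule VF_eqI) (simp_all add: der_simps)

lemma lie_0_right[simp]: "X \<in> VF \<Longrightarrow> lie_bracket X 0 = 0"
  by (rule VF_eqI) (simp_all add: der_simps)

lemma lie_swap: "X \<in> VF \<Longrightarrow> Y \<in> VF \<Longrightarrow> lie_bracket Y X = - lie_bracket X Y"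
  by (rule VF_eqI) (simp_all add: der_simps)

lemma lie_fscale_right: "X \<in> VF \<Longrightarrow> Y \<in> VF \<Longrightarrow> f \<in> Cinf M \<Longrightarrow>
    lie_bracket X (f \<odot> Y) = der X f \<odot> Y + f \<odot> lie_bracket X Y"
  by (rule VF_eqI) (simp_all add: der_simps algebra_simps)

lemma lie_fscale_left: "X \<in> VF \<Longrightarrow> Y \<in> VF \<Longrightarrow> f \<in> Cinf M \<Longrightarrow>
    lie_bracket (f \<odot> X) Y = f \<odot> lie_bracket X Y - der Y f \<odot> X"
  by (rule VF_eqI) (simp_all add: der_simps algebra_simps)

lemma lie_jacobi: "X \<in> VF \<Longrightarrow> Y \<in> VF \<Longrightarrow> Z \<in> VF \<Longrightarrow>
    lie_bracket (lie_bracket X Y) Z = lie_bracket X (lie_bracket Y Z) - lie_bracket Y (lie_bracket X Z)"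
  by (rule VF_eqI) (simp_all add: der_simps)

end

section \<open>Courant algebroids\<close>

locale courant = manifold M
  for M :: "('m::{t2_space, second_countable_topology}, 'a::real_normed_vector) atlas" +
  fixes C :: "('m, 'e::real_vector) courant"
  assumes courant: "courant_algebroid M C"
begin

abbreviation S :: "('m \<Rightarrow> 'e) set" where
  "S \<equiv> Sec C"

abbreviation dorfman :: "('m \<Rightarrow> 'e) \<Rightarrow> ('m \<Rightarrow> 'e) \<Rightarrow> 'm \<Rightarrow> 'e" (infixr "\<star>" 76) where
  "e \<star> e' \<equiv> brac C e e'"

abbreviation pair :: "('m \<Rightarrow> 'e) \<Rightarrow> ('m \<Rightarrow> 'e) \<Rightarrow> 'm \<Rightarrow> real" where
  "pair e e' \<equiv> met (metric C) e e'"

abbreviation act :: "('m \<Rightarrow> 'e) \<Rightarrow> ('m \<Rightarrow> real) \<Rightarrow> 'm \<Rightarrow> real" where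
  "act e f \<equiv> der (anc C e) f"

lemmas courant_laws = courant[unfolded courant_algebroid_def]

lemma vector_bundle_E: "vector_bundle M (bun C)"
  using courant_laws by (elim conjE)

lemma pseudo_metric_E: "pseudo_metric M (bun C) (metric C)"
  using courant_laws by (elim conjE)

lemma bundle_map_anchor: "bundle_map (bun C) (tangent_bundle M) (anchor C)"
  using courant_laws by (elim conjE)

lemmas S_closed[simp, intro] =
  sections_0[OF manifold vector_bundle_E] sections_add[OF manifold vector_bundle_E]
  sections_diff[OF manifold vector_bundle_E] sections_minus[OF manifold vector_bundle_E]
  sections_fscale[OF manifold vector_bundle_E] sections_scaleR[OF manifold vector_bundle_E]

lemmas S_fiber = section_in_fiber[OF manifold vector_bundle_E]

lemmas bracket_laws = courant_laws[THEN conjunct2, THEN conjunct2, THEN conjunct2]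

lemma brac_closed[simp, intro]: "e \<in> S \<Longrightarrow> e' \<in> S \<Longrightarrow> e \<star> e' \<in> S"
  using bracket_laws[THEN conjunct1] by blast

lemma brac_add_left: "a \<in> S \<Longrightarrow> b \<in> S \<Longrightarrow> c \<in> S \<Longrightarrow> (a + b) \<star> c = a \<star> c + b \<star> c"
  and brac_add_right: "a \<in> S \<Longrightarrow> b \<in> S \<Longrightarrow> c \<in> S \<Longrightarrow> a \<star> (b + c) = a \<star> b + a \<star> c"
  using bracket_laws[THEN conjunct2, THEN conjunct1] by simp_all

lemma brac_fscale: "f \<in> Cinf M \<Longrightarrow> a \<in> S \<Longrightarrow> b \<in> S \<Longrightarrow> a \<star> (f \<odot> b) = act a f \<odot> b + f \<odot> (a \<star> b)"
  using bracket_laws[THEN conjunct2, THEN conjunct2, THEN conjunct2, THEN conjunct1] by simp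

lemma act_pair: "a \<in> S \<Longrightarrow> b \<in> S \<Longrightarrow> c \<in> S \<Longrightarrow> act a (pair b c) = pair (a \<star> b) c + pair b (a \<star> c)"
  using bracket_laws[THEN conjunct2, THEN conjunct2, THEN conjunct2, THEN conjunct2, THEN conjunct1] by simp

lemma brac_square: "a \<in> S \<Longrightarrow> c \<in> S \<Longrightarrow> pair (a \<star> a) c = (1/2) *\<^sub>R act c (pair a a)"
  using bracket_laws[THEN conjunct2, THEN conjunct2, THEN conjunct2, THEN conjunct2, THEN conjunct2, THEN conjunct1] by simp

lemma brac_leibniz: "a \<in> S \<Longrightarrow> b \<in> S \<Longrightarrow> c \<in> S \<Longrightarrow> a \<star> (b \<star> c) = (a \<star> b) \<star> c + b \<star> (a \<star> c)"
  using bracket_laws[THEN conjunct2, THEN conjunct2, THEN conjunct2, THEN conjunct2, THEN conjunct2, THEN conjunct2] by blast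

lemmas metric_laws = pseudo_metric_E[unfolded pseudo_metric_def smooth_pairing_def]

lemma metric_add_left: "u \<in> fiber (bun C) p \<Longrightarrow> v \<in> fiber (bun C) p \<Longrightarrow> w \<in> fiber (bun C) p \<Longrightarrow>
    metric C p (u + v) w = metric C p u w + metric C p v w"
  and metric_add_right: "u \<in> fiber (bun C) p \<Longrightarrow> v \<in> fiber (bun C) p \<Longrightarrow> w \<in> fiber (bun C) p \<Longrightarrow>
    metric C p u (v + w) = metric C p u v + metric C p u w"
  using metric_laws[THEN conjunct1, THEN conjunct1] by blast+

lemma metric_scaleR: "u \<in> fiber (bun C) p \<Longrightarrow> v \<in> fiber (bun C) p \<Longrightarrow>
    metric C p (c *\<^sub>R u) v = c * metric C p u v"
  "u \<in> fiber (bun C) p \<Longrightarrow> v \<in> fiber (bun C) p \<Longrightarrow> metric C p u (c *\<^sub>R v) = c * metric C p u v"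
  using metric_laws[THEN conjunct1, THEN conjunct2, THEN conjunct1] by blast+

lemma metric_sym: "u \<in> fiber (bun C) p \<Longrightarrow> v \<in> fiber (bun C) p \<Longrightarrow> metric C p u v = metric C p v u"
  using metric_laws[THEN conjunct2, THEN conjunct1] by blast

lemma metric_nondegenerate:
  "u \<in> fiber (bun C) p \<Longrightarrow> (\<And>v. v \<in> fiber (bun C) p \<Longrightarrow> metric C p u v = 0) \<Longrightarrow> u = 0"
  using metric_laws[THEN conjunct2, THEN conjunct2] by blast

lemma pair_closed[simp, intro]: "a \<in> S \<Longrightarrow> b \<in> S \<Longrightarrow> pair a b \<in> Cinf M"
  using metric_laws[THEN conjunct1, THEN conjunct2, THEN conjunct2] unfolding met_def by blast

lemma pair_sym: "a \<in> S \<Longrightarrow> b \<in> S \<Longrightarrow> pair a b = pair b a"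
  by (simp add: met_def fun_eq_iff S_fiber metric_sym)

lemma pair_add_left: "a \<in> S \<Longrightarrow> b \<in> S \<Longrightarrow> c \<in> S \<Longrightarrow> pair (a + b) c = pair a c + pair b c"
  by (simp add: met_def fun_eq_iff S_fiber metric_add_left)

lemma pair_add_right: "a \<in> S \<Longrightarrow> b \<in> S \<Longrightarrow> c \<in> S \<Longrightarrow> pair a (b + c) = pair a b + pair a c"
  by (simp add: met_def fun_eq_iff S_fiber metric_add_right)

lemma pair_fscale_left: "a \<in> S \<Longrightarrow> b \<in> S \<Longrightarrow> pair (f \<odot> a) b = f * pair a b"
  by (simp add: met_def fun_eq_iff S_fiber metric_scaleR fscale_def)

lemma pair_fscale_right: "a \<in> S \<Longrightarrow> b \<in> S \<Longrightarrow> pair a (f \<odot> b) = f * pair a b"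
  by (simp add: met_def fun_eq_iff S_fiber metric_scaleR fscale_def)

lemma pair_scaleR_left: "a \<in> S \<Longrightarrow> b \<in> S \<Longrightarrow> pair (c *\<^sub>R a) b = c *\<^sub>R pair a b"
  by (simp add: met_def fun_eq_iff S_fiber metric_scaleR scaleR_fun_def)

lemma pair_scaleR_right: "a \<in> S \<Longrightarrow> b \<in> S \<Longrightarrow> pair a (c *\<^sub>R b) = c *\<^sub>R pair a b"
  by (simp add: met_def fun_eq_iff S_fiber metric_scaleR scaleR_fun_def)

lemma pair_diff_left: "a \<in> S \<Longrightarrow> b \<in> S \<Longrightarrow> c \<in> S \<Longrightarrow> pair (a - b) c = pair a c - pair b c"
  using pair_add_left[of a "-b" c] pair_scaleR_left[of b c "-1"] by simp

lemma pair_diff_right: "a \<in> S \<Longrightarrow> b \<in> S \<Longrightarrow> c \<in> S \<Longrightarrow> pair a (b - c) = pair a b - pair a c"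
  using pair_add_right[of a b "-c"] pair_scaleR_right[of a c "-1"] by simp

lemma pair_0_left[simp]: "a \<in> S \<Longrightarrow> pair 0 a = 0"
  using pair_scaleR_left[of a a 0] by simp

lemma pair_0_right[simp]: "a \<in> S \<Longrightarrow> pair a 0 = 0"
  using pair_scaleR_right[of a a 0] by simp

lemma section_nondegenerate:
  assumes "e \<in> S" "\<And>z. z \<in> S \<Longrightarrow> pair e z = 0"
  shows "e = 0"
proof
  fix p
  have "metric C p (e p) v = 0" if v: "v \<in> fiber (bun C) p" for v
  proof -
    obtain z where "z \<in> S" "z p = v"
      using section_through[OF manifold vector_bundle_E v] by blast
    then show ?thesis using fun_cong[OF assms(2), of z p] by (simp add: met_def)
  qed
  then show "e p = 0 p" using metric_nondegenerate[OF S_fiber[OF assms(1)], of p] by simp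
qed

lemma anc_VF[simp, intro]: "e \<in> S \<Longrightarrow> anc C e \<in> VF"
  using bundle_map_anchor by (simp add: bundle_map_def)

lemma anc_add: "a \<in> S \<Longrightarrow> b \<in> S \<Longrightarrow> anc C (a + b) = anc C a + anc C b"
  using bundle_map_anchor by (simp add: bundle_map_def on_sec_def fun_eq_iff S_fiber)

lemma anc_fscale: "a \<in> S \<Longrightarrow> anc C (f \<odot> a) = f \<odot> anc C a"
  using bundle_map_anchor by (simp add: bundle_map_def on_sec_def fun_eq_iff S_fiber fscale_def)

lemma anc_diff: "a \<in> S \<Longrightarrow> b \<in> S \<Longrightarrow> anc C (a - b) = anc C a - anc C b"
  using anc_add[of "a - b" b] by simp

lemma anc_0: "anc C 0 = 0"
  using anc_diff[of 0 0] by simp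

lemma act_add: "a \<in> S \<Longrightarrow> b \<in> S \<Longrightarrow> act (a + b) f = act a f + act b f"
  by (simp add: anc_add der_plus)

lemma act_fscale: "a \<in> S \<Longrightarrow> act (h \<odot> a) f = h * act a f"
  by (simp add: anc_fscale der_fscale)

text \<open>
  The Leibniz identity for \<open>a\<close>, \<open>b\<close> and \<open>f \<odot> c\<close>, compared with the one for \<open>a\<close>, \<open>b\<close> and \<open>c\<close>, leaves
  \<open>([\<rho>(a), \<rho>(b)] f - \<rho>(a \<circ> b) f) c = 0\<close>. At a point where the fibre of \<open>E\<close> is not zero, \<open>c\<close> can be
  chosen with a nonzero value; where it is zero, all anchors vanish.
\<close>

lemma anc_brac:
  assumes a: "a \<in> S" and b: "b \<in> S"
  shows "anc C (a \<star> b) = lie_bracket (anc C a) (anc C b)"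
proof (rule VF_eqI)
  fix f assume f: "f \<in> Cinf M"
  show "der (anc C (a \<star> b)) f = der (lie_bracket (anc C a) (anc C b)) f"
  proof
    fix p
    show "der (anc C (a \<star> b)) f p = der (lie_bracket (anc C a) (anc C b)) f p"
    proof (cases "\<exists>v\<in>fiber (bun C) p. v \<noteq> 0")
      case True
      then obtain v where v: "v \<in> fiber (bun C) p" "v \<noteq> 0" by blast
      obtain c where c: "c \<in> S" "c p = v"
        using section_through[OF manifold vector_bundle_E v(1)] by blast
      have "a \<star> (b \<star> (f \<odot> c)) = (a \<star> b) \<star> (f \<odot> c) + b \<star> (a \<star> (f \<odot> c))"
        using a b c f by (intro brac_leibniz) auto
      then have "(act a (act b f) - act b (act a f) - act (a \<star> b) f) \<odot> c = 0"
        using a b c f by (simp add: brac_fscale brac_add_right brac_leibniz[OF a b c(1)]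
            fscale_add_right fscale_add_left fscale_diff_left algebra_simps)
      then have "(act a (act b f) p - act b (act a f) p - act (a \<star> b) f p) *\<^sub>R v = 0"
        using c(2) by (auto simp: fscale_def fun_eq_iff)
      then show ?thesis using v(2) by (simp add: der_lie_bracket)
    next
      case False
      have "anc C e p = 0" if "e \<in> S" for e
      proof -
        have "e p = 0" using False S_fiber[OF that] by blast
        then show ?thesis using fun_cong[OF anc_0, of p] by (simp add: on_sec_def)
      qed
      then show ?thesis using a b by (simp add: der_def lie_bracket_def)
    qed
  qed
qed (use a b in auto)

lemma act_brac: "a \<in> S \<Longrightarrow> b \<in> S \<Longrightarrow> act (a \<star> b) f = act a (act b f) - act b (act a f)"
  by (simp add: anc_brac der_lie_bracket)

text \<open>
  Polarization of the axiom for \<open>e \<circ> e\<close>.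
\<close>

lemma pair_sym_brac:
  assumes "a \<in> S" "b \<in> S" "c \<in> S"
  shows "pair (a \<star> b) c + pair (b \<star> a) c = act c (pair a b)"
proof -
  have sq: "pair ((a + b) \<star> (a + b)) c = (1/2) *\<^sub>R act c (pair (a + b) (a + b))"
    using assms by (simp add: brac_square)
  have l: "pair ((a + b) \<star> (a + b)) c =
      pair (a \<star> a) c + pair (a \<star> b) c + pair (b \<star> a) c + pair (b \<star> b) c"
    using assms by (simp add: brac_add_left brac_add_right pair_add_left)
  have "pair (a + b) (a + b) = pair a a + pair b b + 2 *\<^sub>R pair a b"
    using assms by (simp add: pair_add_left pair_add_right pair_sym[of b a] scaleR_2)
  then have r: "act c (pair (a + b) (a + b)) = act c (pair a a) + act c (pair b b) + 2 *\<^sub>R act c (pair a b)"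
    using assms by (simp add: der_add der_scaleR)
  have aa: "pair (a \<star> a) c = (1/2) *\<^sub>R act c (pair a a)" "pair (b \<star> b) c = (1/2) *\<^sub>R act c (pair b b)"
    using assms by (simp_all add: brac_square)
  show ?thesis
  proof
    fix p
    show "(pair (a \<star> b) c + pair (b \<star> a) c) p = act c (pair a b) p"
      using fun_cong[OF sq[unfolded l r aa], of p] by (simp add: scaleR_fun_def field_simps)
  qed
qed

definition N :: "('m \<Rightarrow> 'e) set" where
  "N = {s \<in> S. \<forall>p. s p \<in> ker_perp C p}"

lemma N_I: "s \<in> S \<Longrightarrow> (\<And>p. s p \<in> ker_perp C p) \<Longrightarrow> s \<in> N"
  by (simp add: N_def)

lemma N_perp: "s \<in> N \<Longrightarrow> s p \<in> ker_perp C p"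
  by (simp add: N_def)

lemma N_S[simp, dest]: "s \<in> N \<Longrightarrow> s \<in> S"
  by (simp add: N_def)

text \<open>
  Pairing with a section of \<open>(ker \<rho>)\<^sup>\<bottom>\<close> only sees the anchor of the other section. In
  \<open>loday_d2_D_N\<close> and \<open>\<eta>_N\<close> this reduces the vanishing of a form to the vanishing of a vector field.
\<close>

lemma pair_N_ker:
  assumes "s \<in> N" "z \<in> S" "anc C z = 0"
  shows "pair s z = 0" "pair z s = 0"
proof -
  have "z p \<in> ker_anchor C p" for p
  proof -
    have "anchor C p (z p) = 0"
      using fun_cong[OF assms(3), of p] unfolding on_sec_def zero_fun_def .
    then show ?thesis unfolding ker_anchor_def using S_fiber[OF assms(2), of p] by blast
  qed
  moreover have "s p \<in> ker_perp C p" for p by (rule N_perp[OF assms(1)])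
  ultimately have "metric C p (s p) (z p) = 0" for p unfolding ker_perp_def by blast
  then show *: "pair s z = 0" unfolding met_def zero_fun_def by (intro ext)
  show "pair z s = 0" using * pair_sym[OF N_S[OF assms(1)] assms(2)] by simp
qed

text \<open>
  The symmetric part of the bracket is \<open>\<rho>\<^sup>* d g(a, b)\<close>, which pairs to zero with \<open>ker \<rho>\<close>.
\<close>

lemma sym_brac_N:
  assumes "a \<in> S" "b \<in> S"
  shows "a \<star> b + b \<star> a \<in> N"
proof -
  have "(a \<star> b + b \<star> a) p \<in> ker_perp C p" for p
    unfolding ker_perp_def
  proof (intro CollectI conjI ballI)
    show "(a \<star> b + b \<star> a) p \<in> fiber (bun C) p"
      by (rule S_fiber[OF S_closed(2)[OF brac_closed[OF assms] brac_closed[OF assms(2,1)]]])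
    fix v assume "v \<in> ker_anchor C p"
    then have v: "v \<in> fiber (bun C) p" "anchor C p v = 0" by (auto simp: ker_anchor_def)
    obtain c where c: "c \<in> S" "c p = v"
      using section_through[OF manifold vector_bundle_E v(1)] by blast
    have "pair (a \<star> b + b \<star> a) c p = act c (pair a b) p"
      using pair_sym_brac assms c by (simp add: pair_add_left)
    then show "metric C p ((a \<star> b + b \<star> a) p) v = 0"
      using c v by (simp add: met_def der_def on_sec_def)
  qed
  then show ?thesis
    by (rule N_I[OF S_closed(2)[OF brac_closed[OF assms] brac_closed[OF assms(2,1)]]])
qed

end

section \<open>The quotients and the Bott action\<close>

locale courant_quotients = courant M C
  for M :: "('m::{t2_space, second_countable_topology}, 'a::real_normed_vector) atlas"
    and C :: "('m, 'e::real_vector) courant" +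
  fixes Q :: "('m, 'e, 'w::real_vector, 'g::real_vector, 'b::real_vector) quots"
  assumes quotients: "quotients_of M C Q"
begin

abbreviation \<Gamma>A :: "('m \<Rightarrow> 'w) set" where "\<Gamma>A \<equiv> sections (A_bun Q)"
abbreviation \<Gamma>G :: "('m \<Rightarrow> 'g) set" where "\<Gamma>G \<equiv> sections (G_bun Q)"
abbreviation \<Gamma>B :: "('m \<Rightarrow> 'b) set" where "\<Gamma>B \<equiv> sections (B_bun Q)"
abbreviation \<Gamma>F :: "('m \<Rightarrow> 'm tvec) set" where "\<Gamma>F \<equiv> sections (char_dist M C)"
abbreviation prA :: "('m \<Rightarrow> 'e) \<Rightarrow> 'm \<Rightarrow> 'w" where "prA e \<equiv> on_sec (A_pr Q) e"
abbreviation prB :: "('m \<Rightarrow> 'm tvec) \<Rightarrow> 'm \<Rightarrow> 'b" where "prB X \<equiv> on_sec (B_pr Q) X"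

lemma quotient_A: "quotient_bundle M (bun C) (ker_perp C) (A_bun Q) (A_pr Q)"
  and quotient_G: "quotient_bundle M (subbundle (bun C) (ker_anchor C)) (ker_perp C) (G_bun Q) (G_pr Q)"
  and quotient_B: "quotient_bundle M (tangent_bundle M) (fiber (char_dist M C)) (B_bun Q) (B_pr Q)"
  using quotients by (auto simp: quotients_of_def)

lemma vector_bundle_A: "vector_bundle M (A_bun Q)"
  and vector_bundle_G: "vector_bundle M (G_bun Q)"
  and vector_bundle_B: "vector_bundle M (B_bun Q)"
  using quotient_A[unfolded quotient_bundle_def, THEN conjunct1]
    quotient_G[unfolded quotient_bundle_def, THEN conjunct1]
    quotient_B[unfolded quotient_bundle_def, THEN conjunct1] .

lemmas \<Gamma>A_closed[simp, intro] =
  sections_0[OF manifold vector_bundle_A] sections_add[OF manifold vector_bundle_A]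
  sections_fscale[OF manifold vector_bundle_A]

lemmas \<Gamma>G_closed[simp, intro] =
  sections_0[OF manifold vector_bundle_G] sections_add[OF manifold vector_bundle_G]
  sections_diff[OF manifold vector_bundle_G] sections_fscale[OF manifold vector_bundle_G]

lemmas \<Gamma>B_closed[simp, intro] =
  sections_0[OF manifold vector_bundle_B] sections_add[OF manifold vector_bundle_B]
  sections_diff[OF manifold vector_bundle_B] sections_fscale[OF manifold vector_bundle_B]

lemmas \<Gamma>G_fiber = section_in_fiber[OF manifold vector_bundle_G]

lemma bundle_map_A: "bundle_map (bun C) (A_bun Q) (A_pr Q)"
  using quotient_A unfolding quotient_bundle_def by (elim conjE)

lemma bundle_map_B: "bundle_map (tangent_bundle M) (B_bun Q) (B_pr Q)"
  using quotient_B unfolding quotient_bundle_def by (elim conjE)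

lemma bundle_map_add: "bundle_map V W \<phi> \<Longrightarrow> u \<in> fiber V p \<Longrightarrow> v \<in> fiber V p \<Longrightarrow> \<phi> p (u + v) = \<phi> p u + \<phi> p v"
  and bundle_map_scaleR: "bundle_map V W \<phi> \<Longrightarrow> u \<in> fiber V p \<Longrightarrow> \<phi> p (c *\<^sub>R u) = c *\<^sub>R \<phi> p u"
  and bundle_map_section: "bundle_map V W \<phi> \<Longrightarrow> s \<in> sections V \<Longrightarrow> on_sec \<phi> s \<in> sections W"
  by (auto simp: bundle_map_def)

lemma VF_fiber: "X \<in> VF \<Longrightarrow> X p \<in> fiber (tangent_bundle M) p"
  unfolding tangent_bundle_def by simp

lemma prB_closed[simp, intro]: "X \<in> VF \<Longrightarrow> prB X \<in> \<Gamma>B"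
  by (rule bundle_map_section[OF bundle_map_B])

lemma prB_add: "X \<in> VF \<Longrightarrow> Y \<in> VF \<Longrightarrow> prB (X + Y) = prB X + prB Y"
  by (simp add: on_sec_def fun_eq_iff bundle_map_add[OF bundle_map_B] VF_fiber)

lemma prB_fscale: "X \<in> VF \<Longrightarrow> prB (f \<odot> X) = f \<odot> prB X"
  by (simp add: on_sec_def fun_eq_iff bundle_map_scaleR[OF bundle_map_B] VF_fiber fscale_def)

lemma prB_diff: "X \<in> VF \<Longrightarrow> Y \<in> VF \<Longrightarrow> prB (X - Y) = prB X - prB Y"
  using prB_add[of "X - Y" Y] by simp

lemma prB_0[simp]: "prB 0 = 0"
  using prB_diff[of 0 0] by simp

lemma prB_minus: "X \<in> VF \<Longrightarrow> prB (- X) = - prB X"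
  using prB_diff[of 0 X] by simp

lemma \<Gamma>F_iff: "X \<in> \<Gamma>F \<longleftrightarrow> X \<in> VF \<and> (\<forall>p. X p \<in> fiber (char_dist M C) p)"
  unfolding char_dist_def subbundle_def by simp

lemma \<Gamma>F_VF[simp, dest]: "X \<in> \<Gamma>F \<Longrightarrow> X \<in> VF"
  unfolding \<Gamma>F_iff by simp

lemma \<Gamma>F_fiber: "X \<in> \<Gamma>F \<Longrightarrow> X p \<in> fiber (char_dist M C) p"
  unfolding \<Gamma>F_iff by simp

text \<open>
  Sections of \<open>F\<close> are the kernel of the projection to \<open>B\<close>; this makes their closure properties
  consequences of linearity.
\<close>

lemma \<Gamma>F_iff_prB:
  assumes "X \<in> VF" shows "X \<in> \<Gamma>F \<longleftrightarrow> prB X = 0"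
proof -
  have "\<forall>p. {u \<in> fiber (tangent_bundle M) p. B_pr Q p u = 0} = fiber (char_dist M C) p"
    using quotient_B unfolding quotient_bundle_def by (elim conjE)
  then have "X p \<in> fiber (char_dist M C) p \<longleftrightarrow> B_pr Q p (X p) = 0" for p
    using VF_fiber[OF assms, of p] by blast
  then have "(\<forall>p. X p \<in> fiber (char_dist M C) p) \<longleftrightarrow> prB X = 0"
    unfolding on_sec_def fun_eq_iff by simp
  then show ?thesis using assms unfolding \<Gamma>F_iff by blast
qed

lemma \<Gamma>F_I: "X \<in> VF \<Longrightarrow> prB X = 0 \<Longrightarrow> X \<in> \<Gamma>F"
  using \<Gamma>F_iff_prB by blast

lemma \<Gamma>F_prB: "X \<in> \<Gamma>F \<Longrightarrow> prB X = 0"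
  using \<Gamma>F_iff_prB[OF \<Gamma>F_VF] by blast

lemma \<Gamma>F_add[simp, intro]: "X \<in> \<Gamma>F \<Longrightarrow> Y \<in> \<Gamma>F \<Longrightarrow> X + Y \<in> \<Gamma>F"
  by (rule \<Gamma>F_I) (simp_all add: prB_add \<Gamma>F_prB)

lemma \<Gamma>F_diff[simp, intro]: "X \<in> \<Gamma>F \<Longrightarrow> Y \<in> \<Gamma>F \<Longrightarrow> X - Y \<in> \<Gamma>F"
  by (rule \<Gamma>F_I) (simp_all add: prB_diff \<Gamma>F_prB)

lemma \<Gamma>F_0[simp, intro]: "0 \<in> \<Gamma>F"
  by (rule \<Gamma>F_I) simp_all

lemma \<Gamma>F_fscale[simp, intro]: "f \<in> Cinf M \<Longrightarrow> X \<in> \<Gamma>F \<Longrightarrow> f \<odot> X \<in> \<Gamma>F"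
  by (rule \<Gamma>F_I) (simp_all add: prB_fscale fscale_zero_right \<Gamma>F_prB)

lemma char_dist_fiber: "fiber (char_dist M C) p = anchor C p ` fiber (bun C) p"
  unfolding char_dist_def subbundle_def by simp

lemma anc_\<Gamma>F[simp, intro]: "e \<in> S \<Longrightarrow> anc C e \<in> \<Gamma>F"
  unfolding \<Gamma>F_iff char_dist_fiber using anc_VF S_fiber unfolding on_sec_def by blast

definition liftB :: "('m \<Rightarrow> 'b) \<Rightarrow> 'm \<Rightarrow> 'm tvec" where
  "liftB b = lift_sec (tangent_bundle M) (B_pr Q) b"

definition liftA :: "('m \<Rightarrow> 'w) \<Rightarrow> 'm \<Rightarrow> 'e" where
  "liftA a = lift_sec (bun C) (A_pr Q) a"

lemma liftB:
  assumes "b \<in> \<Gamma>B" shows liftB_VF[simp, intro]: "liftB b \<in> VF" and prB_liftB: "prB (liftB b) = b"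
proof -
  have "on_sec (B_pr Q) ` VF = \<Gamma>B"
    using quotient_B unfolding quotient_bundle_def by (elim conjE)
  with assms have "b \<in> on_sec (B_pr Q) ` VF" by (simp only:)
  then have "\<exists>t. t \<in> VF \<and> on_sec (B_pr Q) t = b" by (simp only: image_iff) metis
  note * = someI_ex[OF this]
  show "liftB b \<in> VF" "prB (liftB b) = b"
    unfolding liftB_def lift_sec_def by (rule *[THEN conjunct1], rule *[THEN conjunct2])
qed

lemma liftA:
  assumes "a \<in> \<Gamma>A" shows liftA_S[simp, intro]: "liftA a \<in> S" and prA_liftA: "prA (liftA a) = a"
proof -
  have "on_sec (A_pr Q) ` S = \<Gamma>A"
    using quotient_A unfolding quotient_bundle_def by (elim conjE)
  with assms have "a \<in> on_sec (A_pr Q) ` S" by (simp only:)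
  then have "\<exists>t. t \<in> S \<and> on_sec (A_pr Q) t = a" by (simp only: image_iff) metis
  note * = someI_ex[OF this]
  show "liftA a \<in> S" "prA (liftA a) = a"
    unfolding liftA_def lift_sec_def by (rule *[THEN conjunct1], rule *[THEN conjunct2])
qed

lemma prA_closed[simp, intro]: "e \<in> S \<Longrightarrow> prA e \<in> \<Gamma>A"
  by (rule bundle_map_section[OF bundle_map_A])

lemma prA_add: "e \<in> S \<Longrightarrow> e' \<in> S \<Longrightarrow> prA (e + e') = prA e + prA e'"
  by (simp add: on_sec_def fun_eq_iff bundle_map_add[OF bundle_map_A] S_fiber)

lemma prA_fscale: "e \<in> S \<Longrightarrow> prA (f \<odot> e) = f \<odot> prA e"
  by (simp add: on_sec_def fun_eq_iff bundle_map_scaleR[OF bundle_map_A] S_fiber fscale_def)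

lemma prA_eq_iff:
  assumes "e \<in> S" "e' \<in> S" shows "prA e = prA e' \<longleftrightarrow> e - e' \<in> N"
proof -
  have "\<forall>p. {u \<in> fiber (bun C) p. A_pr Q p u = 0} = ker_perp C p"
    using quotient_A unfolding quotient_bundle_def by (elim conjE)
  then have "(e - e') p \<in> ker_perp C p \<longleftrightarrow> A_pr Q p ((e - e') p) = 0" for p
    using S_fiber[OF S_closed(3)[OF assms], of p] by blast
  then have "e - e' \<in> N \<longleftrightarrow> prA (e - e') = 0"
    using assms unfolding N_def by (auto simp: on_sec_def fun_eq_iff)
  also have "prA (e - e') = prA e - prA e'"
    using prA_add[of "e - e'" e'] assms by simp
  finally show ?thesis by (simp only: right_minus_eq)
qed

text \<open>The Bott action, for arguments in \<open>\<Gamma>(E)\<close> instead of \<open>\<Gamma>(A\<^sub>E)\<close>.\<close>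

definition bott_E :: "('m \<Rightarrow> 'e) \<Rightarrow> ('m \<Rightarrow> 'b) \<Rightarrow> 'm \<Rightarrow> 'b" where
  "bott_E e b = prB (lie_bracket (anc C e) (liftB b))"

lemma bott_eq: "bott M C Q a b = bott_E (liftA a) b"
  by (simp add: bott_def bott_E_def ample_anchor_def liftA_def liftB_def)

end

section \<open>Dissections\<close>

text \<open>
  A dissection is used only through the complement \<open>\<Psi>(\<G> \<oplus> F)\<close> of \<open>(ker \<rho>)\<^sup>\<bottom> = \<Psi>(F\<^sup>*)\<close> in \<open>E\<close>.
\<close>

locale dissected = courant_quotients M C Q
  for M :: "('m::{t2_space, second_countable_topology}, 'a::real_normed_vector) atlas"
    and C :: "('m, 'e::real_vector) courant"
    and Q :: "('m, 'e, 'w::real_vector, 'g::real_vector, 'b::real_vector) quots" +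
  fixes \<Psi> :: "('m, 'e, 'g) diss"
  assumes dissection: "dissection M C Q \<Psi>"
begin

abbreviation Fd :: "'m \<Rightarrow> ('m tvec \<Rightarrow> real) set" where
  "Fd p \<equiv> fiber (dual_bundle M (char_dist M C)) p"
abbreviation Gf :: "'m \<Rightarrow> 'g set" where "Gf p \<equiv> fiber (G_bun Q) p"
abbreviation Ff :: "'m \<Rightarrow> 'm tvec set" where "Ff p \<equiv> fiber (char_dist M C) p"
abbreviation Ef :: "'m \<Rightarrow> 'e set" where "Ef p \<equiv> fiber (bun C) p"
abbreviation gG :: "('m \<Rightarrow> 'g) \<Rightarrow> ('m \<Rightarrow> 'g) \<Rightarrow> 'm \<Rightarrow> real" where "gG r s \<equiv> met (G_metric C Q) r s"
abbreviation cG :: "('m \<Rightarrow> 'e) \<Rightarrow> 'm \<Rightarrow> 'g" where "cG e \<equiv> comp_G M C Q \<Psi> e"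

definition Lsec :: "('m \<Rightarrow> 'g) \<Rightarrow> ('m \<Rightarrow> 'm tvec) \<Rightarrow> 'm \<Rightarrow> 'e" where
  "Lsec r x = (\<lambda>p. \<Psi> p (0, r p, x p))"

definition Lpart :: "('m \<Rightarrow> 'e) \<Rightarrow> 'm \<Rightarrow> 'e" where
  "Lpart e = Lsec (cG e) (anc C e)"

lemma source_fiber: "fiber (diss_source M C Q) p = Fd p \<times> Gf p \<times> Ff p"
  unfolding diss_source_def direct_sum3_def by simp

lemmas dissection_laws = dissection[unfolded dissection_def bundle_iso_def]

lemma Psi_map: "bundle_map (diss_source M C Q) (bun C) \<Psi>"
  and Psi_bij: "bij_betw (\<Psi> p) (Fd p \<times> Gf p \<times> Ff p) (Ef p)"
  and Psi_inv_map: "bundle_map (bun C) (diss_source M C Q) (diss_inv M C Q \<Psi>)"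
  using dissection_laws[THEN conjunct1, THEN conjunct1]
    dissection_laws[THEN conjunct1, THEN conjunct2, THEN conjunct1, THEN spec, of p]
    dissection_laws[THEN conjunct1, THEN conjunct2, THEN conjunct2]
  unfolding source_fiber diss_inv_def .

lemma Psi_metric: "\<xi> \<in> Fd p \<Longrightarrow> r \<in> Gf p \<Longrightarrow> x \<in> Ff p \<Longrightarrow> \<eta> \<in> Fd p \<Longrightarrow> s \<in> Gf p \<Longrightarrow> y \<in> Ff p \<Longrightarrow>
    metric C p (\<Psi> p (\<xi>, r, x)) (\<Psi> p (\<eta>, s, y)) = \<xi> y / 2 + \<eta> x / 2 + G_metric C Q p r s"
  using dissection_laws[THEN conjunct2, THEN conjunct1, THEN spec, of p, THEN bspec, of "(\<xi>, r, x)"]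
  unfolding source_fiber by simp

lemma Psi_anchor: "\<xi> \<in> Fd p \<Longrightarrow> r \<in> Gf p \<Longrightarrow> x \<in> Ff p \<Longrightarrow> anchor C p (\<Psi> p (\<xi>, r, x)) = x"
  using dissection_laws[THEN conjunct2, THEN conjunct2, THEN conjunct1, THEN spec, of p, THEN bspec, of "(\<xi>, r, x)"]
  unfolding source_fiber by simp

lemma Psi_in: "\<xi> \<in> Fd p \<Longrightarrow> r \<in> Gf p \<Longrightarrow> x \<in> Ff p \<Longrightarrow> \<Psi> p (\<xi>, r, x) \<in> Ef p"
  using bij_betwE[OF Psi_bij] by auto

lemma Psi_cases:
  assumes "u \<in> Ef p"
  obtains \<xi> r x where "\<xi> \<in> Fd p" "r \<in> Gf p" "x \<in> Ff p" "u = \<Psi> p (\<xi>, r, x)"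
  using Psi_bij[of p] assms unfolding bij_betw_def by blast

lemma Psi_inv: "\<xi> \<in> Fd p \<Longrightarrow> r \<in> Gf p \<Longrightarrow> x \<in> Ff p \<Longrightarrow> diss_inv M C Q \<Psi> p (\<Psi> p (\<xi>, r, x)) = (\<xi>, r, x)"
  unfolding diss_inv_def inv_map_def source_fiber
  using bij_betw_inv_into_left[OF Psi_bij] by auto

lemma Psi_inject: "\<xi> \<in> Fd p \<Longrightarrow> r \<in> Gf p \<Longrightarrow> x \<in> Ff p \<Longrightarrow> \<eta> \<in> Fd p \<Longrightarrow> s \<in> Gf p \<Longrightarrow> y \<in> Ff p \<Longrightarrow>
    \<Psi> p (\<xi>, r, x) = \<Psi> p (\<eta>, s, y) \<Longrightarrow> (\<xi>, r, x) = (\<eta>, s, y)"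
  by (drule arg_cong[of _ _ "diss_inv M C Q \<Psi> p"]) (simp only: Psi_inv)

lemma Psi_add: "\<xi> \<in> Fd p \<Longrightarrow> r \<in> Gf p \<Longrightarrow> x \<in> Ff p \<Longrightarrow> \<eta> \<in> Fd p \<Longrightarrow> s \<in> Gf p \<Longrightarrow> y \<in> Ff p \<Longrightarrow>
    \<Psi> p (\<xi> + \<eta>, r + s, x + y) = \<Psi> p (\<xi>, r, x) + \<Psi> p (\<eta>, s, y)"
  using Psi_map[unfolded bundle_map_def, THEN conjunct2, THEN conjunct1, rule_format,
      of "(\<xi>, r, x)" p "(\<eta>, s, y)"]
  unfolding source_fiber by simp

lemma Psi_scaleR: "\<xi> \<in> Fd p \<Longrightarrow> r \<in> Gf p \<Longrightarrow> x \<in> Ff p \<Longrightarrow>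
    \<Psi> p (c *\<^sub>R \<xi>, c *\<^sub>R r, c *\<^sub>R x) = c *\<^sub>R \<Psi> p (\<xi>, r, x)"
  using Psi_map[unfolded bundle_map_def, THEN conjunct2, THEN conjunct2, THEN conjunct1, rule_format,
      of "(\<xi>, r, x)" p c]
  unfolding source_fiber by simp

lemma Fd_iff: "\<xi> \<in> Fd p \<longleftrightarrow> (\<forall>u\<in>Ff p. \<forall>v\<in>Ff p. \<xi> (u + v) = \<xi> u + \<xi> v) \<and>
    (\<forall>c. \<forall>u\<in>Ff p. \<xi> (c *\<^sub>R u) = c * \<xi> u) \<and> (\<forall>u. u \<notin> Ff p \<longrightarrow> \<xi> u = 0)"
  unfolding dual_bundle_def Let_def by simp

lemma Fd_0[simp]: "0 \<in> Fd p" by (simp add: Fd_iff)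

lemma Gf_0[simp]: "0 \<in> Gf p" using \<Gamma>G_fiber[of 0 p] by simp

lemma Ff_0[simp]: "0 \<in> Ff p" using \<Gamma>F_fiber[of 0 p] by simp

lemma Fd_at_0[simp]: "\<xi> \<in> Fd p \<Longrightarrow> \<xi> 0 = 0"
  using Fd_iff[of \<xi> p, THEN iffD1, THEN conjunct2, THEN conjunct1, rule_format, of 0 0] by simp

lemma Psi_0[simp]: "\<Psi> p (0, 0, 0) = 0"
  using Psi_scaleR[of 0 p 0 0 0] by simp

lemma G_metric_0[simp]: assumes "r \<in> Gf p" shows "G_metric C Q p r 0 = 0" "G_metric C Q p 0 r = 0"
proof -
  have u: "\<Psi> p (0, r, 0) \<in> Ef p" "0 \<in> Ef p" using assms Psi_in[of 0 p r 0] Psi_in[of 0 p 0 0] by simp_all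
  show "G_metric C Q p r 0 = 0"
    using Psi_metric[of 0 p r 0 0 0 0] assms metric_scaleR(2)[OF u(1) u(1), of 0] by simp
  show "G_metric C Q p 0 r = 0"
    using Psi_metric[of 0 p 0 0 0 r 0] assms metric_scaleR(1)[OF u(1) u(1), of 0] by simp
qed

lemma Ff_subspace: "subspace (Ff p)"
proof (rule subspaceI)
  note bm = bundle_map_anchor[unfolded bundle_map_def]
  fix x y assume "x \<in> Ff p" "y \<in> Ff p"
  then obtain u v where uv: "u \<in> Ef p" "v \<in> Ef p" "x = anchor C p u" "y = anchor C p v"
    unfolding char_dist_fiber by blast
  have "x + y = anchor C p (u + v)" using bm[THEN conjunct2, THEN conjunct1] uv by simp
  then show "x + y \<in> Ff p" unfolding char_dist_fiber
    using uv subspace_add[OF fiber_subspace[OF manifold vector_bundle_E]] by blast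
next
  note bm = bundle_map_anchor[unfolded bundle_map_def]
  fix c x assume "x \<in> Ff p"
  then obtain u where u: "u \<in> Ef p" "x = anchor C p u"
    unfolding char_dist_fiber by blast
  have "c *\<^sub>R x = anchor C p (c *\<^sub>R u)" using bm[THEN conjunct2, THEN conjunct2, THEN conjunct1] u by simp
  then show "c *\<^sub>R x \<in> Ff p" unfolding char_dist_fiber
    using u subspace_scale[OF fiber_subspace[OF manifold vector_bundle_E]] by blast
qed simp

text \<open>
  The fibres of \<open>F\<^sup>*\<close> are full algebraic duals, so they separate the points of \<open>F\<close>.
\<close>

lemma Fd_separates:
  assumes "x \<in> Ff p" "\<And>\<eta>. \<eta> \<in> Fd p \<Longrightarrow> \<eta> x = 0"
  shows "x = 0"
proof (rule ccontr)
  assume "x \<noteq> 0"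
  then have "independent {x}" by simp
  from linear_independent_extend[OF this, of "\<lambda>_. 1::real"]
  obtain f :: "'m tvec \<Rightarrow> real" where f: "linear f" "f x = 1" by auto
  define \<eta> where "\<eta> u = (if u \<in> Ff p then f u else 0)" for u
  have "\<eta> \<in> Fd p"
    unfolding Fd_iff \<eta>_def
    using subspace_add[OF Ff_subspace] subspace_scale[OF Ff_subspace] linear_add[OF f(1)] linear_scale[OF f(1)]
    by simp
  then have "\<eta> x = 0" by (rule assms(2))
  then show False using f(2) assms(1) by (simp add: \<eta>_def)
qed

text \<open>
  Orthogonality to \<open>\<Psi>(F\<^sup>*) \<subseteq> ker \<rho>\<close> forces the component in \<open>F\<close> to vanish, and orthogonality to
  \<open>\<Psi>(\<G>) \<subseteq> ker \<rho>\<close> the one in \<open>\<G>\<close>, because the metric of \<open>\<G>\<close> is nondegenerate.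
\<close>

lemma ker_perp_iff:
  assumes "\<xi> \<in> Fd p" "r \<in> Gf p" "x \<in> Ff p"
  shows "\<Psi> p (\<xi>, r, x) \<in> ker_perp C p \<longleftrightarrow> r = 0 \<and> x = 0"
proof
  assume perp: "\<Psi> p (\<xi>, r, x) \<in> ker_perp C p"
  have *: "metric C p (\<Psi> p (\<xi>, r, x)) (\<Psi> p (\<eta>, s, 0)) = 0" if "\<eta> \<in> Fd p" "s \<in> Gf p" for \<eta> s
  proof -
    have "\<Psi> p (\<eta>, s, 0) \<in> ker_anchor C p"
      using that Psi_in[of \<eta> p s 0] Psi_anchor[of \<eta> p s 0] by (simp add: ker_anchor_def)
    then show ?thesis using perp unfolding ker_perp_def by blast
  qed
  have "x = 0"
  proof (rule Fd_separates[OF assms(3)])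
    fix \<eta> assume "\<eta> \<in> Fd p"
    then show "\<eta> x = 0" using *[of \<eta> 0] assms by (simp add: Psi_metric)
  qed
  have "G_metric C Q p r s = 0" if "s \<in> Gf p" for s
    using *[of 0 s] assms that by (simp add: Psi_metric)
  then have "metric C p (\<Psi> p (0, r, 0)) v = 0" if "v \<in> Ef p" for v
    using that assms by (elim Psi_cases) (simp add: Psi_metric)
  then have "\<Psi> p (0, r, 0) = 0"
    using metric_nondegenerate[OF Psi_in] assms by simp
  then have "r = 0" using Psi_inject[of 0 p r 0 0 0 0] assms by simp
  with \<open>x = 0\<close> show "r = 0 \<and> x = 0" by simp
next
  assume "r = 0 \<and> x = 0"
  then have 0: "r = 0" "x = 0" by auto
  have "metric C p (\<Psi> p (\<xi>, 0, 0)) v = 0" if "v \<in> ker_anchor C p" for v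
  proof -
    have "v \<in> Ef p" "anchor C p v = 0" using that by (auto simp: ker_anchor_def)
    then show ?thesis using assms by (elim Psi_cases) (simp add: Psi_metric Psi_anchor)
  qed
  then show "\<Psi> p (\<xi>, r, x) \<in> ker_perp C p"
    using assms Psi_in[of \<xi> p 0 0] unfolding 0 ker_perp_def by simp
qed

lemma section_cases:
  assumes "e \<in> S"
  obtains \<xi> where "\<xi> \<in> Fd p" "cG e p \<in> Gf p" "anc C e p \<in> Ff p" "e p = \<Psi> p (\<xi>, cG e p, anc C e p)"
proof -
  obtain \<xi> r x where *: "\<xi> \<in> Fd p" "r \<in> Gf p" "x \<in> Ff p" "e p = \<Psi> p (\<xi>, r, x)"
    using Psi_cases[OF S_fiber[OF assms, of p]] by blast
  then have "cG e p = r" "anc C e p = x"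
    by (simp_all add: comp_G_def Psi_inv on_sec_def Psi_anchor)
  with * that show ?thesis by blast
qed

lemma cG_closed[simp, intro]:
  assumes "e \<in> S" shows "cG e \<in> \<Gamma>G"
proof -
  have "on_sec (diss_inv M C Q \<Psi>) e \<in> sections (diss_source M C Q)"
    by (rule bundle_map_section[OF Psi_inv_map assms])
  then show ?thesis unfolding diss_source_def direct_sum3_def comp_G_def on_sec_def by simp
qed

lemma cG_add: "e \<in> S \<Longrightarrow> e' \<in> S \<Longrightarrow> cG (e + e') = cG e + cG e'"
  by (simp add: comp_G_def fun_eq_iff S_fiber bundle_map_add[OF Psi_inv_map])

lemma cG_fscale: "e \<in> S \<Longrightarrow> cG (f \<odot> e) = f \<odot> cG e"
  by (simp add: comp_G_def fun_eq_iff S_fiber fscale_def bundle_map_scaleR[OF Psi_inv_map])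

lemma Lsec_closed[simp, intro]:
  assumes "r \<in> \<Gamma>G" "x \<in> \<Gamma>F" shows "Lsec r x \<in> S"
proof -
  have "(\<lambda>p. (0, r p, x p)) \<in> sections (diss_source M C Q)"
    using assms Cinf_const[of 0 M]
    unfolding diss_source_def direct_sum3_def dual_bundle_def Let_def on_sec_def by simp
  then have "on_sec \<Psi> (\<lambda>p. (0, r p, x p)) \<in> S"
    by (rule bundle_map_section[OF Psi_map])
  then show ?thesis by (simp add: on_sec_def Lsec_def)
qed

lemma cG_Lsec[simp]: "r \<in> \<Gamma>G \<Longrightarrow> x \<in> \<Gamma>F \<Longrightarrow> cG (Lsec r x) = r"
  by (simp add: comp_G_def Lsec_def Psi_inv \<Gamma>G_fiber \<Gamma>F_fiber)

lemma anc_Lsec[simp]: "r \<in> \<Gamma>G \<Longrightarrow> x \<in> \<Gamma>F \<Longrightarrow> anc C (Lsec r x) = x"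
  by (simp add: on_sec_def Lsec_def Psi_anchor \<Gamma>G_fiber \<Gamma>F_fiber)

lemma Lsec_add: "r \<in> \<Gamma>G \<Longrightarrow> x \<in> \<Gamma>F \<Longrightarrow> r' \<in> \<Gamma>G \<Longrightarrow> x' \<in> \<Gamma>F \<Longrightarrow>
    Lsec (r + r') (x + x') = Lsec r x + Lsec r' x'"
  using Psi_add[of 0 _ _ _ 0] by (simp add: Lsec_def fun_eq_iff \<Gamma>G_fiber \<Gamma>F_fiber)

lemma Lsec_fscale: "r \<in> \<Gamma>G \<Longrightarrow> x \<in> \<Gamma>F \<Longrightarrow> Lsec (f \<odot> r) (f \<odot> x) = f \<odot> Lsec r x"
  using Psi_scaleR[of 0] by (simp add: Lsec_def fscale_def fun_eq_iff \<Gamma>G_fiber \<Gamma>F_fiber)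

lemma Lsec_0[simp]: "Lsec 0 0 = 0"
  by (simp add: Lsec_def fun_eq_iff)

lemma Lsec_diff: "r \<in> \<Gamma>G \<Longrightarrow> x \<in> \<Gamma>F \<Longrightarrow> r' \<in> \<Gamma>G \<Longrightarrow> x' \<in> \<Gamma>F \<Longrightarrow>
    Lsec (r - r') (x - x') = Lsec r x - Lsec r' x'"
  using Lsec_add[of "r - r'" "x - x'" r' x'] by simp

lemma pair_Lsec: "r \<in> \<Gamma>G \<Longrightarrow> x \<in> \<Gamma>F \<Longrightarrow> r' \<in> \<Gamma>G \<Longrightarrow> x' \<in> \<Gamma>F \<Longrightarrow>
    pair (Lsec r x) (Lsec r' x') = gG r r'"
  by (simp add: met_def Lsec_def fun_eq_iff Psi_metric \<Gamma>G_fiber \<Gamma>F_fiber)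

lemma Lpart_S[simp, intro]: "e \<in> S \<Longrightarrow> Lpart e \<in> S"
  by (simp add: Lpart_def)

lemma Lpart_add: "e \<in> S \<Longrightarrow> e' \<in> S \<Longrightarrow> Lpart (e + e') = Lpart e + Lpart e'"
  by (simp add: Lpart_def cG_add anc_add Lsec_add)

lemma diff_Lpart_N[simp, intro]:
  assumes "e \<in> S" shows "e - Lpart e \<in> N"
proof (rule N_I)
  show "e - Lpart e \<in> S" using assms by simp
  fix p
  obtain \<xi> where \<xi>: "\<xi> \<in> Fd p" "cG e p \<in> Gf p" "anc C e p \<in> Ff p" "e p = \<Psi> p (\<xi>, cG e p, anc C e p)"
    using section_cases[OF assms] by blast
  have "e p = \<Psi> p (\<xi>, 0, 0) + Lpart e p"
    using Psi_add[OF \<xi>(1) Gf_0 Ff_0 Fd_0 \<xi>(2,3)] \<xi>(4) by (simp add: Lpart_def Lsec_def)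
  then show "(e - Lpart e) p \<in> ker_perp C p"
    using ker_perp_iff[OF \<xi>(1) Gf_0 Ff_0] by simp
qed

lemma N_comps:
  assumes "s \<in> N" shows N_cG: "cG s = 0" and N_anc[simp]: "anc C s = 0"
proof -
  have "cG s p = 0 \<and> anc C s p = 0" for p
  proof -
    obtain \<xi> where \<xi>: "\<xi> \<in> Fd p" "cG s p \<in> Gf p" "anc C s p \<in> Ff p" "s p = \<Psi> p (\<xi>, cG s p, anc C s p)"
      using section_cases[OF N_S[OF assms]] by blast
    then show ?thesis using ker_perp_iff[OF \<xi>(1-3)] N_perp[OF assms, of p] by simp
  qed
  then show "cG s = 0" "anc C s = 0" by (simp_all add: fun_eq_iff)
qed

lemma pair_N_N: "s \<in> N \<Longrightarrow> t \<in> N \<Longrightarrow> pair s t = 0"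
  by (simp add: pair_N_ker)

text \<open>
  Invariance of the metric gives \<open>g(e \<circ> s, w) = 0\<close> for sections \<open>w\<close> of \<open>ker \<rho>\<close>, since \<open>e \<circ> w\<close> again
  lies in \<open>ker \<rho>\<close>. Sections of the form \<open>w = \<Psi>(0, r, 0)\<close> are enough to conclude that the part of
  \<open>e \<circ> s\<close> in the complement is zero. This avoids extending a vector of \<open>ker \<rho>\<close> to a section of
  \<open>ker \<rho>\<close>.
\<close>

lemma brac_N[simp, intro]:
  assumes e: "e \<in> S" and s: "s \<in> N" shows "e \<star> s \<in> N"
proof -
  define t where "t = e \<star> s"
  have t: "t \<in> S" and anc_t: "anc C t = 0"
    using e s by (simp_all add: t_def anc_brac)
  have L: "pair (Lpart t) z = 0" if z: "z \<in> S" for z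
  proof -
    define w where "w = Lsec (cG z) 0"
    have w: "w \<in> S" "anc C w = 0" using z by (simp_all add: w_def)
    have "pair (Lpart t) z = pair (Lpart t) (Lpart z) + pair (Lpart t) (z - Lpart z)"
      using z t by (simp add: pair_diff_right)
    also have "pair (Lpart t) (z - Lpart z) = 0"
      by (rule pair_N_ker(2)[OF diff_Lpart_N[OF z] Lpart_S[OF t]]) (use z t anc_t in \<open>simp add: Lpart_def\<close>)
    also have "pair (Lpart t) (Lpart z) = pair (Lpart t) w"
      using z t anc_t by (simp add: Lpart_def w_def pair_Lsec)
    also have "\<dots> = pair t w"
      using pair_N_ker(1)[OF diff_Lpart_N[OF t] w] t w by (simp add: pair_diff_left)
    also have "\<dots> = act e (pair s w) - pair s (e \<star> w)"
      using e s w by (simp add: t_def act_pair)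
    also have "\<dots> = 0"
      using e s w by (simp add: pair_N_ker anc_brac)
    finally show ?thesis by (simp add: zero_fun_def)
  qed
  have "Lpart t = 0" using section_nondegenerate[OF Lpart_S[OF t] L] .
  then show ?thesis using diff_Lpart_N[OF t] by (simp add: t_def)
qed

end

section \<open>Loday cochains\<close>

context courant_quotients
begin

text \<open>
  The Loday differential of a left Leibniz algebra in degrees 1 to 3: in the terms without an
  action, \<open>e\<^sub>i \<circ> e\<^sub>k\<close> replaces the argument \<open>e\<^sub>k\<close>, and \<open>e\<^sub>i\<close> with \<open>i < k\<close> is omitted. For cochains that are
  not skew the position matters.
\<close>

definition loday_d1 :: "(('m \<Rightarrow> 'b) \<Rightarrow> ('m \<Rightarrow> 'e) \<Rightarrow> 'm \<Rightarrow> real) \<Rightarrow>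
    ('m \<Rightarrow> 'b) \<Rightarrow> ('m \<Rightarrow> 'e) \<Rightarrow> ('m \<Rightarrow> 'e) \<Rightarrow> 'm \<Rightarrow> real" where
  "loday_d1 u b e\<^sub>1 e\<^sub>2 =
     act e\<^sub>1 (u b e\<^sub>2) - u (bott_E e\<^sub>1 b) e\<^sub>2 - (act e\<^sub>2 (u b e\<^sub>1) - u (bott_E e\<^sub>2 b) e\<^sub>1) - u b (e\<^sub>1 \<star> e\<^sub>2)"

definition loday_d2 :: "(('m \<Rightarrow> 'b) \<Rightarrow> ('m \<Rightarrow> 'e) \<Rightarrow> ('m \<Rightarrow> 'e) \<Rightarrow> 'm \<Rightarrow> real) \<Rightarrow>
    ('m \<Rightarrow> 'b) \<Rightarrow> ('m \<Rightarrow> 'e) \<Rightarrow> ('m \<Rightarrow> 'e) \<Rightarrow> ('m \<Rightarrow> 'e) \<Rightarrow> 'm \<Rightarrow> real" where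
  "loday_d2 D b e\<^sub>1 e\<^sub>2 e\<^sub>3 =
     act e\<^sub>1 (D b e\<^sub>2 e\<^sub>3) - D (bott_E e\<^sub>1 b) e\<^sub>2 e\<^sub>3 - (act e\<^sub>2 (D b e\<^sub>1 e\<^sub>3) - D (bott_E e\<^sub>2 b) e\<^sub>1 e\<^sub>3)
     + (act e\<^sub>3 (D b e\<^sub>1 e\<^sub>2) - D (bott_E e\<^sub>3 b) e\<^sub>1 e\<^sub>2)
     - D b (e\<^sub>1 \<star> e\<^sub>2) e\<^sub>3 - D b e\<^sub>2 (e\<^sub>1 \<star> e\<^sub>3) + D b e\<^sub>1 (e\<^sub>2 \<star> e\<^sub>3)"

definition loday_d3 :: "(('m \<Rightarrow> 'b) \<Rightarrow> ('m \<Rightarrow> 'e) \<Rightarrow> ('m \<Rightarrow> 'e) \<Rightarrow> ('m \<Rightarrow> 'e) \<Rightarrow> 'm \<Rightarrow> real) \<Rightarrow>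
    ('m \<Rightarrow> 'b) \<Rightarrow> ('m \<Rightarrow> 'e) \<Rightarrow> ('m \<Rightarrow> 'e) \<Rightarrow> ('m \<Rightarrow> 'e) \<Rightarrow> ('m \<Rightarrow> 'e) \<Rightarrow> 'm \<Rightarrow> real" where
  "loday_d3 W b e\<^sub>1 e\<^sub>2 e\<^sub>3 e\<^sub>4 =
     act e\<^sub>1 (W b e\<^sub>2 e\<^sub>3 e\<^sub>4) - W (bott_E e\<^sub>1 b) e\<^sub>2 e\<^sub>3 e\<^sub>4
     - (act e\<^sub>2 (W b e\<^sub>1 e\<^sub>3 e\<^sub>4) - W (bott_E e\<^sub>2 b) e\<^sub>1 e\<^sub>3 e\<^sub>4)
     + (act e\<^sub>3 (W b e\<^sub>1 e\<^sub>2 e\<^sub>4) - W (bott_E e\<^sub>3 b) e\<^sub>1 e\<^sub>2 e\<^sub>4)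
     - (act e\<^sub>4 (W b e\<^sub>1 e\<^sub>2 e\<^sub>3) - W (bott_E e\<^sub>4 b) e\<^sub>1 e\<^sub>2 e\<^sub>3)
     - W b (e\<^sub>1 \<star> e\<^sub>2) e\<^sub>3 e\<^sub>4 - W b e\<^sub>2 (e\<^sub>1 \<star> e\<^sub>3) e\<^sub>4 - W b e\<^sub>2 e\<^sub>3 (e\<^sub>1 \<star> e\<^sub>4)
     + W b e\<^sub>1 (e\<^sub>2 \<star> e\<^sub>3) e\<^sub>4 + W b e\<^sub>1 e\<^sub>3 (e\<^sub>2 \<star> e\<^sub>4) - W b e\<^sub>1 e\<^sub>2 (e\<^sub>3 \<star> e\<^sub>4)"

definition loday_cochain1 :: "(('m \<Rightarrow> 'b) \<Rightarrow> ('m \<Rightarrow> 'e) \<Rightarrow> 'm \<Rightarrow> real) \<Rightarrow> bool" where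
  "loday_cochain1 u \<longleftrightarrow>
     (\<forall>b\<in>\<Gamma>B. \<forall>e\<in>S. u b e \<in> Cinf M) \<and>
     (\<forall>b\<in>\<Gamma>B. \<forall>b'\<in>\<Gamma>B. \<forall>e\<in>S. u (b - b') e = u b e - u b' e) \<and>
     (\<forall>b\<in>\<Gamma>B. \<forall>e\<in>S. \<forall>e'\<in>S. u b (e + e') = u b e + u b e')"

definition loday_cochain2 :: "(('m \<Rightarrow> 'b) \<Rightarrow> ('m \<Rightarrow> 'e) \<Rightarrow> ('m \<Rightarrow> 'e) \<Rightarrow> 'm \<Rightarrow> real) \<Rightarrow> bool" where
  "loday_cochain2 D \<longleftrightarrow>
     (\<forall>b\<in>\<Gamma>B. \<forall>e\<in>S. \<forall>e'\<in>S. D b e e' \<in> Cinf M) \<and>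
     (\<forall>b\<in>\<Gamma>B. \<forall>b'\<in>\<Gamma>B. \<forall>e\<in>S. \<forall>e'\<in>S. D (b - b') e e' = D b e e' - D b' e e') \<and>
     (\<forall>b\<in>\<Gamma>B. \<forall>e\<in>S. \<forall>e'\<in>S. \<forall>z\<in>S. D b (e + e') z = D b e z + D b e' z \<and>
        D b z (e + e') = D b z e + D b z e')"

end

context dissected
begin

text \<open>
  A dissection lifts sections of \<open>F\<close> to sections of \<open>E\<close>, so \<open>F\<close> is involutive because the anchor is a
  morphism.
\<close>

lemma lie_\<Gamma>F[simp, intro]:
  assumes "x \<in> \<Gamma>F" "y \<in> \<Gamma>F" shows "lie_bracket x y \<in> \<Gamma>F"
proof -
  have "lie_bracket x y = anc C (Lsec 0 x \<star> Lsec 0 y)"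
    using assms by (simp add: anc_brac)
  also have "\<dots> \<in> \<Gamma>F"
    using assms by (intro anc_\<Gamma>F brac_closed Lsec_closed) auto
  finally show ?thesis .
qed

text \<open>
  By involutivity of \<open>F\<close>, the Bott action may be computed with an arbitrary lift of \<open>b\<close>.
\<close>

lemma prB_lie:
  assumes "e \<in> S" "Y \<in> VF"
  shows "prB (lie_bracket (anc C e) Y) = bott_E e (prB Y)"
proof -
  have L: "liftB (prB Y) \<in> VF" using assms by (intro liftB_VF prB_closed)
  have "Y - liftB (prB Y) \<in> \<Gamma>F"
    using assms L by (intro \<Gamma>F_I) (simp_all add: prB_diff prB_liftB)
  then have "prB (lie_bracket (anc C e) (Y - liftB (prB Y))) = 0"
    using assms by (intro \<Gamma>F_prB lie_\<Gamma>F) auto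
  then show ?thesis
    using assms L by (simp add: lie_diff_right prB_diff bott_E_def)
qed

lemma bott_E_closed[simp, intro]: "e \<in> S \<Longrightarrow> b \<in> \<Gamma>B \<Longrightarrow> bott_E e b \<in> \<Gamma>B"
  unfolding bott_E_def by (intro prB_closed VF_lie anc_VF liftB_VF)

lemma bott_E_add_right:
  assumes "e \<in> S" "b \<in> \<Gamma>B" "b' \<in> \<Gamma>B" shows "bott_E e (b + b') = bott_E e b + bott_E e b'"
  using prB_lie[OF assms(1), of "liftB b + liftB b'"] assms
  by (simp add: prB_add prB_liftB lie_add_right bott_E_def)

lemma bott_E_fscale_right:
  assumes "e \<in> S" "b \<in> \<Gamma>B" "f \<in> Cinf M" shows "bott_E e (f \<odot> b) = act e f \<odot> b + f \<odot> bott_E e b"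
  using prB_lie[OF assms(1), of "f \<odot> liftB b"] assms
  by (simp add: prB_add prB_fscale prB_liftB lie_fscale_right bott_E_def)

lemma bott_E_add_left: "e \<in> S \<Longrightarrow> e' \<in> S \<Longrightarrow> b \<in> \<Gamma>B \<Longrightarrow> bott_E (e + e') b = bott_E e b + bott_E e' b"
  by (simp add: bott_E_def anc_add lie_add_left prB_add)

lemma bott_E_fscale_left: "e \<in> S \<Longrightarrow> b \<in> \<Gamma>B \<Longrightarrow> f \<in> Cinf M \<Longrightarrow> bott_E (f \<odot> e) b = f \<odot> bott_E e b"
  by (simp add: bott_E_def anc_fscale lie_fscale_left prB_diff prB_fscale \<Gamma>F_prB[OF anc_\<Gamma>F] fscale_zero_right)

lemma bott_E_N[simp]: "s \<in> N \<Longrightarrow> b \<in> \<Gamma>B \<Longrightarrow> bott_E s b = 0"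
  by (simp add: bott_E_def)

text \<open>
  Flatness of the Bott connection, which makes the action on \<open>\<Gamma>(B)\<close> a representation.
\<close>

lemma bott_E_brac:
  assumes "e \<in> S" "e' \<in> S" "b \<in> \<Gamma>B"
  shows "bott_E (e \<star> e') b = bott_E e (bott_E e' b) - bott_E e' (bott_E e b)"
proof -
  have "bott_E e (bott_E e' b) = prB (lie_bracket (anc C e) (lie_bracket (anc C e') (liftB b)))"
       "bott_E e' (bott_E e b) = prB (lie_bracket (anc C e') (lie_bracket (anc C e) (liftB b)))"
    using prB_lie assms by (simp_all add: bott_E_def)
  then show ?thesis
    using assms by (simp add: bott_E_def anc_brac lie_jacobi prB_diff)
qed

text \<open>
  Both instances of \<open>d\<^sup>2 = 0\<close> follow from additivity of the cochain, the Leibniz identity and the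
  two representation laws \<open>act_brac\<close> and \<open>bott_E_brac\<close>.
\<close>

lemma loday_d2_loday_d1:
  assumes u: "loday_cochain1 u" and "b \<in> \<Gamma>B" "e\<^sub>1 \<in> S" "e\<^sub>2 \<in> S" "e\<^sub>3 \<in> S"
  shows "loday_d2 (loday_d1 u) b e\<^sub>1 e\<^sub>2 e\<^sub>3 = 0"
  using assms(2-)
  by (simp add: loday_d1_def loday_d2_def u[unfolded loday_cochain1_def] der_diff act_brac bott_E_brac
      brac_leibniz[of e\<^sub>1 e\<^sub>2 e\<^sub>3])

lemma loday_d3_loday_d2:
  assumes D: "loday_cochain2 D" and "b \<in> \<Gamma>B" "e\<^sub>1 \<in> S" "e\<^sub>2 \<in> S" "e\<^sub>3 \<in> S" "e\<^sub>4 \<in> S"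
  shows "loday_d3 (loday_d2 D) b e\<^sub>1 e\<^sub>2 e\<^sub>3 e\<^sub>4 = 0"
  using assms(2-)
  by (simp add: loday_d3_def loday_d2_def D[unfolded loday_cochain2_def] der_diff der_add act_brac bott_E_brac
      brac_leibniz[of e\<^sub>1 e\<^sub>2 e\<^sub>3] brac_leibniz[of e\<^sub>1 e\<^sub>2 e\<^sub>4] brac_leibniz[of e\<^sub>1 e\<^sub>3 e\<^sub>4]
      brac_leibniz[of e\<^sub>2 e\<^sub>3 e\<^sub>4])

end

section \<open>Cochains of the ample Lie algebroid\<close>

context courant_quotients
begin

text \<open>
  The forms on \<open>E\<close> that come from cochains of \<open>A\<^sub>E\<close> with values in \<open>B\<^sup>*\<close>. Linearity and
  vanishing on \<open>(ker \<rho>)\<^sup>\<bottom>\<close> are imposed on the last argument; skew-symmetry carries them to the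
  others.
\<close>

definition skew_form2 :: "(('m \<Rightarrow> 'b) \<Rightarrow> ('m \<Rightarrow> 'e) \<Rightarrow> ('m \<Rightarrow> 'e) \<Rightarrow> 'm \<Rightarrow> real) \<Rightarrow> bool" where
  "skew_form2 \<eta> \<longleftrightarrow>
     (\<forall>b\<in>\<Gamma>B. \<forall>e\<in>S. \<forall>e'\<in>S. \<eta> b e e' \<in> Cinf M \<and> \<eta> b e e' = - \<eta> b e' e) \<and>
     (\<forall>b\<in>\<Gamma>B. \<forall>b'\<in>\<Gamma>B. \<forall>e\<in>S. \<forall>e'\<in>S. \<eta> (b + b') e e' = \<eta> b e e' + \<eta> b' e e') \<and>
     (\<forall>f\<in>Cinf M. \<forall>b\<in>\<Gamma>B. \<forall>e\<in>S. \<forall>e'\<in>S. \<eta> (f \<odot> b) e e' = f * \<eta> b e e') \<and>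
     (\<forall>b\<in>\<Gamma>B. \<forall>e\<in>S. \<forall>s\<in>S. \<forall>t\<in>S. \<eta> b e (s + t) = \<eta> b e s + \<eta> b e t) \<and>
     (\<forall>f\<in>Cinf M. \<forall>b\<in>\<Gamma>B. \<forall>e\<in>S. \<forall>s\<in>S. \<eta> b e (f \<odot> s) = f * \<eta> b e s) \<and>
     (\<forall>b\<in>\<Gamma>B. \<forall>e\<in>S. \<forall>s\<in>N. \<eta> b e s = 0)"

definition skew_form3 :: "(('m \<Rightarrow> 'b) \<Rightarrow> ('m \<Rightarrow> 'e) \<Rightarrow> ('m \<Rightarrow> 'e) \<Rightarrow> ('m \<Rightarrow> 'e) \<Rightarrow> 'm \<Rightarrow> real) \<Rightarrow> bool" where
  "skew_form3 \<omega> \<longleftrightarrow>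
     (\<forall>b\<in>\<Gamma>B. \<forall>e\<^sub>1\<in>S. \<forall>e\<^sub>2\<in>S. \<forall>e\<^sub>3\<in>S. \<omega> b e\<^sub>1 e\<^sub>2 e\<^sub>3 \<in> Cinf M \<and>
        \<omega> b e\<^sub>1 e\<^sub>2 e\<^sub>3 = - \<omega> b e\<^sub>2 e\<^sub>1 e\<^sub>3 \<and> \<omega> b e\<^sub>1 e\<^sub>2 e\<^sub>3 = - \<omega> b e\<^sub>1 e\<^sub>3 e\<^sub>2) \<and>
     (\<forall>b\<in>\<Gamma>B. \<forall>b'\<in>\<Gamma>B. \<forall>e\<^sub>1\<in>S. \<forall>e\<^sub>2\<in>S. \<forall>e\<^sub>3\<in>S.
        \<omega> (b + b') e\<^sub>1 e\<^sub>2 e\<^sub>3 = \<omega> b e\<^sub>1 e\<^sub>2 e\<^sub>3 + \<omega> b' e\<^sub>1 e\<^sub>2 e\<^sub>3) \<and>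
     (\<forall>f\<in>Cinf M. \<forall>b\<in>\<Gamma>B. \<forall>e\<^sub>1\<in>S. \<forall>e\<^sub>2\<in>S. \<forall>e\<^sub>3\<in>S. \<omega> (f \<odot> b) e\<^sub>1 e\<^sub>2 e\<^sub>3 = f * \<omega> b e\<^sub>1 e\<^sub>2 e\<^sub>3) \<and>
     (\<forall>b\<in>\<Gamma>B. \<forall>e\<^sub>1\<in>S. \<forall>e\<^sub>2\<in>S. \<forall>s\<in>S. \<forall>t\<in>S. \<omega> b e\<^sub>1 e\<^sub>2 (s + t) = \<omega> b e\<^sub>1 e\<^sub>2 s + \<omega> b e\<^sub>1 e\<^sub>2 t) \<and>
     (\<forall>f\<in>Cinf M. \<forall>b\<in>\<Gamma>B. \<forall>e\<^sub>1\<in>S. \<forall>e\<^sub>2\<in>S. \<forall>s\<in>S. \<omega> b e\<^sub>1 e\<^sub>2 (f \<odot> s) = f * \<omega> b e\<^sub>1 e\<^sub>2 s) \<and>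
     (\<forall>b\<in>\<Gamma>B. \<forall>e\<^sub>1\<in>S. \<forall>e\<^sub>2\<in>S. \<forall>s\<in>N. \<omega> b e\<^sub>1 e\<^sub>2 s = 0)"

text \<open>
  The cochain of \<open>A\<^sub>E\<close> induced by a form on \<open>E\<close>: evaluation on the chosen lifts of sections.
\<close>

definition descend2 :: "(('m \<Rightarrow> 'b) \<Rightarrow> ('m \<Rightarrow> 'e) \<Rightarrow> ('m \<Rightarrow> 'e) \<Rightarrow> 'm \<Rightarrow> real) \<Rightarrow> ('m, 'w, 'b) cochain" where
  "descend2 \<eta> = (\<lambda>as b. if as \<in> tuples (A_bun Q) 2 \<and> b \<in> \<Gamma>B
     then \<eta> b (liftA (as ! 0)) (liftA (as ! 1)) else 0)"

definition descend3 ::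
  "(('m \<Rightarrow> 'b) \<Rightarrow> ('m \<Rightarrow> 'e) \<Rightarrow> ('m \<Rightarrow> 'e) \<Rightarrow> ('m \<Rightarrow> 'e) \<Rightarrow> 'm \<Rightarrow> real) \<Rightarrow> ('m, 'w, 'b) cochain" where
  "descend3 \<omega> = (\<lambda>as b. if as \<in> tuples (A_bun Q) 3 \<and> b \<in> \<Gamma>B
     then \<omega> b (liftA (as ! 0)) (liftA (as ! 1)) (liftA (as ! 2)) else 0)"

lemma liftA_add_N: "a \<in> \<Gamma>A \<Longrightarrow> a' \<in> \<Gamma>A \<Longrightarrow> liftA (a + a') - (liftA a + liftA a') \<in> N"
  by (subst prA_eq_iff[symmetric]) (simp_all add: prA_liftA prA_add)

lemma liftA_fscale_N: "a \<in> \<Gamma>A \<Longrightarrow> f \<in> Cinf M \<Longrightarrow> liftA (f \<odot> a) - f \<odot> liftA a \<in> N"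
  by (subst prA_eq_iff[symmetric]) (simp_all add: prA_liftA prA_fscale)

lemma liftA_bracket_N: "a \<in> \<Gamma>A \<Longrightarrow> a' \<in> \<Gamma>A \<Longrightarrow> liftA (ample_bracket C Q a a') - liftA a \<star> liftA a' \<in> N"
  by (subst prA_eq_iff[symmetric]) (simp_all add: prA_liftA ample_bracket_def flip: liftA_def)

lemma ample_bracket_closed[simp, intro]: "a \<in> \<Gamma>A \<Longrightarrow> a' \<in> \<Gamma>A \<Longrightarrow> ample_bracket C Q a a' \<in> \<Gamma>A"
  unfolding ample_bracket_def liftA_def[symmetric] by (intro prA_closed brac_closed liftA_S)

lemma ample_anchor_eq: "ample_anchor C Q a = anc C (liftA a)"
  by (simp add: ample_anchor_def liftA_def)

text \<open>
  The chosen lifts are compatible with sums, multiples and brackets only up to sections of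
  \<open>(ker \<rho>)\<^sup>\<bottom>\<close>, which forms on \<open>A\<^sub>E\<close> do not see.
\<close>

lemma additive_N_cong:
  assumes "\<And>s t. s \<in> S \<Longrightarrow> t \<in> S \<Longrightarrow> h (s + t) = h s + (h t :: 'm \<Rightarrow> real)" "\<And>s. s \<in> N \<Longrightarrow> h s = 0"
    and "x \<in> S" "y \<in> S" "x - y \<in> N"
  shows "h x = h y"
proof -
  have "h (y + (x - y)) = h y + h (x - y)" using assms(3-5) by (intro assms(1)) auto
  then show ?thesis using assms(2)[OF assms(5)] by simp
qed

context
  fixes \<eta> assumes \<eta>: "skew_form2 \<eta>"
begin

lemma skew_form2_closed[simp, intro]: "b \<in> \<Gamma>B \<Longrightarrow> e \<in> S \<Longrightarrow> e' \<in> S \<Longrightarrow> \<eta> b e e' \<in> Cinf M"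
  and skew_form2_swap: "b \<in> \<Gamma>B \<Longrightarrow> e \<in> S \<Longrightarrow> e' \<in> S \<Longrightarrow> \<eta> b e e' = - \<eta> b e' e"
  using \<eta>[unfolded skew_form2_def, THEN conjunct1] by blast+

lemma skew_form2_add_b: "b \<in> \<Gamma>B \<Longrightarrow> b' \<in> \<Gamma>B \<Longrightarrow> e \<in> S \<Longrightarrow> e' \<in> S \<Longrightarrow> \<eta> (b + b') e e' = \<eta> b e e' + \<eta> b' e e'"
  and skew_form2_fscale_b: "f \<in> Cinf M \<Longrightarrow> b \<in> \<Gamma>B \<Longrightarrow> e \<in> S \<Longrightarrow> e' \<in> S \<Longrightarrow> \<eta> (f \<odot> b) e e' = f * \<eta> b e e'"
  and skew_form2_add: "b \<in> \<Gamma>B \<Longrightarrow> e \<in> S \<Longrightarrow> s \<in> S \<Longrightarrow> t \<in> S \<Longrightarrow> \<eta> b e (s + t) = \<eta> b e s + \<eta> b e t"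
  and skew_form2_fscale: "f \<in> Cinf M \<Longrightarrow> b \<in> \<Gamma>B \<Longrightarrow> e \<in> S \<Longrightarrow> s \<in> S \<Longrightarrow> \<eta> b e (f \<odot> s) = f * \<eta> b e s"
  and skew_form2_N: "b \<in> \<Gamma>B \<Longrightarrow> e \<in> S \<Longrightarrow> s \<in> N \<Longrightarrow> \<eta> b e s = 0"
  using \<eta>[unfolded skew_form2_def, THEN conjunct2] by simp_all

lemma skew_form2_cong_2:
  assumes "b \<in> \<Gamma>B" "e \<in> S" "x \<in> S" "y \<in> S" "x - y \<in> N" shows "\<eta> b e x = \<eta> b e y"
  by (rule additive_N_cong[where h = "\<eta> b e", OF _ _ assms(3-5)]) (use assms in \<open>simp_all add: skew_form2_add skew_form2_N\<close>)

lemma skew_form2_cong_1: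
  assumes "b \<in> \<Gamma>B" "e \<in> S" "x \<in> S" "y \<in> S" "x - y \<in> N" shows "\<eta> b x e = \<eta> b y e"
  using skew_form2_cong_2[OF assms] skew_form2_swap[of b x e] skew_form2_swap[of b y e] assms by simp

lemma skew_form2_lift_add:
  assumes "b \<in> \<Gamma>B" "e \<in> S" "a \<in> \<Gamma>A" "a' \<in> \<Gamma>A"
  shows "\<eta> b e (liftA (a + a')) = \<eta> b e (liftA a) + \<eta> b e (liftA a')"
    and "\<eta> b (liftA (a + a')) e = \<eta> b (liftA a) e + \<eta> b (liftA a') e"
proof -
  show *: "\<eta> b e (liftA (a + a')) = \<eta> b e (liftA a) + \<eta> b e (liftA a')"
    using skew_form2_cong_2[OF assms(1,2) _ _ liftA_add_N[OF assms(3,4)]] assms by (simp add: skew_form2_add)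
  show "\<eta> b (liftA (a + a')) e = \<eta> b (liftA a) e + \<eta> b (liftA a') e"
    using * assms by (simp add: skew_form2_swap[of b _ e])
qed

lemma skew_form2_lift_fscale:
  assumes "b \<in> \<Gamma>B" "e \<in> S" "a \<in> \<Gamma>A" "f \<in> Cinf M"
  shows "\<eta> b e (liftA (f \<odot> a)) = f * \<eta> b e (liftA a)"
    and "\<eta> b (liftA (f \<odot> a)) e = f * \<eta> b (liftA a) e"
proof -
  show *: "\<eta> b e (liftA (f \<odot> a)) = f * \<eta> b e (liftA a)"
    using skew_form2_cong_2[OF assms(1,2) _ _ liftA_fscale_N[OF assms(3,4)]] assms by (simp add: skew_form2_fscale)
  show "\<eta> b (liftA (f \<odot> a)) e = f * \<eta> b (liftA a) e"
    using * assms by (simp add: skew_form2_swap[of b _ e])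
qed

lemma skew_form2_alt:
  assumes "b \<in> \<Gamma>B" "e \<in> S" shows "\<eta> b e e = 0"
proof
  fix p show "\<eta> b e e p = 0 p" using fun_cong[OF skew_form2_swap[OF assms assms(2)], of p] by simp
qed

lemma descend2_cochain: "descend2 \<eta> \<in> ce_cochains M Q 2"
proof -
  have nth: "as ! 0 \<in> \<Gamma>A" "as ! Suc 0 \<in> \<Gamma>A" "length as = 2" if "as \<in> tuples (A_bun Q) 2" for as
    using that nth_mem[of 0 as] nth_mem[of 1 as] unfolding tuples_def by auto
  have upd: "as[i := s] \<in> tuples (A_bun Q) 2" if "as \<in> tuples (A_bun Q) 2" "s \<in> \<Gamma>A" for as i s
    using that set_update_subset_insert[of as i s] unfolding tuples_def by auto
  have i: "i = 0 \<or> i = 1" if "i < 2" for i :: nat using that by auto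
  show ?thesis
    unfolding ce_cochains_def
  proof (intro CollectI conjI ballI allI impI)
    fix as assume as: "as \<in> tuples (A_bun Q) 2"
    show "descend2 \<eta> as \<in> sec_dual M (B_bun Q)"
      unfolding sec_dual_def descend2_def using as nth[OF as]
      by (simp add: skew_form2_add_b skew_form2_fscale_b)
    fix i :: nat assume ik: "i < 2"
    fix s t assume st: "s \<in> \<Gamma>A" "t \<in> \<Gamma>A"
    have "descend2 \<eta> (as[i := s + t]) b = (descend2 \<eta> (as[i := s]) + descend2 \<eta> (as[i := t])) b" for b
      using i[OF ik] nth[OF as] upd[OF as] st
      by (auto simp: descend2_def skew_form2_lift_add)
    then show "descend2 \<eta> (as[i := s + t]) = descend2 \<eta> (as[i := s]) + descend2 \<eta> (as[i := t])" by blast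
  next
    fix as :: "('m \<Rightarrow> 'w) list" assume "as \<notin> tuples (A_bun Q) 2"
    then show "descend2 \<eta> as = 0" by (simp add: descend2_def fun_eq_iff)
  next
    fix as i f s b
    assume "as \<in> tuples (A_bun Q) 2" "i < (2::nat)" "f \<in> Cinf M" "s \<in> \<Gamma>A"
    then show "descend2 \<eta> (as[i := f \<odot> s]) b = f * descend2 \<eta> (as[i := s]) b"
      using i[of i] nth[of as] upd[of as] by (auto simp: descend2_def skew_form2_lift_fscale)
  next
    fix as i j
    assume as: "as \<in> tuples (A_bun Q) 2" "i < (2::nat)" "j < (2::nat)" "i \<noteq> j \<and> as ! i = as ! j"
    then have "as ! 0 = as ! Suc 0" using i[of i] i[of j] by auto
    then have "descend2 \<eta> as b = 0 b" for b using nth[OF as(1)] by (simp add: descend2_def skew_form2_alt)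
    then show "descend2 \<eta> as = 0" by blast
  qed
qed

end

context
  fixes \<omega> assumes \<omega>: "skew_form3 \<omega>"
begin

lemma skew_form3_closed[simp, intro]: "b \<in> \<Gamma>B \<Longrightarrow> e\<^sub>1 \<in> S \<Longrightarrow> e\<^sub>2 \<in> S \<Longrightarrow> e\<^sub>3 \<in> S \<Longrightarrow> \<omega> b e\<^sub>1 e\<^sub>2 e\<^sub>3 \<in> Cinf M"
  and skew_form3_swap_12: "b \<in> \<Gamma>B \<Longrightarrow> e\<^sub>1 \<in> S \<Longrightarrow> e\<^sub>2 \<in> S \<Longrightarrow> e\<^sub>3 \<in> S \<Longrightarrow> \<omega> b e\<^sub>1 e\<^sub>2 e\<^sub>3 = - \<omega> b e\<^sub>2 e\<^sub>1 e\<^sub>3"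
  and skew_form3_swap_23: "b \<in> \<Gamma>B \<Longrightarrow> e\<^sub>1 \<in> S \<Longrightarrow> e\<^sub>2 \<in> S \<Longrightarrow> e\<^sub>3 \<in> S \<Longrightarrow> \<omega> b e\<^sub>1 e\<^sub>2 e\<^sub>3 = - \<omega> b e\<^sub>1 e\<^sub>3 e\<^sub>2"
  using \<omega>[unfolded skew_form3_def, THEN conjunct1] by blast+

lemma skew_form3_add_b: "b \<in> \<Gamma>B \<Longrightarrow> b' \<in> \<Gamma>B \<Longrightarrow> e\<^sub>1 \<in> S \<Longrightarrow> e\<^sub>2 \<in> S \<Longrightarrow> e\<^sub>3 \<in> S \<Longrightarrow>
      \<omega> (b + b') e\<^sub>1 e\<^sub>2 e\<^sub>3 = \<omega> b e\<^sub>1 e\<^sub>2 e\<^sub>3 + \<omega> b' e\<^sub>1 e\<^sub>2 e\<^sub>3"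
  and skew_form3_fscale_b: "f \<in> Cinf M \<Longrightarrow> b \<in> \<Gamma>B \<Longrightarrow> e\<^sub>1 \<in> S \<Longrightarrow> e\<^sub>2 \<in> S \<Longrightarrow> e\<^sub>3 \<in> S \<Longrightarrow>
      \<omega> (f \<odot> b) e\<^sub>1 e\<^sub>2 e\<^sub>3 = f * \<omega> b e\<^sub>1 e\<^sub>2 e\<^sub>3"
  and skew_form3_add: "b \<in> \<Gamma>B \<Longrightarrow> e\<^sub>1 \<in> S \<Longrightarrow> e\<^sub>2 \<in> S \<Longrightarrow> s \<in> S \<Longrightarrow> t \<in> S \<Longrightarrow>
      \<omega> b e\<^sub>1 e\<^sub>2 (s + t) = \<omega> b e\<^sub>1 e\<^sub>2 s + \<omega> b e\<^sub>1 e\<^sub>2 t"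
  and skew_form3_fscale: "f \<in> Cinf M \<Longrightarrow> b \<in> \<Gamma>B \<Longrightarrow> e\<^sub>1 \<in> S \<Longrightarrow> e\<^sub>2 \<in> S \<Longrightarrow> s \<in> S \<Longrightarrow>
      \<omega> b e\<^sub>1 e\<^sub>2 (f \<odot> s) = f * \<omega> b e\<^sub>1 e\<^sub>2 s"
  and skew_form3_N: "b \<in> \<Gamma>B \<Longrightarrow> e\<^sub>1 \<in> S \<Longrightarrow> e\<^sub>2 \<in> S \<Longrightarrow> s \<in> N \<Longrightarrow> \<omega> b e\<^sub>1 e\<^sub>2 s = 0"
  using \<omega>[unfolded skew_form3_def, THEN conjunct2] by simp_all

lemma skew_form3_rotate: "b \<in> \<Gamma>B \<Longrightarrow> e\<^sub>1 \<in> S \<Longrightarrow> e\<^sub>2 \<in> S \<Longrightarrow> e\<^sub>3 \<in> S \<Longrightarrow> \<omega> b e\<^sub>1 e\<^sub>2 e\<^sub>3 = \<omega> b e\<^sub>2 e\<^sub>3 e\<^sub>1"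
  using skew_form3_swap_12[of b e\<^sub>1 e\<^sub>2 e\<^sub>3] skew_form3_swap_23[of b e\<^sub>2 e\<^sub>1 e\<^sub>3] by simp

lemma skew_form3_cong_3:
  assumes "b \<in> \<Gamma>B" "e \<in> S" "e' \<in> S" "x \<in> S" "y \<in> S" "x - y \<in> N" shows "\<omega> b e e' x = \<omega> b e e' y"
  by (rule additive_N_cong[where h = "\<omega> b e e'", OF _ _ assms(4-6)]) (use assms in \<open>simp_all add: skew_form3_add skew_form3_N\<close>)

lemma skew_form3_cong_1:
  assumes "b \<in> \<Gamma>B" "e \<in> S" "e' \<in> S" "x \<in> S" "y \<in> S" "x - y \<in> N" shows "\<omega> b x e e' = \<omega> b y e e'"
  using skew_form3_cong_3[OF assms] assms by (simp add: skew_form3_rotate[of b _ e e'])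

lemma skew_form3_lift_add:
  assumes "b \<in> \<Gamma>B" "e \<in> S" "e' \<in> S" "a \<in> \<Gamma>A" "a' \<in> \<Gamma>A"
  shows "\<omega> b e e' (liftA (a + a')) = \<omega> b e e' (liftA a) + \<omega> b e e' (liftA a')"
    and "\<omega> b e (liftA (a + a')) e' = \<omega> b e (liftA a) e' + \<omega> b e (liftA a') e'"
    and "\<omega> b (liftA (a + a')) e e' = \<omega> b (liftA a) e e' + \<omega> b (liftA a') e e'"
proof -
  show *: "\<omega> b e e' (liftA (a + a')) = \<omega> b e e' (liftA a) + \<omega> b e e' (liftA a')"
    using skew_form3_cong_3[OF assms(1-3) _ _ liftA_add_N[OF assms(4,5)]] assms by (simp add: skew_form3_add)
  show "\<omega> b e (liftA (a + a')) e' = \<omega> b e (liftA a) e' + \<omega> b e (liftA a') e'"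
    using * assms by (simp add: skew_form3_swap_23[of b e _ e'])
  show "\<omega> b (liftA (a + a')) e e' = \<omega> b (liftA a) e e' + \<omega> b (liftA a') e e'"
    using * assms by (simp add: skew_form3_rotate[of b _ e e'])
qed

lemma skew_form3_lift_fscale:
  assumes "b \<in> \<Gamma>B" "e \<in> S" "e' \<in> S" "a \<in> \<Gamma>A" "f \<in> Cinf M"
  shows "\<omega> b e e' (liftA (f \<odot> a)) = f * \<omega> b e e' (liftA a)"
    and "\<omega> b e (liftA (f \<odot> a)) e' = f * \<omega> b e (liftA a) e'"
    and "\<omega> b (liftA (f \<odot> a)) e e' = f * \<omega> b (liftA a) e e'"
proof -
  show *: "\<omega> b e e' (liftA (f \<odot> a)) = f * \<omega> b e e' (liftA a)"
    using skew_form3_cong_3[OF assms(1-3) _ _ liftA_fscale_N[OF assms(4,5)]] assms by (simp add: skew_form3_fscale)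
  show "\<omega> b e (liftA (f \<odot> a)) e' = f * \<omega> b e (liftA a) e'"
    using * assms by (simp add: skew_form3_swap_23[of b e _ e'])
  show "\<omega> b (liftA (f \<odot> a)) e e' = f * \<omega> b (liftA a) e e'"
    using * assms by (simp add: skew_form3_rotate[of b _ e e'])
qed

lemma skew_form3_alt:
  assumes "b \<in> \<Gamma>B" "e \<in> S" "e' \<in> S"
  shows "\<omega> b e e e' = 0" "\<omega> b e' e e = 0" "\<omega> b e e' e = 0"
proof -
  show *: "\<omega> b e e e' = 0"
  proof
    fix p show "\<omega> b e e e' p = 0 p"
      using fun_cong[OF skew_form3_swap_12[OF assms(1,2,2,3)], of p] by simp
  qed
  then show "\<omega> b e' e e = 0" "\<omega> b e e' e = 0"
    using skew_form3_rotate[of b e' e e] skew_form3_swap_23[of b e e' e] assms by simp_all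
qed

lemma descend3_cochain: "descend3 \<omega> \<in> ce_cochains M Q 3"
proof -
  have nth: "as ! 0 \<in> \<Gamma>A" "as ! Suc 0 \<in> \<Gamma>A" "as ! 2 \<in> \<Gamma>A" "length as = 3"
    if "as \<in> tuples (A_bun Q) 3" for as
    using that nth_mem[of 0 as] nth_mem[of 1 as] nth_mem[of 2 as] unfolding tuples_def by auto
  have upd: "as[i := s] \<in> tuples (A_bun Q) 3" if "as \<in> tuples (A_bun Q) 3" "s \<in> \<Gamma>A" for as i s
    using that set_update_subset_insert[of as i s] unfolding tuples_def by auto
  have i: "i = 0 \<or> i = 1 \<or> i = 2" if "i < 3" for i :: nat using that by auto
  show ?thesis
    unfolding ce_cochains_def
  proof (intro CollectI conjI ballI allI impI)
    fix as assume as: "as \<in> tuples (A_bun Q) 3"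
    show "descend3 \<omega> as \<in> sec_dual M (B_bun Q)"
      unfolding sec_dual_def descend3_def using as nth[OF as]
      by (simp add: skew_form3_add_b skew_form3_fscale_b)
    fix i :: nat assume ik: "i < 3"
    fix s t assume st: "s \<in> \<Gamma>A" "t \<in> \<Gamma>A"
    have "descend3 \<omega> (as[i := s + t]) b = (descend3 \<omega> (as[i := s]) + descend3 \<omega> (as[i := t])) b" for b
      using i[OF ik] nth[OF as] upd[OF as] st
      by (auto simp: descend3_def skew_form3_lift_add)
    then show "descend3 \<omega> (as[i := s + t]) = descend3 \<omega> (as[i := s]) + descend3 \<omega> (as[i := t])" by blast
  next
    fix as :: "('m \<Rightarrow> 'w) list" assume "as \<notin> tuples (A_bun Q) 3"
    then show "descend3 \<omega> as = 0" by (simp add: descend3_def fun_eq_iff)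
  next
    fix as i f s b
    assume "as \<in> tuples (A_bun Q) 3" "i < (3::nat)" "f \<in> Cinf M" "s \<in> \<Gamma>A"
    then show "descend3 \<omega> (as[i := f \<odot> s]) b = f * descend3 \<omega> (as[i := s]) b"
      using i[of i] nth[of as] upd[of as] by (auto simp: descend3_def skew_form3_lift_fscale)
  next
    fix as i j
    assume as: "as \<in> tuples (A_bun Q) 3" "i < (3::nat)" "j < (3::nat)" "i \<noteq> j \<and> as ! i = as ! j"
    then have "as ! 0 = as ! Suc 0 \<or> as ! 0 = as ! 2 \<or> as ! Suc 0 = as ! 2" using i[of i] i[of j] by auto
    then have "descend3 \<omega> as b = 0 b" for b using nth[OF as(1)] by (auto simp: descend3_def skew_form3_alt)
    then show "descend3 \<omega> as = 0" by blast
  qed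
qed

end

lemma tuples_Suc_iff: "a # as \<in> tuples (A_bun Q) (Suc k) \<longleftrightarrow> a \<in> \<Gamma>A \<and> as \<in> tuples (A_bun Q) k"
  by (auto simp: tuples_def)

lemma tuples_0_iff: "[] \<in> tuples (A_bun Q) 0"
  by (auto simp: tuples_def)

lemmas tuples_simps = tuples_Suc_iff tuples_0_iff numeral_2_eq_2 numeral_3_eq_3

end

context dissected
begin

lemma scaleR_apply: "(c *\<^sub>R f) x = c *\<^sub>R f x"
  by (simp add: scaleR_fun_def)

lemma dual_action_apply: "b \<in> \<Gamma>B \<Longrightarrow>
    dual_action M C Q a \<phi> b = der (ample_anchor C Q a) (\<phi> b) - \<phi> (bott M C Q a b)"
  by (simp add: dual_action_def)

text \<open>
  For skew forms the position of a bracket among the arguments only affects the sign, so the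
  Chevalley-Eilenberg differential, which puts it first, agrees with the Loday differential.
\<close>

lemma ce_diff_descend2:
  assumes \<eta>: "skew_form2 \<eta>" and a: "a\<^sub>1 \<in> \<Gamma>A" "a\<^sub>2 \<in> \<Gamma>A" "a\<^sub>3 \<in> \<Gamma>A" and b: "b \<in> \<Gamma>B"
  shows "ce_diff M C Q 2 (descend2 \<eta>) [a\<^sub>1, a\<^sub>2, a\<^sub>3] b = loday_d2 \<eta> b (liftA a\<^sub>1) (liftA a\<^sub>2) (liftA a\<^sub>3)"
proof -
  have p: "descend2 \<eta> [x, y] b' = \<eta> b' (liftA x) (liftA y)" if "x \<in> \<Gamma>A" "y \<in> \<Gamma>A" "b' \<in> \<Gamma>B" for x y b'
    using that by (simp add: descend2_def tuples_simps)
  have t: "[a\<^sub>1, a\<^sub>2, a\<^sub>3] \<in> tuples (A_bun Q) (Suc 2)"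
    using a by (simp add: tuples_simps)
  have br: "\<eta> b (liftA (ample_bracket C Q x y)) (liftA z) = \<eta> b (liftA x \<star> liftA y) (liftA z)"
    if "x \<in> \<Gamma>A" "y \<in> \<Gamma>A" "z \<in> \<Gamma>A" for x y z
    using skew_form2_cong_1[OF \<eta> b _ _ _ liftA_bracket_N] that by simp
  have sw: "\<eta> b (liftA x \<star> liftA y) (liftA z) = - \<eta> b (liftA z) (liftA x \<star> liftA y)"
    if "x \<in> \<Gamma>A" "y \<in> \<Gamma>A" "z \<in> \<Gamma>A" for x y z
    using that by (intro skew_form2_swap[OF \<eta> b]) auto
  show ?thesis
    using a b t sw[of a\<^sub>1 a\<^sub>3 a\<^sub>2] sw[of a\<^sub>2 a\<^sub>3 a\<^sub>1]
    by (simp add: ce_diff_def loday_d2_def dual_action_apply omit_def numeral_2_eq_2 lessThan_Suc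
        atMost_0 scaleR_apply ample_anchor_eq bott_eq p br)
qed

lemma ce_diff_descend3:
  assumes \<omega>: "skew_form3 \<omega>" and a: "a\<^sub>1 \<in> \<Gamma>A" "a\<^sub>2 \<in> \<Gamma>A" "a\<^sub>3 \<in> \<Gamma>A" "a\<^sub>4 \<in> \<Gamma>A" and b: "b \<in> \<Gamma>B"
  shows "ce_diff M C Q 3 (descend3 \<omega>) [a\<^sub>1, a\<^sub>2, a\<^sub>3, a\<^sub>4] b =
    loday_d3 \<omega> b (liftA a\<^sub>1) (liftA a\<^sub>2) (liftA a\<^sub>3) (liftA a\<^sub>4)"
proof -
  have p: "descend3 \<omega> [x, y, z] b' = \<omega> b' (liftA x) (liftA y) (liftA z)"
    if "x \<in> \<Gamma>A" "y \<in> \<Gamma>A" "z \<in> \<Gamma>A" "b' \<in> \<Gamma>B" for x y z b'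
    using that by (simp add: descend3_def tuples_simps)
  have t: "[a\<^sub>1, a\<^sub>2, a\<^sub>3, a\<^sub>4] \<in> tuples (A_bun Q) (Suc 3)"
    using a by (simp add: tuples_simps)
  have br: "\<omega> b (liftA (ample_bracket C Q x y)) (liftA z) (liftA v) = \<omega> b (liftA x \<star> liftA y) (liftA z) (liftA v)"
    if "x \<in> \<Gamma>A" "y \<in> \<Gamma>A" "z \<in> \<Gamma>A" "v \<in> \<Gamma>A" for x y z v
    using skew_form3_cong_1[OF \<omega> b _ _ _ _ liftA_bracket_N] that by simp
  have sw: "\<omega> b (liftA x \<star> liftA y) (liftA z) (liftA v) = - \<omega> b (liftA z) (liftA x \<star> liftA y) (liftA v)"
     "\<omega> b (liftA x \<star> liftA y) (liftA z) (liftA v) = \<omega> b (liftA z) (liftA v) (liftA x \<star> liftA y)"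
    if "x \<in> \<Gamma>A" "y \<in> \<Gamma>A" "z \<in> \<Gamma>A" "v \<in> \<Gamma>A" for x y z v
    using that by (auto intro!: skew_form3_swap_12[OF \<omega> b] skew_form3_rotate[OF \<omega> b])
  show ?thesis
    using a b t sw(1)[of a\<^sub>1 a\<^sub>3 a\<^sub>2 a\<^sub>4] sw(1)[of a\<^sub>2 a\<^sub>3 a\<^sub>1 a\<^sub>4] sw(2)[of a\<^sub>1 a\<^sub>4 a\<^sub>2 a\<^sub>3]
      sw(1)[of a\<^sub>2 a\<^sub>4 a\<^sub>1 a\<^sub>3] skew_form3_swap_23[OF \<omega> b, of "liftA a\<^sub>1" "liftA a\<^sub>2 \<star> liftA a\<^sub>4" "liftA a\<^sub>3"]
      sw(2)[of a\<^sub>3 a\<^sub>4 a\<^sub>1 a\<^sub>2]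
    by (simp add: ce_diff_def loday_d3_def dual_action_apply omit_def numeral_2_eq_2 numeral_3_eq_3 lessThan_Suc
        atMost_0 scaleR_apply ample_anchor_eq bott_eq p br)
qed

lemma ample_anchor_VF[simp, intro]: "a \<in> \<Gamma>A \<Longrightarrow> ample_anchor C Q a \<in> VF"
  by (simp add: ample_anchor_eq)

lemma ce_cochains_diff:
  assumes "\<eta> \<in> ce_cochains M Q k" "\<eta>' \<in> ce_cochains M Q k" shows "\<eta> - \<eta>' \<in> ce_cochains M Q k"
proof -
  have "\<phi> - \<psi> \<in> sec_dual M (B_bun Q)" if "\<phi> \<in> sec_dual M (B_bun Q)" "\<psi> \<in> sec_dual M (B_bun Q)" for \<phi> \<psi>
    using that unfolding sec_dual_def by (simp add: algebra_simps)
  then show ?thesis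
    using assms unfolding ce_cochains_def by (simp add: algebra_simps)
qed

lemma ce_diff_add:
  assumes \<eta>: "\<eta> \<in> ce_cochains M Q k" and \<eta>': "\<eta>' \<in> ce_cochains M Q k"
  shows "ce_diff M C Q k (\<eta> + \<eta>') = ce_diff M C Q k \<eta> + ce_diff M C Q k \<eta>'"
proof
  fix as :: "('m \<Rightarrow> 'w) list"
  show "ce_diff M C Q k (\<eta> + \<eta>') as = (ce_diff M C Q k \<eta> + ce_diff M C Q k \<eta>') as"
  proof (cases "as \<in> tuples (A_bun Q) (Suc k)")
    case True
    have da: "dual_action M C Q (as ! i) (\<eta> (omit i as) + \<eta>' (omit i as)) =
        dual_action M C Q (as ! i) (\<eta> (omit i as)) + dual_action M C Q (as ! i) (\<eta>' (omit i as))"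
      if "i \<le> k" for i
    proof -
      have "omit i as \<in> tuples (A_bun Q) k"
        using True that set_take_subset[of i as] set_drop_subset[of "Suc i" as]
        by (auto simp: tuples_def omit_def)
      then have "\<eta> (omit i as) \<in> sec_dual M (B_bun Q)" "\<eta>' (omit i as) \<in> sec_dual M (B_bun Q)"
        using \<eta> \<eta>' by (auto simp: ce_cochains_def)
      moreover have "as ! i \<in> \<Gamma>A" using True that nth_mem[of i as] by (auto simp: tuples_def)
      ultimately show ?thesis
        by (auto simp: dual_action_def sec_dual_def fun_eq_iff[of "dual_action _ _ _ _ _"] der_add)
    qed
    then show ?thesis using True
      by (simp add: ce_diff_def sum.distrib scaleR_add_right algebra_simps)
  qed (simp add: ce_diff_def)
qed

text \<open>
  \<open>ce_class\<close> is a coset, so adding a coboundary amounts to a shift of the index \<open>\<eta>\<close> in its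
  description.
\<close>

lemma ce_class_eqI:
  assumes \<eta>\<^sub>0: "\<eta>\<^sub>0 \<in> ce_cochains M Q 2" and eq: "\<omega>' = \<omega> + ce_diff M C Q 2 \<eta>\<^sub>0"
  shows "ce_class M C Q 3 \<omega> = ce_class M C Q 3 \<omega>'"
proof -
  have add: "\<eta> + \<eta>\<^sub>0 \<in> ce_cochains M Q 2" if "\<eta> \<in> ce_cochains M Q 2" for \<eta>
    using ce_cochains_diff[OF that ce_cochains_diff[OF ce_cochains_diff[OF \<eta>\<^sub>0 \<eta>\<^sub>0] \<eta>\<^sub>0]] by simp
  have "\<exists>\<eta>'. \<omega>' + ce_diff M C Q 2 \<eta> = \<omega> + ce_diff M C Q 2 \<eta>' \<and> \<eta>' \<in> ce_cochains M Q 2"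
    if "\<eta> \<in> ce_cochains M Q 2" for \<eta>
    by (rule exI[of _ "\<eta> + \<eta>\<^sub>0"]) (use add[OF that] that \<eta>\<^sub>0 eq in \<open>simp add: ce_diff_add add_ac\<close>)
  moreover have "\<exists>\<eta>'. \<omega> + ce_diff M C Q 2 \<eta> = \<omega>' + ce_diff M C Q 2 \<eta>' \<and> \<eta>' \<in> ce_cochains M Q 2"
    if "\<eta> \<in> ce_cochains M Q 2" for \<eta>
  proof (intro exI conjI)
    show d: "\<eta> - \<eta>\<^sub>0 \<in> ce_cochains M Q 2" by (rule ce_cochains_diff[OF that \<eta>\<^sub>0])
    show "\<omega> + ce_diff M C Q 2 \<eta> = \<omega>' + ce_diff M C Q 2 (\<eta> - \<eta>\<^sub>0)"
      using ce_diff_add[OF d \<eta>\<^sub>0] by (simp add: eq add_ac)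
  qed
  ultimately show ?thesis unfolding ce_class_def by auto
qed

end

section \<open>The connection as a Loday 2-cochain\<close>

lemma connection_diff_0:
  assumes "connection M V \<alpha> W nab" "0 \<in> sections V" "0 \<in> sections W"
  shows "w \<in> sections W \<Longrightarrow> nab 0 w = 0" "v \<in> sections V \<Longrightarrow> nab v 0 = 0"
proof -
  show "nab 0 w = 0" if "w \<in> sections W"
  proof -
    have "nab (0 + 0) w = nab 0 w + nab 0 w"
      using assms that unfolding connection_def by blast
    then show ?thesis by simp
  qed
  show "nab v 0 = 0" if "v \<in> sections V"
  proof -
    have "nab v (0 + 0) = nab v 0 + nab v 0"
      using assms that unfolding connection_def by blast
    then show ?thesis by simp
  qed
qed

locale dissected_triple = dissected M C Q \<Psi>
  for M :: "('m::{t2_space, second_countable_topology}, 'a::real_normed_vector) atlas"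
    and C :: "('m, 'e::real_vector) courant"
    and Q :: "('m, 'e, 'w::real_vector, 'g::real_vector, 'b::real_vector) quots"
    and \<Psi> :: "('m, 'e, 'g) diss" +
  fixes \<tau> :: "('m, 'g, 'b) triple"
  assumes triple: "is_triple M C Q \<tau>"
begin

abbreviation j :: "('m \<Rightarrow> 'b) \<Rightarrow> 'm \<Rightarrow> 'm tvec" where "j b \<equiv> on_sec (split_B \<tau>) b"
abbreviation prF :: "('m \<Rightarrow> 'm tvec) \<Rightarrow> 'm \<Rightarrow> 'm tvec" where "prF X \<equiv> part_F Q \<tau> X"

lemmas triple_laws = triple[unfolded is_triple_def]

lemma split_map: "bundle_map (B_bun Q) (tangent_bundle M) (split_B \<tau>)"
  using triple_laws[THEN conjunct1] .

lemma split_section: "\<forall>p. \<forall>u\<in>fiber (B_bun Q) p. B_pr Q p (split_B \<tau> p u) = u"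
  using triple_laws[THEN conjunct2, THEN conjunct1] .

lemma connection_F: "connection M (char_dist M C) (\<lambda>p x. x) (char_dist M C) (nabla_F \<tau>)"
  using triple_laws[THEN conjunct2, THEN conjunct2, THEN conjunct1] .

lemma connection_B: "connection M (B_bun Q) (split_B \<tau>) (G_bun Q) (nabla_B \<tau>)"
  using triple_laws[THEN conjunct2, THEN conjunct2, THEN conjunct2, THEN conjunct2, THEN conjunct1] .

lemma nabla_B_metric: "b \<in> \<Gamma>B \<Longrightarrow> r \<in> \<Gamma>G \<Longrightarrow> s \<in> \<Gamma>G \<Longrightarrow>
    der (j b) (gG r s) = gG (nabla_B \<tau> b r) s + gG r (nabla_B \<tau> b s)"
  using triple_laws[THEN conjunct2, THEN conjunct2, THEN conjunct2, THEN conjunct2, THEN conjunct2] by blast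

lemma \<Gamma>B_fiber: "b \<in> \<Gamma>B \<Longrightarrow> b p \<in> fiber (B_bun Q) p"
  by (rule section_in_fiber[OF manifold vector_bundle_B])

lemma j_VF[simp, intro]: "b \<in> \<Gamma>B \<Longrightarrow> j b \<in> VF"
  by (rule bundle_map_section[OF split_map])

lemma prB_j[simp]: "b \<in> \<Gamma>B \<Longrightarrow> prB (j b) = b"
  using split_section by (simp add: on_sec_def \<Gamma>B_fiber)

lemma j_add: "b \<in> \<Gamma>B \<Longrightarrow> b' \<in> \<Gamma>B \<Longrightarrow> j (b + b') = j b + j b'"
  by (simp add: on_sec_def fun_eq_iff bundle_map_add[OF split_map \<Gamma>B_fiber \<Gamma>B_fiber])

lemma j_fscale: "b \<in> \<Gamma>B \<Longrightarrow> j (f \<odot> b) = f \<odot> j b"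
  by (simp add: on_sec_def fun_eq_iff fscale_def bundle_map_scaleR[OF split_map \<Gamma>B_fiber])

lemma j_diff: "b \<in> \<Gamma>B \<Longrightarrow> b' \<in> \<Gamma>B \<Longrightarrow> j (b - b') = j b - j b'"
  using j_add[of "b - b'" b'] by simp

lemma j_0[simp]: "j 0 = 0"
  using j_diff[of 0 0] by simp

lemma j_minus: "b \<in> \<Gamma>B \<Longrightarrow> j (- b) = - j b"
  using j_diff[of 0 b] by simp

lemma prF_eq: "prF X = X - j (prB X)"
  by (simp add: part_F_def part_B_def)

lemma prF_closed[simp, intro]: "X \<in> VF \<Longrightarrow> prF X \<in> \<Gamma>F"
  unfolding prF_eq by (intro \<Gamma>F_I) (simp_all add: prB_diff)

lemma prF_add: "X \<in> VF \<Longrightarrow> Y \<in> VF \<Longrightarrow> prF (X + Y) = prF X + prF Y"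
  by (simp add: prF_eq prB_add j_add)

lemma prF_diff: "X \<in> VF \<Longrightarrow> Y \<in> VF \<Longrightarrow> prF (X - Y) = prF X - prF Y"
  by (simp add: prF_eq prB_diff j_diff)

lemma prF_fscale: "X \<in> VF \<Longrightarrow> prF (f \<odot> X) = f \<odot> prF X"
  by (simp add: prF_eq prB_fscale j_fscale fscale_diff_right)

lemma prF_\<Gamma>F[simp]: "x \<in> \<Gamma>F \<Longrightarrow> prF x = x"
  by (simp add: prF_eq \<Gamma>F_prB)

lemma prF_j[simp]: "b \<in> \<Gamma>B \<Longrightarrow> prF (j b) = 0"
  by (simp add: prF_eq)

lemma nabla_B_closed[simp, intro]: "b \<in> \<Gamma>B \<Longrightarrow> r \<in> \<Gamma>G \<Longrightarrow> nabla_B \<tau> b r \<in> \<Gamma>G"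
  using connection_B[unfolded connection_def, THEN conjunct1] by blast

lemma nabla_B_add_b: "b \<in> \<Gamma>B \<Longrightarrow> b' \<in> \<Gamma>B \<Longrightarrow> r \<in> \<Gamma>G \<Longrightarrow> nabla_B \<tau> (b + b') r = nabla_B \<tau> b r + nabla_B \<tau> b' r"
  using connection_B[unfolded connection_def, THEN conjunct2, THEN conjunct1] by blast

lemma nabla_B_add: "b \<in> \<Gamma>B \<Longrightarrow> r \<in> \<Gamma>G \<Longrightarrow> s \<in> \<Gamma>G \<Longrightarrow> nabla_B \<tau> b (r + s) = nabla_B \<tau> b r + nabla_B \<tau> b s"
  using connection_B[unfolded connection_def, THEN conjunct2, THEN conjunct2, THEN conjunct1] by blast

lemma nabla_B_fscale_b: "f \<in> Cinf M \<Longrightarrow> b \<in> \<Gamma>B \<Longrightarrow> r \<in> \<Gamma>G \<Longrightarrow> nabla_B \<tau> (f \<odot> b) r = f \<odot> nabla_B \<tau> b r"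
  and nabla_B_fscale: "f \<in> Cinf M \<Longrightarrow> b \<in> \<Gamma>B \<Longrightarrow> r \<in> \<Gamma>G \<Longrightarrow>
    nabla_B \<tau> b (f \<odot> r) = der (j b) f \<odot> r + f \<odot> nabla_B \<tau> b r"
  using connection_B[unfolded connection_def, THEN conjunct2, THEN conjunct2, THEN conjunct2] by blast+

lemma nabla_B_0[simp]: "r \<in> \<Gamma>G \<Longrightarrow> nabla_B \<tau> 0 r = 0" "b \<in> \<Gamma>B \<Longrightarrow> nabla_B \<tau> b 0 = 0"
  using connection_diff_0[OF connection_B] by auto

lemma nabla_F_closed[simp, intro]: "x \<in> \<Gamma>F \<Longrightarrow> y \<in> \<Gamma>F \<Longrightarrow> nabla_F \<tau> x y \<in> \<Gamma>F"
  using connection_F[unfolded connection_def, THEN conjunct1] by blast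

lemma nabla_F_add_left: "x \<in> \<Gamma>F \<Longrightarrow> x' \<in> \<Gamma>F \<Longrightarrow> y \<in> \<Gamma>F \<Longrightarrow> nabla_F \<tau> (x + x') y = nabla_F \<tau> x y + nabla_F \<tau> x' y"
  using connection_F[unfolded connection_def, THEN conjunct2, THEN conjunct1] by blast

lemma nabla_F_0[simp]: "y \<in> \<Gamma>F \<Longrightarrow> nabla_F \<tau> 0 y = 0"
  using connection_diff_0(1)[OF connection_F] by auto

text \<open>
  The covariant derivative along \<open>j b\<close> of the part of \<open>e\<close> in the complement \<open>\<Psi>(\<G> \<oplus> F)\<close>.
\<close>

definition del :: "('m \<Rightarrow> 'b) \<Rightarrow> ('m \<Rightarrow> 'e) \<Rightarrow> 'm \<Rightarrow> 'e" where
  "del b e = Lsec (nabla_B \<tau> b (cG e)) (prF (lie_bracket (j b) (anc C e)))"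

text \<open>
  The function \<open>g(\<nabla>\<^sub>b e, e')\<close>. The part \<open>s = e - Lpart e\<close> lies in \<open>\<Psi>(F\<^sup>*)\<close>, where \<open>\<nabla>\<close> is defined by
  duality; its contribution is written as \<open>j(b) g(s, e') - g(s, \<nabla>\<^sub>b e')\<close>. In this form \<open>D\<close> is smooth
  without knowing that the dual connection takes smooth sections to smooth sections.
\<close>

definition D :: "('m \<Rightarrow> 'b) \<Rightarrow> ('m \<Rightarrow> 'e) \<Rightarrow> ('m \<Rightarrow> 'e) \<Rightarrow> 'm \<Rightarrow> real" where
  "D b e e' = pair (del b e) e' + der (j b) (pair (e - Lpart e) e') - pair (e - Lpart e) (del b e')"

lemma del_S[simp, intro]: "b \<in> \<Gamma>B \<Longrightarrow> e \<in> S \<Longrightarrow> del b e \<in> S"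
  unfolding del_def by (intro Lsec_closed nabla_B_closed cG_closed prF_closed VF_lie j_VF anc_VF)

text \<open>
  The failure of \<open>\<nabla>\<^sub>b\<close> to be compatible with the anchor. The projection to \<open>F\<close> in \<open>\<nabla>\<^sub>b x = pr\<^sub>F [j(b), x]\<close>
  subtracts \<open>j(pr\<^sub>B [j(b), x]) = - j(x \<cdot> b)\<close>.
\<close>

lemma anc_del:
  assumes "b \<in> \<Gamma>B" "e \<in> S"
  shows "anc C (del b e) = lie_bracket (j b) (anc C e) + j (bott_E e b)"
proof -
  have "prB (lie_bracket (j b) (anc C e)) = - bott_E e b"
    using assms prB_lie[of e "j b"] by (simp add: lie_swap[of "anc C e" "j b"] prB_minus)
  then have "prF (lie_bracket (j b) (anc C e)) = lie_bracket (j b) (anc C e) + j (bott_E e b)"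
    using assms by (simp add: prF_eq j_minus)
  moreover have "anc C (del b e) = prF (lie_bracket (j b) (anc C e))"
    unfolding del_def using assms by (intro anc_Lsec) auto
  ultimately show ?thesis by simp
qed

lemma del_add_b: "b \<in> \<Gamma>B \<Longrightarrow> b' \<in> \<Gamma>B \<Longrightarrow> e \<in> S \<Longrightarrow> del (b + b') e = del b e + del b' e"
  by (simp add: del_def nabla_B_add_b j_add lie_add_left prF_add Lsec_add)

lemma del_fscale_b: "f \<in> Cinf M \<Longrightarrow> b \<in> \<Gamma>B \<Longrightarrow> e \<in> S \<Longrightarrow> del (f \<odot> b) e = f \<odot> del b e"
  by (simp add: del_def nabla_B_fscale_b j_fscale lie_fscale_left prF_diff prF_fscale fscale_zero_right Lsec_fscale)

lemma del_add: "b \<in> \<Gamma>B \<Longrightarrow> e \<in> S \<Longrightarrow> e' \<in> S \<Longrightarrow> del b (e + e') = del b e + del b e'"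
  by (simp add: del_def cG_add anc_add nabla_B_add lie_add_right prF_add Lsec_add)

lemma del_fscale: "f \<in> Cinf M \<Longrightarrow> b \<in> \<Gamma>B \<Longrightarrow> e \<in> S \<Longrightarrow>
    del b (f \<odot> e) = der (j b) f \<odot> Lpart e + f \<odot> del b e"
  by (simp add: del_def cG_fscale anc_fscale nabla_B_fscale lie_fscale_right prF_add prF_fscale
      Lsec_add Lsec_fscale Lpart_def)

lemma del_N[simp]: "b \<in> \<Gamma>B \<Longrightarrow> s \<in> N \<Longrightarrow> del b s = 0"
  by (simp add: del_def N_cG)

lemma pair_split:
  assumes "e \<in> S" "e' \<in> S"
  shows "pair (e - Lpart e) e' = pair e e' - pair (Lpart e) e'"
    and "pair (e - Lpart e) e' = pair (e - Lpart e) (Lpart e')"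
proof -
  show "pair (e - Lpart e) e' = pair e e' - pair (Lpart e) e'"
    using assms by (simp add: pair_diff_left)
  have "pair (e - Lpart e) (e' - Lpart e') = 0"
    using assms by (intro pair_N_N) auto
  then show "pair (e - Lpart e) e' = pair (e - Lpart e) (Lpart e')"
    using assms by (simp add: pair_diff_right)
qed

lemma D_closed[simp, intro]: "b \<in> \<Gamma>B \<Longrightarrow> e \<in> S \<Longrightarrow> e' \<in> S \<Longrightarrow> D b e e' \<in> Cinf M"
  unfolding D_def by (intro Cinf_closed der_closed pair_closed del_S S_closed j_VF Lpart_S)

lemma D_add_b: "b \<in> \<Gamma>B \<Longrightarrow> b' \<in> \<Gamma>B \<Longrightarrow> e \<in> S \<Longrightarrow> e' \<in> S \<Longrightarrow> D (b + b') e e' = D b e e' + D b' e e'"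
  by (simp add: D_def del_add_b j_add der_plus pair_add_left pair_add_right)

lemma D_fscale_b: "f \<in> Cinf M \<Longrightarrow> b \<in> \<Gamma>B \<Longrightarrow> e \<in> S \<Longrightarrow> e' \<in> S \<Longrightarrow> D (f \<odot> b) e e' = f * D b e e'"
  by (simp add: D_def del_fscale_b j_fscale der_fscale pair_fscale_left pair_fscale_right algebra_simps)

lemma D_diff_b: "b \<in> \<Gamma>B \<Longrightarrow> b' \<in> \<Gamma>B \<Longrightarrow> e \<in> S \<Longrightarrow> e' \<in> S \<Longrightarrow> D (b - b') e e' = D b e e' - D b' e e'"
  using D_add_b[of "b - b'" b' e e'] by simp

lemma D_add_left:
  assumes "b \<in> \<Gamma>B" "e \<in> S" "e' \<in> S" "z \<in> S" shows "D b (e + e') z = D b e z + D b e' z"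
proof -
  have "e + e' - Lpart (e + e') = (e - Lpart e) + (e' - Lpart e')"
    using assms by (simp add: Lpart_add)
  then have "pair (e + e' - Lpart (e + e')) x = pair (e - Lpart e) x + pair (e' - Lpart e') x"
    if "x \<in> S" for x
    using assms that by (simp only: pair_add_left S_closed Lpart_S)
  then show ?thesis
    using assms by (simp add: D_def del_add pair_add_left der_add)
qed

lemma D_add_right: "b \<in> \<Gamma>B \<Longrightarrow> e \<in> S \<Longrightarrow> e' \<in> S \<Longrightarrow> z \<in> S \<Longrightarrow> D b z (e + e') = D b z e + D b z e'"
  by (simp add: D_def del_add pair_add_right der_add)

lemma D_fscale_right:
  assumes "f \<in> Cinf M" "b \<in> \<Gamma>B" "e \<in> S" "e' \<in> S" shows "D b e (f \<odot> e') = f * D b e e'"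
proof -
  have "pair (e - Lpart e) (del b (f \<odot> e')) =
      der (j b) f * pair (e - Lpart e) e' + f * pair (e - Lpart e) (del b e')"
    using assms pair_split(2)[of e e'] by (simp add: del_fscale pair_add_right pair_fscale_right)
  then show ?thesis
    using assms by (simp add: D_def pair_fscale_right der_mult algebra_simps)
qed

text \<open>
  The terms of \<open>D\<close> that involve \<open>(ker \<rho>)\<^sup>\<bottom>\<close> are designed to be metric; what remains is the metric
  property of \<open>\<nabla>\<^sup>B\<close> on \<open>\<G>\<close>, since \<open>F\<close> is isotropic in the complement.
\<close>

lemma D_metric:
  assumes "b \<in> \<Gamma>B" "e \<in> S" "e' \<in> S"
  shows "D b e e' + D b e' e = der (j b) (pair e e')"
proof -
  have L: "pair (Lpart u) (Lpart v) = gG (cG u) (cG v)" "pair (del b u) (Lpart v) = gG (nabla_B \<tau> b (cG u)) (cG v)"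
    if "u \<in> S" "v \<in> S" for u v
    using that assms by (simp_all add: Lpart_def del_def pair_Lsec)
  have gGc: "gG (cG e) (cG e') \<in> Cinf M" unfolding L(1)[OF assms(2,3), symmetric] using assms by blast
  have 1: "pair (del b e) e' - pair (e' - Lpart e') (del b e) = gG (nabla_B \<tau> b (cG e)) (cG e')"
    if "e \<in> S" "e' \<in> S" for e e'
    using that assms L(2)[OF that] by (simp add: pair_sym[of _ "del b e"] pair_diff_right)
  have 2: "pair (e - Lpart e) e' + pair (e' - Lpart e') e = pair e e' - gG (cG e) (cG e')"
    using assms L(1)[of e e'] pair_split(2)[of e' e]
    by (simp add: pair_diff_left pair_sym[of e' "Lpart e"] pair_sym[of e' e] pair_sym[of "Lpart e'" "Lpart e"])
  have "gG (nabla_B \<tau> b (cG e)) (cG e') + gG (nabla_B \<tau> b (cG e')) (cG e) = der (j b) (gG (cG e) (cG e'))"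
  proof -
    have "gG (nabla_B \<tau> b (cG e')) (cG e) = gG (cG e) (nabla_B \<tau> b (cG e'))"
      using assms pair_sym[of "Lsec (nabla_B \<tau> b (cG e')) 0" "Lsec (cG e) 0"] by (simp add: pair_Lsec)
    then show ?thesis using assms by (simp add: nabla_B_metric)
  qed
  moreover have "der (j b) (pair (e - Lpart e) e') + der (j b) (pair (e' - Lpart e') e) =
      der (j b) (pair e e') - der (j b) (gG (cG e) (cG e'))"
    using assms gGc by (simp add: 2 flip: der_add der_diff)
  ultimately show ?thesis
    using 1[of e e'] 1[of e' e] assms unfolding D_def by (simp add: algebra_simps)
qed

lemma D_N:
  assumes "b \<in> \<Gamma>B" "e \<in> S" "s \<in> N" shows "D b e s = pair (del b e) s"
proof -
  have "pair (e - Lpart e) s = 0" using assms by (intro pair_N_N) auto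
  then show ?thesis using assms by (simp add: D_def)
qed

lemma loday_cochain2_D: "loday_cochain2 D"
  unfolding loday_cochain2_def by (simp add: D_diff_b D_add_left D_add_right)


section \<open>The coboundary of the connection descends\<close>

lemma loday_d2_closed[simp, intro]:
  "b \<in> \<Gamma>B \<Longrightarrow> e\<^sub>1 \<in> S \<Longrightarrow> e\<^sub>2 \<in> S \<Longrightarrow> e\<^sub>3 \<in> S \<Longrightarrow> loday_d2 D b e\<^sub>1 e\<^sub>2 e\<^sub>3 \<in> Cinf M"
  unfolding loday_d2_def by (intro Cinf_closed der_closed D_closed bott_E_closed brac_closed anc_VF)

text \<open>
  Here \<open>s = \<rho>\<^sup>* d f\<close>. With \<open>f = g(e\<^sub>1, e\<^sub>2)\<close> it is the symmetric part of the bracket, and the values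
  computed here cancel the symmetric part of \<open>D\<close> in the two skew-symmetry lemmas that follow.
\<close>

lemma D_sym_brac:
  assumes "b \<in> \<Gamma>B" "e \<in> S" "s \<in> N" and s: "\<And>z. z \<in> S \<Longrightarrow> pair s z = act z f" and f: "f \<in> Cinf M"
  shows "D b e s = der (j b) (act e f) - act e (der (j b) f) + der (j (bott_E e b)) f"
    and "D b s e = act e (der (j b) f) - der (j (bott_E e b)) f"
proof -
  have "D b e s = act (del b e) f"
    using assms(1-3) s[of "del b e"] by (simp add: D_N pair_sym[of "del b e" s])
  then show 1: "D b e s = der (j b) (act e f) - act e (der (j b) f) + der (j (bott_E e b)) f"
    using assms(1,2) by (simp add: anc_del der_plus der_lie_bracket)
  have "D b s e + D b e s = der (j b) (act e f)"
    using assms(1-3) s[of e] by (simp add: D_metric)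
  then show "D b s e = act e (der (j b) f) - der (j (bott_E e b)) f"
    unfolding 1 by (simp add: algebra_simps)
qed

lemma loday_d2_D_swap_12:
  assumes b: "b \<in> \<Gamma>B" and e: "e\<^sub>1 \<in> S" "e\<^sub>2 \<in> S" "e\<^sub>3 \<in> S"
  shows "loday_d2 D b e\<^sub>1 e\<^sub>2 e\<^sub>3 = - loday_d2 D b e\<^sub>2 e\<^sub>1 e\<^sub>3"
proof -
  define s where "s = e\<^sub>1 \<star> e\<^sub>2 + e\<^sub>2 \<star> e\<^sub>1"
  have s: "s \<in> N" "\<And>z. z \<in> S \<Longrightarrow> pair s z = act z (pair e\<^sub>1 e\<^sub>2)"
    using e sym_brac_N by (simp_all add: s_def pair_add_left pair_sym_brac)
  have 1: "D b (e\<^sub>1 \<star> e\<^sub>2) e\<^sub>3 + D b (e\<^sub>2 \<star> e\<^sub>1) e\<^sub>3 =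
      act e\<^sub>3 (der (j b) (pair e\<^sub>1 e\<^sub>2)) - der (j (bott_E e\<^sub>3 b)) (pair e\<^sub>1 e\<^sub>2)"
    using D_sym_brac(2)[OF b e(3) s] b e by (simp add: s_def D_add_left)
  have 2: "act e\<^sub>3 (D b e\<^sub>1 e\<^sub>2) + act e\<^sub>3 (D b e\<^sub>2 e\<^sub>1) = act e\<^sub>3 (der (j b) (pair e\<^sub>1 e\<^sub>2))"
    "D (bott_E e\<^sub>3 b) e\<^sub>1 e\<^sub>2 + D (bott_E e\<^sub>3 b) e\<^sub>2 e\<^sub>1 = der (j (bott_E e\<^sub>3 b)) (pair e\<^sub>1 e\<^sub>2)"
    using b e by (simp_all add: D_metric flip: der_add)
  have "loday_d2 D b e\<^sub>1 e\<^sub>2 e\<^sub>3 + loday_d2 D b e\<^sub>2 e\<^sub>1 e\<^sub>3 =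
      (act e\<^sub>3 (D b e\<^sub>1 e\<^sub>2) + act e\<^sub>3 (D b e\<^sub>2 e\<^sub>1)) - (D (bott_E e\<^sub>3 b) e\<^sub>1 e\<^sub>2 + D (bott_E e\<^sub>3 b) e\<^sub>2 e\<^sub>1)
      - (D b (e\<^sub>1 \<star> e\<^sub>2) e\<^sub>3 + D b (e\<^sub>2 \<star> e\<^sub>1) e\<^sub>3)"
    unfolding loday_d2_def by simp
  also have "\<dots> = 0" unfolding 1 2 by simp
  finally show ?thesis by (simp add: eq_neg_iff_add_eq_0)
qed

lemma loday_d2_D_swap_23:
  assumes b: "b \<in> \<Gamma>B" and e: "e\<^sub>1 \<in> S" "e\<^sub>2 \<in> S" "e\<^sub>3 \<in> S"
  shows "loday_d2 D b e\<^sub>1 e\<^sub>2 e\<^sub>3 = - loday_d2 D b e\<^sub>1 e\<^sub>3 e\<^sub>2"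
proof -
  define s where "s = e\<^sub>2 \<star> e\<^sub>3 + e\<^sub>3 \<star> e\<^sub>2"
  have s: "s \<in> N" "\<And>z. z \<in> S \<Longrightarrow> pair s z = act z (pair e\<^sub>2 e\<^sub>3)"
    using e sym_brac_N by (simp_all add: s_def pair_add_left pair_sym_brac)
  have 1: "D b e\<^sub>1 (e\<^sub>2 \<star> e\<^sub>3) + D b e\<^sub>1 (e\<^sub>3 \<star> e\<^sub>2) =
      der (j b) (act e\<^sub>1 (pair e\<^sub>2 e\<^sub>3)) - act e\<^sub>1 (der (j b) (pair e\<^sub>2 e\<^sub>3)) + der (j (bott_E e\<^sub>1 b)) (pair e\<^sub>2 e\<^sub>3)"
    using D_sym_brac(1)[OF b e(1) s] b e by (simp add: s_def D_add_right)
  have 2: "act e\<^sub>1 (D b e\<^sub>2 e\<^sub>3) + act e\<^sub>1 (D b e\<^sub>3 e\<^sub>2) = act e\<^sub>1 (der (j b) (pair e\<^sub>2 e\<^sub>3))"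
    "D (bott_E e\<^sub>1 b) e\<^sub>2 e\<^sub>3 + D (bott_E e\<^sub>1 b) e\<^sub>3 e\<^sub>2 = der (j (bott_E e\<^sub>1 b)) (pair e\<^sub>2 e\<^sub>3)"
    using b e by (simp_all add: D_metric flip: der_add)
  have 3: "D b (e\<^sub>1 \<star> e\<^sub>2) e\<^sub>3 + D b e\<^sub>3 (e\<^sub>1 \<star> e\<^sub>2) + (D b e\<^sub>2 (e\<^sub>1 \<star> e\<^sub>3) + D b (e\<^sub>1 \<star> e\<^sub>3) e\<^sub>2) =
      der (j b) (act e\<^sub>1 (pair e\<^sub>2 e\<^sub>3))"
  proof -
    have "pair e\<^sub>2 (e\<^sub>1 \<star> e\<^sub>3) \<in> Cinf M" "pair (e\<^sub>1 \<star> e\<^sub>2) e\<^sub>3 \<in> Cinf M" using e by blast+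
    then show ?thesis using b e by (simp add: D_metric act_pair der_add)
  qed
  have "loday_d2 D b e\<^sub>1 e\<^sub>2 e\<^sub>3 + loday_d2 D b e\<^sub>1 e\<^sub>3 e\<^sub>2 =
      (act e\<^sub>1 (D b e\<^sub>2 e\<^sub>3) + act e\<^sub>1 (D b e\<^sub>3 e\<^sub>2)) - (D (bott_E e\<^sub>1 b) e\<^sub>2 e\<^sub>3 + D (bott_E e\<^sub>1 b) e\<^sub>3 e\<^sub>2)
      - (D b (e\<^sub>1 \<star> e\<^sub>2) e\<^sub>3 + D b e\<^sub>3 (e\<^sub>1 \<star> e\<^sub>2) + (D b e\<^sub>2 (e\<^sub>1 \<star> e\<^sub>3) + D b (e\<^sub>1 \<star> e\<^sub>3) e\<^sub>2))
      + (D b e\<^sub>1 (e\<^sub>2 \<star> e\<^sub>3) + D b e\<^sub>1 (e\<^sub>3 \<star> e\<^sub>2))"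
    unfolding loday_d2_def by simp
  also have "\<dots> = 0" unfolding 1 2 3 by simp
  finally show ?thesis by (simp add: eq_neg_iff_add_eq_0)
qed

text \<open>
  Because \<open>D\<^sub>b(e, s) = g(\<nabla>\<^sub>b e, s)\<close> for \<open>s\<close> in \<open>(ker \<rho>)\<^sup>\<bottom>\<close>, all terms combine to the pairing of \<open>s\<close> with
  one section \<open>z\<close>. Its anchor vanishes by \<open>anc_del\<close>, the Jacobi identity and flatness of the Bott
  connection.
\<close>

lemma loday_d2_D_N:
  assumes b: "b \<in> \<Gamma>B" and e: "e\<^sub>1 \<in> S" "e\<^sub>2 \<in> S" and s: "s \<in> N"
  shows "loday_d2 D b e\<^sub>1 e\<^sub>2 s = 0"
proof -
  define z where "z = e\<^sub>1 \<star> del b e\<^sub>2 - e\<^sub>2 \<star> del b e\<^sub>1 - del (bott_E e\<^sub>1 b) e\<^sub>2 + del (bott_E e\<^sub>2 b) e\<^sub>1 - del b (e\<^sub>1 \<star> e\<^sub>2)"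
  have z: "z \<in> S" using b e by (simp add: z_def)
  have D0: "D 0 e\<^sub>1 e\<^sub>2 = 0" using D_diff_b[OF b b e] by simp
  have "loday_d2 D b e\<^sub>1 e\<^sub>2 s = pair z s"
    using b e s D0 by (simp add: loday_d2_def z_def D_N act_pair der_zero pair_add_left pair_diff_left)
  also have "\<dots> = 0"
  proof (rule pair_N_ker(2)[OF s z])
    have "anc C z = lie_bracket (anc C e\<^sub>1) (lie_bracket (j b) (anc C e\<^sub>2) + j (bott_E e\<^sub>2 b))
        - lie_bracket (anc C e\<^sub>2) (lie_bracket (j b) (anc C e\<^sub>1) + j (bott_E e\<^sub>1 b))
        - (lie_bracket (j (bott_E e\<^sub>1 b)) (anc C e\<^sub>2) + j (bott_E e\<^sub>2 (bott_E e\<^sub>1 b)))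
        + (lie_bracket (j (bott_E e\<^sub>2 b)) (anc C e\<^sub>1) + j (bott_E e\<^sub>1 (bott_E e\<^sub>2 b)))
        - (lie_bracket (j b) (lie_bracket (anc C e\<^sub>1) (anc C e\<^sub>2)) + j (bott_E e\<^sub>1 (bott_E e\<^sub>2 b) - bott_E e\<^sub>2 (bott_E e\<^sub>1 b)))"
      using b e by (simp add: z_def anc_diff anc_add anc_brac anc_del bott_E_brac)
    also have "\<dots> = 0"
    proof (rule VF_eqI)
      fix f assume "f \<in> Cinf M"
      then show "der (lie_bracket (anc C e\<^sub>1) (lie_bracket (j b) (anc C e\<^sub>2) + j (bott_E e\<^sub>2 b))
        - lie_bracket (anc C e\<^sub>2) (lie_bracket (j b) (anc C e\<^sub>1) + j (bott_E e\<^sub>1 b))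
        - (lie_bracket (j (bott_E e\<^sub>1 b)) (anc C e\<^sub>2) + j (bott_E e\<^sub>2 (bott_E e\<^sub>1 b)))
        + (lie_bracket (j (bott_E e\<^sub>2 b)) (anc C e\<^sub>1) + j (bott_E e\<^sub>1 (bott_E e\<^sub>2 b)))
        - (lie_bracket (j b) (lie_bracket (anc C e\<^sub>1) (anc C e\<^sub>2)) + j (bott_E e\<^sub>1 (bott_E e\<^sub>2 b) - bott_E e\<^sub>2 (bott_E e\<^sub>1 b)))) f
        = der 0 f"
        using b e by (simp add: der_simps j_diff)
    qed (use b e in auto)
    finally show "anc C z = 0" .
  qed
  finally show ?thesis .
qed

lemma skew_form3_loday_d2_D: "skew_form3 (loday_d2 D)"
  unfolding skew_form3_def
proof (intro conjI ballI)
  fix b b' e\<^sub>1 e\<^sub>2 e\<^sub>3 assume a: "b \<in> \<Gamma>B" "b' \<in> \<Gamma>B" "e\<^sub>1 \<in> S" "e\<^sub>2 \<in> S" "e\<^sub>3 \<in> S"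
  then show "loday_d2 D (b + b') e\<^sub>1 e\<^sub>2 e\<^sub>3 = loday_d2 D b e\<^sub>1 e\<^sub>2 e\<^sub>3 + loday_d2 D b' e\<^sub>1 e\<^sub>2 e\<^sub>3"
    by (simp add: loday_d2_def bott_E_add_right D_add_b der_add)
next
  fix f b e\<^sub>1 e\<^sub>2 e\<^sub>3 assume a: "f \<in> Cinf M" "b \<in> \<Gamma>B" "e\<^sub>1 \<in> S" "e\<^sub>2 \<in> S" "e\<^sub>3 \<in> S"
  then show "loday_d2 D (f \<odot> b) e\<^sub>1 e\<^sub>2 e\<^sub>3 = f * loday_d2 D b e\<^sub>1 e\<^sub>2 e\<^sub>3"
    by (simp add: loday_d2_def bott_E_fscale_right D_fscale_b D_add_b der_mult algebra_simps)
next
  fix b e\<^sub>1 e\<^sub>2 s t assume a: "b \<in> \<Gamma>B" "e\<^sub>1 \<in> S" "e\<^sub>2 \<in> S" "s \<in> S" "t \<in> S"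
  then show "loday_d2 D b e\<^sub>1 e\<^sub>2 (s + t) = loday_d2 D b e\<^sub>1 e\<^sub>2 s + loday_d2 D b e\<^sub>1 e\<^sub>2 t"
    by (simp add: loday_d2_def bott_E_add_left D_add_right D_add_b der_add anc_add der_plus brac_add_right)
next
  fix f b e\<^sub>1 e\<^sub>2 s assume a: "f \<in> Cinf M" "b \<in> \<Gamma>B" "e\<^sub>1 \<in> S" "e\<^sub>2 \<in> S" "s \<in> S"
  then show "loday_d2 D b e\<^sub>1 e\<^sub>2 (f \<odot> s) = f * loday_d2 D b e\<^sub>1 e\<^sub>2 s"
    by (simp add: loday_d2_def bott_E_fscale_left D_fscale_right D_fscale_b D_add_right der_mult anc_fscale
        der_fscale brac_fscale algebra_simps)
qed ((rule loday_d2_closed loday_d2_D_swap_12 loday_d2_D_swap_23 loday_d2_D_N; assumption)+)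

end

section \<open>Torsion, curvature and \<open>d\<^sub>T\<close>\<close>

text \<open>
  The arithmetic behind \<open>torsion_L\<close>, at a point: \<open>cijk\<close> stands for \<open>g(e\<^sub>i \<circ> e\<^sub>j, e\<^sub>k)\<close>, \<open>nijk\<close> for
  \<open>g(\<nabla>\<^sub>i e\<^sub>j, e\<^sub>k)\<close>, and \<open>ri\<close> for \<open>\<rho>(e\<^sub>i)\<close> applied to the pairing of the two other sections. The nine
  hypotheses are the axiom for \<open>e \<circ> e\<close>, invariance of the metric, and the metric property of \<open>\<nabla>\<close>.
\<close>

lemma cyclic_torsion_identity:
  fixes c123 c213 c231 c321 c312 c132 n123 n132 n213 n231 n312 n321 r1 r2 r3 :: real
  assumes "c123 + c213 = r3" "c231 + c321 = r1" "c312 + c132 = r2"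
    "r1 = c123 + c132" "r2 = c231 + c213" "r3 = c312 + c321"
    "r1 = n123 + n132" "r2 = n231 + n213" "r3 = n312 + n321"
  shows "1 / 2 * (1 / 3 * (c123 - c213) - (n123 - n213) + (1 / 3 * (c231 - c321) - (n231 - n321))
      + (1 / 3 * (c312 - c132) - (n312 - n132))) = c123 - n123 + n213 - n312"
proof -
  have c: "c213 = r3 - c123" "c132 = r1 - c123" "c312 = r2 - r1 + c123" "c231 = r2 - r3 + c123" "c321 = r1 - r2 + r3 - c123"
    using assms by linarith+
  have n: "n132 = r1 - n123" "n231 = r2 - n213" "n321 = r3 - n312" using assms by linarith+
  show ?thesis unfolding c n by (simp add: field_simps)
qed

context dissected_triple
begin

abbreviation nG :: "('m \<Rightarrow> 'm tvec) \<Rightarrow> ('m \<Rightarrow> 'g) \<Rightarrow> 'm \<Rightarrow> 'g" where "nG X r \<equiv> conn_G M C Q \<Psi> \<tau> X r"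
abbreviation nF :: "('m \<Rightarrow> 'm tvec) \<Rightarrow> ('m \<Rightarrow> 'm tvec) \<Rightarrow> 'm \<Rightarrow> 'm tvec" where "nF X y \<equiv> conn_F Q \<tau> X y"
abbreviation nab :: "('m \<Rightarrow> 'm tvec) \<Rightarrow> ('m \<Rightarrow> 'e) \<Rightarrow> 'm \<Rightarrow> 'e" where "nab X e \<equiv> conn M C Q \<Psi> \<tau> X e"

lemma nabla_G_eq: "nabla_G M C Q \<Psi> x r = cG (Lsec 0 x \<star> Lsec r 0)"
  by (simp add: nabla_G_def emb_F_def emb_G_def Lsec_def)

text \<open>
  Expressing the metric of \<open>\<G>\<close> through the one of \<open>E\<close> makes the metric property of \<open>\<nabla>\<^sup>\<G>\<close> an instance
  of the invariance of \<open>g\<close>.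
\<close>

lemma gG_cG:
  assumes "e \<in> S" "r \<in> \<Gamma>G" shows "gG (cG e) r = pair e (Lsec r 0)"
proof -
  have "pair (e - Lpart e) (Lsec r 0) = 0"
    using assms by (intro pair_N_ker(1)) auto
  then have "pair e (Lsec r 0) = pair (Lpart e) (Lsec r 0)" using assms by (simp add: pair_diff_left)
  then show ?thesis using assms by (simp add: Lpart_def pair_Lsec)
qed

lemma gG_eq: "r \<in> \<Gamma>G \<Longrightarrow> s \<in> \<Gamma>G \<Longrightarrow> gG r s = pair (Lsec r 0) (Lsec s 0)"
  by (simp add: pair_Lsec)

lemma gG_sym: "r \<in> \<Gamma>G \<Longrightarrow> s \<in> \<Gamma>G \<Longrightarrow> gG r s = gG s r"
  using pair_sym[of "Lsec r 0" "Lsec s 0"] by (simp add: pair_Lsec)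

lemma nabla_G_closed[simp, intro]: "x \<in> \<Gamma>F \<Longrightarrow> r \<in> \<Gamma>G \<Longrightarrow> nabla_G M C Q \<Psi> x r \<in> \<Gamma>G"
  unfolding nabla_G_eq by (intro cG_closed brac_closed Lsec_closed) auto

lemma nabla_G_metric:
  assumes "x \<in> \<Gamma>F" "r \<in> \<Gamma>G" "s \<in> \<Gamma>G"
  shows "der x (gG r s) = gG (nabla_G M C Q \<Psi> x r) s + gG r (nabla_G M C Q \<Psi> x s)"
proof -
  have L: "Lsec 0 x \<in> S" "Lsec r 0 \<in> S" "Lsec s 0 \<in> S" using assms by auto
  have "der x (gG r s) = act (Lsec 0 x) (pair (Lsec r 0) (Lsec s 0))"
    using assms by (simp add: gG_eq)
  also have "\<dots> = pair (Lsec 0 x \<star> Lsec r 0) (Lsec s 0) + pair (Lsec 0 x \<star> Lsec s 0) (Lsec r 0)"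
    using L by (simp add: act_pair pair_sym[of "Lsec r 0" "Lsec 0 x \<star> Lsec s 0"])
  also have "\<dots> = gG (nabla_G M C Q \<Psi> x r) s + gG (nabla_G M C Q \<Psi> x s) r"
    using L assms by (simp add: nabla_G_eq gG_cG)
  finally show ?thesis using assms by (simp add: gG_sym[of r])
qed

lemma nabla_G_add_left: "x \<in> \<Gamma>F \<Longrightarrow> y \<in> \<Gamma>F \<Longrightarrow> r \<in> \<Gamma>G \<Longrightarrow>
    nabla_G M C Q \<Psi> (x + y) r = nabla_G M C Q \<Psi> x r + nabla_G M C Q \<Psi> y r"
  using Lsec_add[of 0 x 0 y] by (simp add: nabla_G_eq brac_add_left cG_add)

lemma nabla_G_0[simp]: "r \<in> \<Gamma>G \<Longrightarrow> nabla_G M C Q \<Psi> 0 r = 0"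
  using nabla_G_add_left[of 0 0 r] by simp

lemma nG_eq: "nG X r = nabla_G M C Q \<Psi> (prF X) r + nabla_B \<tau> (prB X) r"
  by (simp add: conn_G_def part_B_def)

lemma nF_eq: "nF X y = nabla_F \<tau> (prF X) y + prF (lie_bracket (j (prB X)) y)"
  by (simp add: conn_F_def part_B_def)

lemma nG_closed[simp, intro]: "X \<in> VF \<Longrightarrow> r \<in> \<Gamma>G \<Longrightarrow> nG X r \<in> \<Gamma>G"
  by (simp add: nG_eq)

lemma nF_closed[simp, intro]: "X \<in> VF \<Longrightarrow> y \<in> \<Gamma>F \<Longrightarrow> nF X y \<in> \<Gamma>F"
  by (simp add: nF_eq)

lemma nG_add: "X \<in> VF \<Longrightarrow> Y \<in> VF \<Longrightarrow> r \<in> \<Gamma>G \<Longrightarrow> nG (X + Y) r = nG X r + nG Y r"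
  by (simp add: nG_eq prF_add prB_add nabla_G_add_left nabla_B_add_b)

lemma nF_add: "X \<in> VF \<Longrightarrow> Y \<in> VF \<Longrightarrow> y \<in> \<Gamma>F \<Longrightarrow> nF (X + Y) y = nF X y + nF Y y"
  by (simp add: nF_eq prF_add prB_add nabla_F_add_left j_add lie_add_left)

lemma nG_metric:
  assumes "X \<in> VF" "r \<in> \<Gamma>G" "s \<in> \<Gamma>G"
  shows "der X (gG r s) = gG (nG X r) s + gG r (nG X s)"
proof -
  have gadd: "gG (u + v) w = gG u w + gG v w" "gG w (u + v) = gG w u + gG w v"
    if "u \<in> \<Gamma>G" "v \<in> \<Gamma>G" "w \<in> \<Gamma>G" for u v w
  proof -
    have "Lsec (u + v) 0 = Lsec u 0 + Lsec v 0" using Lsec_add[of u 0 v 0] that by simp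
    then show "gG (u + v) w = gG u w + gG v w" "gG w (u + v) = gG w u + gG w v"
      using that by (simp_all add: gG_eq pair_add_left pair_add_right)
  qed
  have "X = prF X + j (prB X)" by (simp add: prF_eq)
  then have "der X (gG r s) = der (prF X) (gG r s) + der (j (prB X)) (gG r s)"
    by (metis der_plus)
  then show ?thesis
    using assms by (simp add: nabla_G_metric nabla_B_metric nG_eq gadd)
qed

text \<open>
  Torsion and curvature are only evaluated on sections of the complement \<open>\<Psi>(\<G> \<oplus> F)\<close>, on which the
  component in \<open>F\<^sup>*\<close> is zero. So the dual connection matters only at the zero section, where the
  unique section that it describes exists and is zero.
\<close>

lemma conn_Fdual_0:
  assumes "X \<in> VF"
  shows "conn_Fdual M C Q \<tau> X (\<lambda>p. 0) = (\<lambda>p. 0)"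
  unfolding conn_Fdual_def
proof (rule the_equality)
  have "(\<lambda>p. 0) \<in> sections (dual_bundle M (char_dist M C))"
    unfolding dual_bundle_def Let_def on_sec_def using Cinf_const[of 0 M] by simp
  moreover have "der X (\<lambda>p. 0) = (\<lambda>p. 0)"
    using der_of_0[OF assms] by (simp add: zero_fun_def)
  ultimately show "(\<lambda>p. 0) \<in> sections (dual_bundle M (char_dist M C)) \<and>
    (\<forall>y\<in>\<Gamma>F. on_sec (\<lambda>p. 0) y = der X (on_sec (\<lambda>p. 0) y) - on_sec (\<lambda>p. 0) (nF X y))"
    by (simp add: on_sec_def fun_eq_iff)
next
  fix \<eta> assume \<eta>: "\<eta> \<in> sections (dual_bundle M (char_dist M C)) \<and>
    (\<forall>y\<in>\<Gamma>F. on_sec \<eta> y = der X (on_sec (\<lambda>p. 0) y) - on_sec (\<lambda>p. 0) (nF X y))"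
  have Fd: "\<eta> p \<in> Fd p" for p
    using \<eta>[THEN conjunct1] unfolding dual_bundle_def Let_def by simp
  have z: "on_sec \<eta> y = 0" if "y \<in> \<Gamma>F" for y
  proof -
    have "on_sec \<eta> y = der X (\<lambda>p. 0) - (\<lambda>p. 0)"
      using \<eta> that by (simp add: on_sec_def)
    then show ?thesis using der_of_0[OF assms] by (simp add: zero_fun_def fun_eq_iff)
  qed
  show "\<eta> = (\<lambda>p. 0)"
  proof (rule ext, rule ext)
    fix p u
    show "\<eta> p u = 0 u"
    proof (cases "u \<in> Ff p")
      case True
      then obtain v where v: "v \<in> Ef p" "u = anchor C p v" unfolding char_dist_fiber by blast
      obtain e where e: "e \<in> S" "e p = v" using section_through[OF manifold vector_bundle_E v(1)] by blast
      show ?thesis using fun_cong[OF z[OF anc_\<Gamma>F[OF e(1)]], of p] e(2) v(2) by (simp add: on_sec_def)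
    next
      case False
      then show ?thesis using Fd[of p] unfolding Fd_iff by simp
    qed
  qed
qed

lemma nab_Lsec:
  assumes "X \<in> VF" "r \<in> \<Gamma>G" "y \<in> \<Gamma>F"
  shows "nab X (Lsec r y) = Lsec (nG X r) (nF X y)"
proof -
  have inv: "diss_inv M C Q \<Psi> p (Lsec r y p) = (0, r p, y p)" for p
    using assms by (simp add: Lsec_def Psi_inv \<Gamma>G_fiber \<Gamma>F_fiber)
  have "comp_Fdual M C Q \<Psi> (Lsec r y) = (\<lambda>p. 0)" "comp_G M C Q \<Psi> (Lsec r y) = r"
    "comp_F M C Q \<Psi> (Lsec r y) = y"
    by (simp_all add: comp_Fdual_def comp_G_def comp_F_def inv)
  then show ?thesis
    using conn_Fdual_0[OF assms(1)] by (simp add: conn_def Lsec_def[of "nG X r"])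
qed

text \<open>The sections of the complement \<open>\<Psi>(\<G> \<oplus> F)\<close>.\<close>

definition Ls :: "('m \<Rightarrow> 'e) set" where
  "Ls = {e \<in> S. Lpart e = e}"

lemma Ls_I: "e \<in> S \<Longrightarrow> Lpart e = e \<Longrightarrow> e \<in> Ls"
  by (simp add: Ls_def)

lemma Ls_S[simp, dest]: "e \<in> Ls \<Longrightarrow> e \<in> S"
  by (simp add: Ls_def)

lemma Ls_Lpart: "e \<in> Ls \<Longrightarrow> Lpart e = e"
  unfolding Ls_def by blast

lemma Lsec_Ls[simp, intro]: "r \<in> \<Gamma>G \<Longrightarrow> x \<in> \<Gamma>F \<Longrightarrow> Lsec r x \<in> Ls"
  by (rule Ls_I) (simp_all add: Lpart_def)

lemma Lpart_Ls[simp, intro]: "e \<in> S \<Longrightarrow> Lpart e \<in> Ls"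
  unfolding Lpart_def by (intro Lsec_Ls cG_closed anc_\<Gamma>F)

lemma nab_L: "X \<in> VF \<Longrightarrow> e \<in> Ls \<Longrightarrow> nab X e = Lsec (nG X (cG e)) (nF X (anc C e))"
  using nab_Lsec[of X "cG e" "anc C e"] by (simp add: Ls_Lpart flip: Lpart_def)

lemma nab_Ls[simp, intro]: "X \<in> VF \<Longrightarrow> e \<in> Ls \<Longrightarrow> nab X e \<in> Ls"
  unfolding nab_L by (intro Lsec_Ls nG_closed nF_closed cG_closed anc_\<Gamma>F Ls_S)

lemma nab_add: "X \<in> VF \<Longrightarrow> Y \<in> VF \<Longrightarrow> e \<in> Ls \<Longrightarrow> nab (X + Y) e = nab X e + nab Y e"
  by (simp add: nab_L nG_add nF_add Lsec_add)

lemma pair_L: "e \<in> Ls \<Longrightarrow> e' \<in> Ls \<Longrightarrow> pair e e' = gG (cG e) (cG e')"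
  using pair_Lsec[of "cG e" "anc C e" "cG e'" "anc C e'"] by (simp add: Ls_Lpart flip: Lpart_def)

lemma nab_metric: "X \<in> VF \<Longrightarrow> e \<in> Ls \<Longrightarrow> e' \<in> Ls \<Longrightarrow>
    der X (pair e e') = pair (nab X e) e' + pair e (nab X e')"
  using nG_metric[of X "cG e" "cG e'"] by (simp add: pair_L nab_Ls) (simp add: nab_L)

lemma nab_j: "b \<in> \<Gamma>B \<Longrightarrow> e \<in> Ls \<Longrightarrow> nab (j b) e = del b e"
  by (simp add: nab_L del_def nG_eq nF_eq)

lemma D_L: "b \<in> \<Gamma>B \<Longrightarrow> e \<in> Ls \<Longrightarrow> z \<in> S \<Longrightarrow> D b e z = pair (nab (j b) e) z"
  by (simp add: D_def nab_j Ls_Lpart)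

abbreviation tor :: "('m \<Rightarrow> 'e) \<Rightarrow> ('m \<Rightarrow> 'e) \<Rightarrow> ('m \<Rightarrow> 'e) \<Rightarrow> 'm \<Rightarrow> real" where
  "tor \<equiv> torsion C (conn M C Q \<Psi> \<tau>)"

text \<open>
  The cyclic sum of the definition of the torsion, reduced to the shape in which every derivative
  can be matched with a term of the Loday differential.
\<close>

lemma torsion_L:
  assumes L: "e\<^sub>1 \<in> Ls" "e\<^sub>2 \<in> Ls" "e\<^sub>3 \<in> Ls"
  shows "tor e\<^sub>1 e\<^sub>2 e\<^sub>3 = pair (e\<^sub>1 \<star> e\<^sub>2) e\<^sub>3 - pair (nab (anc C e\<^sub>1) e\<^sub>2) e\<^sub>3
     + pair (nab (anc C e\<^sub>2) e\<^sub>1) e\<^sub>3 - pair (nab (anc C e\<^sub>3) e\<^sub>1) e\<^sub>2"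
proof
  fix p
  have T: "pair ((1/3) *\<^sub>R (u \<star> v - v \<star> u) - (nab (anc C u) v - nab (anc C v) u)) w p =
     (1/3) * (pair (u \<star> v) w p - pair (v \<star> u) w p) - (pair (nab (anc C u) v) w p - pair (nab (anc C v) u) w p)"
    if "u \<in> Ls" "v \<in> Ls" "w \<in> Ls" for u v w
    using that by (simp add: pair_diff_left pair_scaleR_left scaleR_apply)
  have sym: "pair (u \<star> v) w p + pair (v \<star> u) w p = act w (pair u v) p" if "u \<in> S" "v \<in> S" "w \<in> S" for u v w
    using fun_cong[OF pair_sym_brac[OF that], of p] by simp
  have inv: "act u (pair v w) p = pair (u \<star> v) w p + pair (u \<star> w) v p" if "u \<in> S" "v \<in> S" "w \<in> S" for u v w
    using fun_cong[OF act_pair[OF that], of p] that by (simp add: pair_sym[of v "u \<star> w"])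
  have met: "act u (pair v w) p = pair (nab (anc C u) v) w p + pair (nab (anc C u) w) v p"
    if "u \<in> Ls" "v \<in> Ls" "w \<in> Ls" for u v w
    using fun_cong[OF nab_metric[of "anc C u" v w], of p] that by (simp add: pair_sym[of v "nab (anc C u) w"])
  have ps: "pair e\<^sub>1 e\<^sub>2 = pair e\<^sub>2 e\<^sub>1" "pair e\<^sub>1 e\<^sub>3 = pair e\<^sub>3 e\<^sub>1" "pair e\<^sub>2 e\<^sub>3 = pair e\<^sub>3 e\<^sub>2"
    using L by (simp_all add: pair_sym[of _ e\<^sub>1] pair_sym[of e\<^sub>2 e\<^sub>3])
  note L' = L[THEN Ls_S]
  note facts = sym[OF L'] sym[OF L'(2,3,1)] sym[OF L'(3,1,2)] inv[OF L'] inv[OF L'(2,3,1)] inv[OF L'(3,1,2)]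
    met[OF L] met[OF L(2,3,1)] met[OF L(3,1,2)]
  have eq: "tor e\<^sub>1 e\<^sub>2 e\<^sub>3 p = (1/2) * (
      (1/3) * (pair (e\<^sub>1 \<star> e\<^sub>2) e\<^sub>3 p - pair (e\<^sub>2 \<star> e\<^sub>1) e\<^sub>3 p) - (pair (nab (anc C e\<^sub>1) e\<^sub>2) e\<^sub>3 p - pair (nab (anc C e\<^sub>2) e\<^sub>1) e\<^sub>3 p)
      + ((1/3) * (pair (e\<^sub>2 \<star> e\<^sub>3) e\<^sub>1 p - pair (e\<^sub>3 \<star> e\<^sub>2) e\<^sub>1 p) - (pair (nab (anc C e\<^sub>2) e\<^sub>3) e\<^sub>1 p - pair (nab (anc C e\<^sub>3) e\<^sub>2) e\<^sub>1 p))
      + ((1/3) * (pair (e\<^sub>3 \<star> e\<^sub>1) e\<^sub>2 p - pair (e\<^sub>1 \<star> e\<^sub>3) e\<^sub>2 p) - (pair (nab (anc C e\<^sub>3) e\<^sub>1) e\<^sub>2 p - pair (nab (anc C e\<^sub>1) e\<^sub>3) e\<^sub>2 p)))"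
    unfolding torsion_def Let_def scaleR_fun_def[of "1/2"] plus_fun_def using L by (simp only: T) simp
  show "tor e\<^sub>1 e\<^sub>2 e\<^sub>3 p = (pair (e\<^sub>1 \<star> e\<^sub>2) e\<^sub>3 - pair (nab (anc C e\<^sub>1) e\<^sub>2) e\<^sub>3
     + pair (nab (anc C e\<^sub>2) e\<^sub>1) e\<^sub>3 - pair (nab (anc C e\<^sub>3) e\<^sub>1) e\<^sub>2) p"
    unfolding eq fun_diff_def plus_fun_def by (rule cyclic_torsion_identity[OF facts[unfolded ps]])
qed

abbreviation curv :: "('m \<Rightarrow> 'm tvec) \<Rightarrow> ('m \<Rightarrow> 'm tvec) \<Rightarrow> ('m \<Rightarrow> 'e) \<Rightarrow> 'm \<Rightarrow> 'e" where
  "curv \<equiv> curvature (conn M C Q \<Psi> \<tau>)"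

lemma pair_curv:
  assumes "X \<in> VF" "Y \<in> VF" "e \<in> Ls" "e' \<in> Ls"
  shows "pair (curv X Y e) e' = pair (nab X (nab Y e)) e' - pair (nab Y (nab X e)) e' - pair (nab (lie_bracket X Y) e) e'"
  using assms by (simp add: curvature_def pair_diff_left)

text \<open>
  The curvature of a metric connection is skew. The cyclic sum in \<open>curv_form\<close> and the signs in the
  derivative of the torsion are related in this way.
\<close>

lemma pair_curv_skew:
  assumes "X \<in> VF" "Y \<in> VF" "e \<in> Ls" "e' \<in> Ls"
  shows "pair (curv X Y e) e' = - pair (curv X Y e') e"
proof -
  have c: "pair (nab Z u) v \<in> Cinf M" "pair u (nab Z v) \<in> Cinf M" if "Z \<in> VF" "u \<in> Ls" "v \<in> Ls" for Z u v
    using that by auto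
  have s: "pair (nab Z (nab Z' e')) e = pair e (nab Z (nab Z' e'))" "pair (nab Z e') e = pair e (nab Z e')"
    if "Z \<in> VF" "Z' \<in> VF" for Z Z'
    using that assms by (auto intro!: pair_sym)
  have "der (lie_bracket X Y) (pair e e') = der X (der Y (pair e e')) - der Y (der X (pair e e'))"
    by (rule der_lie_bracket)
  then show ?thesis
    using assms c by (simp add: pair_curv s nab_metric der_add algebra_simps)
qed

text \<open>
  Each of the three connection terms of the torsion contributes a curvature term, by commuting
  \<open>\<nabla>\<^sub>b\<close> past \<open>\<nabla>\<close> along an anchor \<open>\<rho>(e)\<close>. The vector field \<open>[\<rho>(e), j(b)]\<close> of the curvature and
  \<open>\<rho>(\<nabla>\<^sub>b e)\<close> add up to \<open>j(e \<cdot> b)\<close>, which produces the Bott terms of the Loday differential.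
\<close>

lemma cov_deriv3_torsion:
  assumes b: "b \<in> \<Gamma>B" and L: "e\<^sub>1 \<in> Ls" "e\<^sub>2 \<in> Ls" "e\<^sub>3 \<in> Ls"
  shows "cov_deriv3 (conn M C Q \<Psi> \<tau>) (j b) tor e\<^sub>1 e\<^sub>2 e\<^sub>3 =
     pair (curv (anc C e\<^sub>1) (j b) e\<^sub>2) e\<^sub>3 - pair (curv (anc C e\<^sub>2) (j b) e\<^sub>1) e\<^sub>3 + pair (curv (anc C e\<^sub>3) (j b) e\<^sub>1) e\<^sub>2
     - loday_d2 D b e\<^sub>1 e\<^sub>2 e\<^sub>3"
proof -
  define d where "d e = nab (j b) e" for e
  have d: "d e \<in> Ls" if "e \<in> Ls" for e using that b by (simp add: d_def)
  have n: "nab (anc C u) e \<in> Ls" if "u \<in> S" "e \<in> Ls" for u e using that by auto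
  have c: "pair u v \<in> Cinf M" if "u \<in> Ls" "v \<in> Ls" for u v using that by auto
  have c1: "pair (e\<^sub>1 \<star> e\<^sub>2) e\<^sub>3 \<in> Cinf M" using L by auto
  \<comment> \<open>\<open>X1\<close>, \<open>B1\<close> and \<open>B2\<close> turn the derivative of the bracket term into \<open>D\<close>; \<open>K\<close> treats the connection terms.\<close>
  have X1: "der (j b) (pair (e\<^sub>1 \<star> e\<^sub>2) e\<^sub>3) = D b (e\<^sub>1 \<star> e\<^sub>2) e\<^sub>3 + pair (e\<^sub>1 \<star> e\<^sub>2) (d e\<^sub>3)"
    using D_metric[of b "e\<^sub>1 \<star> e\<^sub>2" e\<^sub>3] b L by (simp add: D_L d_def pair_sym[of "e\<^sub>1 \<star> e\<^sub>2"])
  have X2: "der (j b) (pair (nab (anc C u) v) w) = pair (d (nab (anc C u) v)) w + pair (nab (anc C u) v) (d w)"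
    if "u \<in> Ls" "v \<in> Ls" "w \<in> Ls" for u v w
    unfolding d_def using b that by (intro nab_metric) auto
  have X: "der (j b) (tor e\<^sub>1 e\<^sub>2 e\<^sub>3) = der (j b) (pair (e\<^sub>1 \<star> e\<^sub>2) e\<^sub>3) - der (j b) (pair (nab (anc C e\<^sub>1) e\<^sub>2) e\<^sub>3)
     + der (j b) (pair (nab (anc C e\<^sub>2) e\<^sub>1) e\<^sub>3) - der (j b) (pair (nab (anc C e\<^sub>3) e\<^sub>1) e\<^sub>2)"
    using b L c c1 n by (simp add: torsion_L der_add der_diff)
  have B2: "pair (e\<^sub>1 \<star> d e\<^sub>2) e\<^sub>3 = act e\<^sub>1 (D b e\<^sub>2 e\<^sub>3) - D b e\<^sub>2 (e\<^sub>1 \<star> e\<^sub>3)"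
    using act_pair[of e\<^sub>1 "d e\<^sub>2" e\<^sub>3] b L d by (simp add: D_L d_def)
  have B1: "pair (d e\<^sub>1 \<star> e\<^sub>2) e\<^sub>3 = act e\<^sub>3 (D b e\<^sub>1 e\<^sub>2) - (act e\<^sub>2 (D b e\<^sub>1 e\<^sub>3) - D b e\<^sub>1 (e\<^sub>2 \<star> e\<^sub>3))"
    using act_pair[of e\<^sub>2 "d e\<^sub>1" e\<^sub>3] pair_sym_brac[of "d e\<^sub>1" e\<^sub>2 e\<^sub>3] b L d
    by (simp add: D_L d_def algebra_simps)
  have K: "pair (curv (anc C u) (j b) v) w = pair (nab (anc C u) (d v)) w - pair (d (nab (anc C u) v)) w
      - (D (bott_E u b) v w - pair (nab (anc C (d u)) v) w)"
    if u: "u \<in> Ls" and v: "v \<in> Ls" and w: "w \<in> Ls" for u v w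
  proof -
    have VF: "anc C u \<in> VF" "lie_bracket (anc C u) (j b) \<in> VF" "anc C (d u) \<in> VF"
      using u b d by auto
    have "anc C (d u) = lie_bracket (j b) (anc C u) + j (bott_E u b)"
      using u b by (simp add: d_def nab_j anc_del)
    also have "lie_bracket (j b) (anc C u) = - lie_bracket (anc C u) (j b)"
      using u b by (intro lie_swap) auto
    finally have "lie_bracket (anc C u) (j b) + anc C (d u) = j (bott_E u b)"
      by (simp only: add_minus_cancel)
    then have "nab (lie_bracket (anc C u) (j b)) v + nab (anc C (d u)) v = nab (j (bott_E u b)) v"
      using nab_add[OF VF(2,3) v] by simp
    then have "pair (nab (lie_bracket (anc C u) (j b)) v) w + pair (nab (anc C (d u)) v) w = D (bott_E u b) v w"
      using u v w b VF by (simp add: D_L flip: pair_add_left)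
    then show ?thesis
      using u v w b VF by (simp add: pair_curv d_def algebra_simps)
  qed
  show ?thesis
    unfolding cov_deriv3_def X X1 X2[OF L] X2[OF L(2,1,3)] X2[OF L(3,1,2)] K[OF L] K[OF L(2,1,3)] K[OF L(3,1,2)] loday_d2_def
      d_def[symmetric]
    using L d by (simp add: torsion_L B1 B2 algebra_simps)
qed

text \<open>
  The identification of \<open>A\<^sub>E\<close> with \<open>\<G> \<oplus> F\<close> takes the class of \<open>e\<close> to its components, because the
  complement meets \<open>(ker \<rho>)\<^sup>\<bottom>\<close> in zero.
\<close>

lemma A_comp_prA:
  assumes "e \<in> S"
  shows "A_comp M C Q \<Psi> p (prA e p) = (cG e p, anc C e p)"
  unfolding A_comp_def
proof (rule the_equality)
  have fib: "cG e p \<in> Gf p" "anc C e p \<in> Ff p" using assms by (simp_all add: \<Gamma>G_fiber \<Gamma>F_fiber)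
  have "prA (Lpart e) = prA e"
    using assms diff_Lpart_N[of e] prA_eq_iff[of e "Lpart e"] by simp
  then have pr: "A_pr Q p (\<Psi> p (0, cG e p, anc C e p)) = prA e p"
    by (simp add: on_sec_def Lpart_def Lsec_def fun_eq_iff)
  then show "(cG e p, anc C e p) \<in> Gf p \<times> Ff p \<and> A_pr Q p (\<Psi> p (0, cG e p, anc C e p)) = prA e p"
    using fib by simp
  fix u assume u: "u \<in> Gf p \<times> Ff p \<and> A_pr Q p (\<Psi> p (0, u)) = prA e p"
  obtain r x where rx: "u = (r, x)" "r \<in> Gf p" "x \<in> Ff p" using u by (cases u) auto
  have d: "r - cG e p \<in> Gf p" "x - anc C e p \<in> Ff p"
    using rx fib subspace_diff[OF Ff_subspace] subspace_diff[OF fiber_subspace[OF manifold vector_bundle_G]] by auto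
  have in1: "\<Psi> p (0, r - cG e p, x - anc C e p) \<in> Ef p" "\<Psi> p (0, cG e p, anc C e p) \<in> Ef p"
    using d fib by (auto intro: Psi_in)
  have "\<Psi> p (0, r, x) = \<Psi> p (0, r - cG e p, x - anc C e p) + \<Psi> p (0, cG e p, anc C e p)"
    using Psi_add[OF Fd_0 d Fd_0 fib] by simp
  then have "A_pr Q p (\<Psi> p (0, r - cG e p, x - anc C e p)) = 0"
    using bundle_map_add[OF bundle_map_A in1] u pr rx by simp
  moreover have "\<forall>p. {u \<in> fiber (bun C) p. A_pr Q p u = 0} = ker_perp C p"
    using quotient_A unfolding quotient_bundle_def by (elim conjE)
  ultimately have "\<Psi> p (0, r - cG e p, x - anc C e p) \<in> ker_perp C p" using in1 by blast
  then show "u = (cG e p, anc C e p)" using ker_perp_iff[OF Fd_0 d] rx by simp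
qed

lemma A_lift_eq: "a \<in> \<Gamma>A \<Longrightarrow> A_lift M C Q \<Psi> a = Lpart (liftA a)"
  using A_comp_prA[of "liftA a"] by (simp add: A_lift_def Lpart_def Lsec_def prA_liftA)

lemma cG_curv_emb_G:
  assumes "X \<in> VF" "Y \<in> VF" "e \<in> Ls" "e' \<in> Ls"
  shows "gG (cG (curv X Y (emb_G \<Psi> (cG e)))) (cG e') = pair (curv X Y e) e'"
proof -
  have cv: "curv X Y (Lsec r y) = Lsec (nG X (nG Y r) - nG Y (nG X r) - nG (lie_bracket X Y) r)
      (nF X (nF Y y) - nF Y (nF X y) - nF (lie_bracket X Y) y)"
    if "r \<in> \<Gamma>G" "y \<in> \<Gamma>F" for r y
    using that assms by (simp add: curvature_def nab_Lsec Lsec_diff)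
  have "emb_G \<Psi> (cG e) = Lsec (cG e) 0" by (simp add: emb_G_def Lsec_def)
  moreover have "e = Lsec (cG e) (anc C e)" "e' = Lsec (cG e') (anc C e')"
    using assms Ls_Lpart[of e] Ls_Lpart[of e'] by (simp_all add: Lpart_def)
  ultimately show ?thesis
    using assms cv[of "cG e" 0] cv[of "cG e" "anc C e"]
      pair_Lsec[of "nG X (nG Y (cG e)) - nG Y (nG X (cG e)) - nG (lie_bracket X Y) (cG e)"
       "nF X (nF Y (anc C e)) - nF Y (nF X (anc C e)) - nF (lie_bracket X Y) (anc C e)" "cG e'" "anc C e'"]
    by simp
qed

lemma d_T_map_eq:
  assumes b: "b \<in> \<Gamma>B" and a: "a\<^sub>1 \<in> \<Gamma>A" "a\<^sub>2 \<in> \<Gamma>A" "a\<^sub>3 \<in> \<Gamma>A"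
  shows "d_T_map M C Q \<Psi> \<tau> b a\<^sub>1 a\<^sub>2 a\<^sub>3 = loday_d2 D b (liftA a\<^sub>1) (liftA a\<^sub>2) (liftA a\<^sub>3)"
proof -
  define e where "e a = Lpart (liftA a)" for a
  have e: "e a \<in> Ls" "anc C (e a) = anc C (liftA a)" "cG (e a) = cG (liftA a)" if "a \<in> \<Gamma>A" for a
    using that by (simp_all add: e_def Lpart_def)
  have comp: "(\<lambda>p. fst (A_comp M C Q \<Psi> p (a p))) = cG (e a)" "(\<lambda>p. snd (A_comp M C Q \<Psi> p (a p))) = anc C (e a)"
    if "a \<in> \<Gamma>A" for a
    using A_comp_prA[of "liftA a"] e[OF that] that by (simp_all add: prA_liftA)
  have "curv_form M C Q \<Psi> \<tau> b a\<^sub>1 a\<^sub>2 a\<^sub>3 =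
      pair (curv (anc C (e a\<^sub>1)) (j b) (e a\<^sub>2)) (e a\<^sub>3) + pair (curv (anc C (e a\<^sub>2)) (j b) (e a\<^sub>3)) (e a\<^sub>1)
      + pair (curv (anc C (e a\<^sub>3)) (j b) (e a\<^sub>1)) (e a\<^sub>2)"
    unfolding curv_form_def Let_def comp[OF a(1)] comp[OF a(2)] comp[OF a(3)]
    using a b e(1) by (simp add: cG_curv_emb_G)
  moreover have "pair (curv (anc C (e a\<^sub>2)) (j b) (e a\<^sub>3)) (e a\<^sub>1) = - pair (curv (anc C (e a\<^sub>2)) (j b) (e a\<^sub>1)) (e a\<^sub>3)"
    using a b e(1) by (intro pair_curv_skew) auto
  ultimately have "d_T_map M C Q \<Psi> \<tau> b a\<^sub>1 a\<^sub>2 a\<^sub>3 = loday_d2 D b (e a\<^sub>1) (e a\<^sub>2) (e a\<^sub>3)"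
    using cov_deriv3_torsion[OF b e(1)[OF a(1)] e(1)[OF a(2)] e(1)[OF a(3)]] a
    by (simp add: d_T_map_def A_lift_eq e_def)
  also have "\<dots> = loday_d2 D b (liftA a\<^sub>1) (liftA a\<^sub>2) (liftA a\<^sub>3)"
  proof -
    note cong = skew_form3_cong_3[OF skew_form3_loday_d2_D b] and rot = skew_form3_rotate[OF skew_form3_loday_d2_D b]
    have S: "e a \<in> S" "liftA a \<in> S" "liftA a - e a \<in> N" if "a \<in> \<Gamma>A" for a
      using that by (simp_all add: e_def)
    show ?thesis
      using cong[OF S(1)[OF a(1)] S(1)[OF a(2)] S(2)[OF a(3)] S(1)[OF a(3)] S(3)[OF a(3)]]
        cong[OF S(2)[OF a(3)] S(1)[OF a(1)] S(2)[OF a(2)] S(1)[OF a(2)] S(3)[OF a(2)]]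
        cong[OF S(2)[OF a(2)] S(2)[OF a(3)] S(2)[OF a(1)] S(1)[OF a(1)] S(3)[OF a(1)]]
        rot[OF S(2)[OF a(3)] S(1)[OF a(1)] S(1)[OF a(2)]] rot[OF S(2)[OF a(3)] S(1)[OF a(1)] S(2)[OF a(2)]]
        rot[OF S(1)[OF a(1)] S(2)[OF a(2)] S(2)[OF a(3)]] rot[OF S(2)[OF a(1)] S(2)[OF a(2)] S(2)[OF a(3)]]
      by simp
  qed
  finally show ?thesis .
qed

lemma d_T_eq: "d_T M C Q \<Psi> \<tau> = descend3 (loday_d2 D)"
proof (intro ext)
  fix as b p
  show "d_T M C Q \<Psi> \<tau> as b p = descend3 (loday_d2 D) as b p"
  proof (cases "as \<in> tuples (A_bun Q) 3 \<and> b \<in> \<Gamma>B")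
    case True
    then have "as ! 0 \<in> \<Gamma>A" "as ! 1 \<in> \<Gamma>A" "as ! 2 \<in> \<Gamma>A"
      using nth_mem[of 0 as] nth_mem[of 1 as] nth_mem[of 2 as] unfolding tuples_def by auto
    then show ?thesis using True by (simp add: d_T_def descend3_def d_T_map_eq)
  qed (auto simp: d_T_def descend3_def)
qed

lemma sum_apply: "(\<Sum>i\<in>I. f i) x = (\<Sum>i\<in>I. f i x)"
  by (induction I rule: infinite_finite_induct) simp_all

lemma ce_diff_outside:
  assumes "as \<notin> tuples (A_bun Q) (Suc k) \<or> b \<notin> \<Gamma>B" "\<And>as. b \<notin> \<Gamma>B \<Longrightarrow> \<omega> as b = 0"
  shows "ce_diff M C Q k \<omega> as b = 0"
  using assms by (auto simp: ce_diff_def dual_action_def sum_apply scaleR_apply)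

lemma d_T_cocycle: "d_T M C Q \<Psi> \<tau> \<in> ce_cocycles M C Q 3"
proof -
  have "ce_diff M C Q 3 (descend3 (loday_d2 D)) as b = 0" for as b
  proof (cases "as \<in> tuples (A_bun Q) (Suc 3) \<and> b \<in> \<Gamma>B")
    case True
    then have "length as = Suc (Suc (Suc (Suc 0)))" unfolding tuples_def by simp
    then obtain a\<^sub>1 a\<^sub>2 a\<^sub>3 a\<^sub>4 where as: "as = [a\<^sub>1, a\<^sub>2, a\<^sub>3, a\<^sub>4]"
      by (auto simp: length_Suc_conv)
    have a: "a\<^sub>1 \<in> \<Gamma>A" "a\<^sub>2 \<in> \<Gamma>A" "a\<^sub>3 \<in> \<Gamma>A" "a\<^sub>4 \<in> \<Gamma>A" and b: "b \<in> \<Gamma>B"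
      using True unfolding as tuples_def by auto
    show ?thesis unfolding as ce_diff_descend3[OF skew_form3_loday_d2_D a b]
      by (intro loday_d3_loday_d2[OF loday_cochain2_D b] liftA_S a)
  next
    case False
    then show ?thesis by (intro ce_diff_outside) (auto simp: descend3_def)
  qed
  then show ?thesis
    unfolding d_T_eq ce_cocycles_def using descend3_cochain[OF skew_form3_loday_d2_D] by (simp add: fun_eq_iff)
qed

end

section \<open>Change of the dissection and of the triple\<close>

locale two_choices = one: dissected_triple M C Q \<Psi> \<tau> + two: dissected_triple M C Q \<Psi>' \<tau>'
  for M :: "('m::{t2_space, second_countable_topology}, 'a::real_normed_vector) atlas"
    and C :: "('m, 'e::real_vector) courant"
    and Q :: "('m, 'e, 'w::real_vector, 'g::real_vector, 'b::real_vector) quots"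
    and \<Psi> \<Psi>' :: "('m, 'e, 'g) diss" and \<tau> \<tau>' :: "('m, 'g, 'b) triple"
begin

text \<open>
  The lift to \<open>E\<close> of the section \<open>j'(b) - j(b)\<close> of \<open>F\<close>, through the first dissection.
\<close>

definition u :: "('m \<Rightarrow> 'b) \<Rightarrow> 'm \<Rightarrow> 'e" where
  "u b = one.Lsec 0 (two.j b - one.j b)"

abbreviation \<theta> :: "('m \<Rightarrow> 'b) \<Rightarrow> ('m \<Rightarrow> 'e) \<Rightarrow> 'm \<Rightarrow> real" where
  "\<theta> b e \<equiv> one.pair (u b) e"

text \<open>
  The last term corrects the difference of the connections by the bracket with \<open>u\<^sub>b\<close>: for a metric
  family \<open>D\<close> along \<open>j\<close>, the family \<open>D - d \<theta>\<close> is a metric family along \<open>j'\<close>.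
\<close>

definition \<eta> :: "('m \<Rightarrow> 'b) \<Rightarrow> ('m \<Rightarrow> 'e) \<Rightarrow> ('m \<Rightarrow> 'e) \<Rightarrow> 'm \<Rightarrow> real" where
  "\<eta> b e e' = two.D b e e' - one.D b e e' + one.loday_d1 \<theta> b e e'"

lemma j_diff_\<Gamma>F: "b \<in> one.\<Gamma>B \<Longrightarrow> two.j b - one.j b \<in> one.\<Gamma>F"
  by (intro one.\<Gamma>F_I) (simp_all add: one.prB_diff)

lemma u_S[simp, intro]: "b \<in> one.\<Gamma>B \<Longrightarrow> u b \<in> one.S"
  unfolding u_def by (intro one.Lsec_closed j_diff_\<Gamma>F) auto

lemma anc_u: "b \<in> one.\<Gamma>B \<Longrightarrow> anc C (u b) = two.j b - one.j b"
  unfolding u_def by (intro one.anc_Lsec j_diff_\<Gamma>F) auto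

lemma u_add: "b \<in> one.\<Gamma>B \<Longrightarrow> b' \<in> one.\<Gamma>B \<Longrightarrow> u (b + b') = u b + u b'"
  using one.Lsec_add[of 0 "two.j b - one.j b" 0 "two.j b' - one.j b'"]
  by (simp add: u_def one.j_add two.j_add j_diff_\<Gamma>F algebra_simps)

lemma u_fscale: "b \<in> one.\<Gamma>B \<Longrightarrow> f \<in> Cinf M \<Longrightarrow> u (f \<odot> b) = f \<odot> u b"
  using one.Lsec_fscale[of 0 "two.j b - one.j b" f]
  by (simp add: u_def one.j_fscale two.j_fscale j_diff_\<Gamma>F fscale_diff_right fscale_zero_right)

lemma u_diff: "b \<in> one.\<Gamma>B \<Longrightarrow> b' \<in> one.\<Gamma>B \<Longrightarrow> u (b - b') = u b - u b'"
  using u_add[of "b - b'" b'] by simp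

lemma u_0[simp]: "u 0 = 0"
  using u_diff[of 0 0] by simp

lemma loday_cochain1_\<theta>: "one.loday_cochain1 \<theta>"
  unfolding one.loday_cochain1_def by (simp add: u_diff one.pair_diff_left one.pair_add_right)

lemma \<eta>_closed[simp, intro]: "b \<in> one.\<Gamma>B \<Longrightarrow> e \<in> one.S \<Longrightarrow> e' \<in> one.S \<Longrightarrow> \<eta> b e e' \<in> Cinf M"
  unfolding \<eta>_def one.loday_d1_def
  by (intro one.Cinf_closed one.der_closed one.pair_closed one.D_closed two.D_closed u_S
      one.bott_E_closed one.brac_closed one.anc_VF)

lemma \<eta>_skew:
  assumes b: "b \<in> one.\<Gamma>B" and e: "e \<in> one.S" "e' \<in> one.S"
  shows "\<eta> b e e' = - \<eta> b e' e"
proof -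
  have s: "\<theta> b (brac C e e') + \<theta> b (brac C e' e) = der (anc C (u b)) (one.pair e e')"
    using one.pair_sym_brac[of e e' "u b"] b e by (simp add: one.pair_sym[of "u b"])
  have "\<eta> b e e' + \<eta> b e' e = (two.D b e e' + two.D b e' e) - (one.D b e e' + one.D b e' e)
      - (\<theta> b (brac C e e') + \<theta> b (brac C e' e))"
    by (simp add: \<eta>_def one.loday_d1_def)
  also have "\<dots> = 0"
    using b e by (simp add: s one.D_metric two.D_metric anc_u der_minus)
  finally show ?thesis by (simp add: eq_neg_iff_add_eq_0)
qed

text \<open>
  Again all terms combine to the pairing of \<open>s\<close> with a section \<open>z\<close>, whose anchor vanishes since \<open>\<nabla>\<close>
  and \<open>\<nabla>'\<close> have the same defect from compatibility with the anchor, up to the choice of the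
  splitting.
\<close>

lemma \<eta>_N:
  assumes b: "b \<in> one.\<Gamma>B" and e: "e \<in> one.S" and s: "s \<in> one.N"
  shows "\<eta> b e s = 0"
proof -
  define z where "z = two.del b e - one.del b e + brac C e (u b) - u (one.bott_E e b)"
  have z: "z \<in> one.S" using b e by (simp add: z_def)
  have "one.loday_d1 \<theta> b e s = one.pair (brac C e (u b) - u (one.bott_E e b)) s"
    using b e s by (simp add: one.loday_d1_def one.act_pair der_zero one.pair_diff_left)
  then have "\<eta> b e s = one.pair z s"
    using b e s by (simp add: \<eta>_def z_def one.D_N two.D_N one.pair_add_left one.pair_diff_left)
  also have "\<dots> = 0"
  proof (rule one.pair_N_ker(2)[OF s z])
    have "anc C z = (lie_bracket (two.j b) (anc C e) + two.j (one.bott_E e b))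
        - (lie_bracket (one.j b) (anc C e) + one.j (one.bott_E e b))
        + lie_bracket (anc C e) (two.j b - one.j b) - (two.j (one.bott_E e b) - one.j (one.bott_E e b))"
      using b e by (simp add: z_def one.anc_diff one.anc_add one.anc_brac one.anc_del two.anc_del anc_u)
    also have "\<dots> = 0"
      by (rule one.VF_eqI) (use b e in \<open>simp_all add: one.der_simps\<close>)
    finally show "anc C z = 0" .
  qed
  finally show ?thesis .
qed

lemma skew_form2_\<eta>: "one.skew_form2 \<eta>"
  unfolding one.skew_form2_def
proof (intro conjI ballI)
  fix b b' e e' assume "b \<in> one.\<Gamma>B" "b' \<in> one.\<Gamma>B" "e \<in> one.S" "e' \<in> one.S"
  then show "\<eta> (b + b') e e' = \<eta> b e e' + \<eta> b' e e'"
    by (simp add: \<eta>_def one.loday_d1_def one.D_add_b two.D_add_b u_add one.bott_E_add_right one.pair_add_left one.der_add)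
next
  fix f b e e' assume "f \<in> Cinf M" "b \<in> one.\<Gamma>B" "e \<in> one.S" "e' \<in> one.S"
  then show "\<eta> (f \<odot> b) e e' = f * \<eta> b e e'"
    by (simp add: \<eta>_def one.loday_d1_def one.D_fscale_b two.D_fscale_b u_fscale u_add one.bott_E_fscale_right
        one.pair_fscale_left one.pair_add_left one.der_mult algebra_simps)
next
  fix b e s t assume "b \<in> one.\<Gamma>B" "e \<in> one.S" "s \<in> one.S" "t \<in> one.S"
  then show "\<eta> b e (s + t) = \<eta> b e s + \<eta> b e t"
    by (simp add: \<eta>_def one.loday_d1_def one.D_add_right two.D_add_right u_add one.bott_E_add_left
        one.pair_add_left one.pair_add_right one.der_add one.act_add one.brac_add_right)
next
  fix f b e s assume "f \<in> Cinf M" "b \<in> one.\<Gamma>B" "e \<in> one.S" "s \<in> one.S"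
  then show "\<eta> b e (f \<odot> s) = f * \<eta> b e s"
    by (simp add: \<eta>_def one.loday_d1_def one.D_fscale_right two.D_fscale_right u_fscale one.bott_E_fscale_left
        one.pair_fscale_left one.pair_fscale_right one.pair_add_right one.der_mult one.act_fscale one.brac_fscale
        algebra_simps)
qed ((rule \<eta>_closed \<eta>_skew \<eta>_N; assumption)+)

text \<open>
  The term \<open>d \<theta>\<close> of \<open>\<eta>\<close> is invisible here, by \<open>d\<^sup>2 = 0\<close>.
\<close>

lemma loday_d2_D_change:
  assumes b: "b \<in> one.\<Gamma>B" and e: "e\<^sub>1 \<in> one.S" "e\<^sub>2 \<in> one.S" "e\<^sub>3 \<in> one.S"
  shows "one.loday_d2 two.D b e\<^sub>1 e\<^sub>2 e\<^sub>3 = one.loday_d2 one.D b e\<^sub>1 e\<^sub>2 e\<^sub>3 + one.loday_d2 \<eta> b e\<^sub>1 e\<^sub>2 e\<^sub>3"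
proof -
  have c: "one.loday_d1 \<theta> b' x y \<in> Cinf M" if "b' \<in> one.\<Gamma>B" "x \<in> one.S" "y \<in> one.S" for b' x y
    unfolding one.loday_d1_def using that
    by (intro one.Cinf_closed one.der_closed one.pair_closed u_S one.bott_E_closed one.brac_closed one.anc_VF)
  have "one.loday_d2 \<eta> b e\<^sub>1 e\<^sub>2 e\<^sub>3 = one.loday_d2 two.D b e\<^sub>1 e\<^sub>2 e\<^sub>3 - one.loday_d2 one.D b e\<^sub>1 e\<^sub>2 e\<^sub>3
      + one.loday_d2 (one.loday_d1 \<theta>) b e\<^sub>1 e\<^sub>2 e\<^sub>3"
    using b e c by (simp add: one.loday_d2_def \<eta>_def one.der_add one.der_diff)
  then show ?thesis using one.loday_d2_loday_d1[OF loday_cochain1_\<theta> b e] by simp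
qed

lemma d_T_change: "d_T M C Q \<Psi>' \<tau>' = d_T M C Q \<Psi> \<tau> + ce_diff M C Q 2 (one.descend2 \<eta>)"
proof (intro ext)
  fix as b
  have "d_T M C Q \<Psi>' \<tau>' as b = d_T M C Q \<Psi> \<tau> as b + ce_diff M C Q 2 (one.descend2 \<eta>) as b"
  proof (cases "as \<in> tuples (A_bun Q) (Suc 2) \<and> b \<in> one.\<Gamma>B")
    case True
    then have "length as = Suc (Suc (Suc 0))" unfolding tuples_def by simp
    then obtain a\<^sub>1 a\<^sub>2 a\<^sub>3 where as: "as = [a\<^sub>1, a\<^sub>2, a\<^sub>3]"
      by (auto simp: length_Suc_conv)
    have a: "a\<^sub>1 \<in> one.\<Gamma>A" "a\<^sub>2 \<in> one.\<Gamma>A" "a\<^sub>3 \<in> one.\<Gamma>A" and b: "b \<in> one.\<Gamma>B"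
      using True unfolding as tuples_def by auto
    have t: "[a\<^sub>1, a\<^sub>2, a\<^sub>3] \<in> tuples (A_bun Q) 3" using a unfolding tuples_def by simp
    show ?thesis
      unfolding as one.ce_diff_descend2[OF skew_form2_\<eta> a b]
      using t a b loday_d2_D_change[OF b, of "one.liftA a\<^sub>1" "one.liftA a\<^sub>2" "one.liftA a\<^sub>3"]
      by (simp add: one.d_T_eq two.d_T_eq one.descend3_def)
  next
    case False
    then have "ce_diff M C Q 2 (one.descend2 \<eta>) as b = 0"
      by (intro one.ce_diff_outside) (auto simp: one.descend2_def)
    moreover have "as \<notin> tuples (A_bun Q) 3 \<or> b \<notin> one.\<Gamma>B"
      using False by (simp add: numeral_3_eq_3 numeral_2_eq_2)
    ultimately show ?thesis
      by (auto simp: one.d_T_eq two.d_T_eq one.descend3_def)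
  qed
  then show "d_T M C Q \<Psi>' \<tau>' as b p = (d_T M C Q \<Psi> \<tau> + ce_diff M C Q 2 (one.descend2 \<eta>)) as b p" for p
    by simp
qed

lemma class_eq: "ce_class M C Q 3 (d_T M C Q \<Psi> \<tau>) = ce_class M C Q 3 (d_T M C Q \<Psi>' \<tau>')"
  by (rule one.ce_class_eqI[OF one.descend2_cochain[OF skew_form2_\<eta>] d_T_change])

end

theorem proposition4p8:
  fixes M :: "('m::{t2_space, second_countable_topology}, 'a::real_normed_vector) atlas"
    and C :: "('m, 'e::real_vector) courant"
    and Q :: "('m, 'e, 'w::real_vector, 'g::real_vector, 'b::real_vector) quots"
  assumes "smooth_manifold M" and "connected (UNIV :: 'm set)"
    and "courant_algebroid M C" and "regular C"
    and "quotients_of M C Q"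
  shows "(\<forall>\<Psi> \<tau>. dissection M C Q \<Psi> \<and> is_triple M C Q \<tau> \<longrightarrow>
            d_T M C Q \<Psi> \<tau> \<in> ce_cocycles M C Q 3) \<and>
         (\<forall>\<Psi> \<tau> \<Psi>' \<tau>'. dissection M C Q \<Psi> \<and> is_triple M C Q \<tau> \<and>
            dissection M C Q \<Psi>' \<and> is_triple M C Q \<tau>' \<longrightarrow>
            ce_class M C Q 3 (d_T M C Q \<Psi> \<tau>) = ce_class M C Q 3 (d_T M C Q \<Psi>' \<tau>'))"
proof -
  have setting: "dissected_triple M C Q \<Psi> \<tau>" if "dissection M C Q \<Psi>" "is_triple M C Q \<tau>" for \<Psi> \<tau>
    using assms that by unfold_locales
  show ?thesis
  proof (intro conjI allI impI)
    fix \<Psi> \<tau> assume "dissection M C Q \<Psi> \<and> is_triple M C Q \<tau>"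
    then show "d_T M C Q \<Psi> \<tau> \<in> ce_cocycles M C Q 3"
      using dissected_triple.d_T_cocycle[OF setting] by blast
  next
    fix \<Psi> \<tau> \<Psi>' \<tau>'
    assume "dissection M C Q \<Psi> \<and> is_triple M C Q \<tau> \<and> dissection M C Q \<Psi>' \<and> is_triple M C Q \<tau>'"
    then have "two_choices M C Q \<Psi> \<Psi>' \<tau> \<tau>'"
      by (intro two_choices.intro setting) auto
    then show "ce_class M C Q 3 (d_T M C Q \<Psi> \<tau>) = ce_class M C Q 3 (d_T M C Q \<Psi>' \<tau>')"
      by (rule two_choices.class_eq)
  qed
qed

end
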